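(* Let $n\geqslant 2$ and let $\mathcal{C}$ be an idempotent complete additive category, regarded as an exact category $(\mathcal{C},\mathscr{E}^t)$ with the trivial exact structure. Then $(\mathcal{C}[\epsilon]^n,\mathscr{E}_F^t)$ is a Frobenius category and its stable category $\underline{\mathcal{C}[\epsilon]^n}$ is a triangulated category.
   Context: The category $\mathcal{C}[\epsilon]^n$ has as objects pairs $(X,\epsilon_X)$ with $X\in\mathcal{C}$, $\epsilon_X\in\operatorname{End}_{\mathcal{C}}(X)$, $\epsilon_X^n=0$; morphisms $(X,\epsilon_X)\to(Y,\epsilon_Y)$ are morphisms $f:X\to Y$ in $\mathcal{C}$ with $f\epsilon_X=\epsilon_Yf$. $\mathcal{C}$ is idempotent complete if every idempotent $e\in\operatorname{End}(X)$ factors as $e=\iota\pi$ with $\pi:X\to Y$, $\iota:Y\to X$, $\pi\iota=1_Y$. The trivial exact structure $\mathscr{E}^t$ on $\mathcal{C}$ is the (Quillen) exact structure whose short exact sequences are the split ones; $\mathscr{E}_F^t$ is the class of pairs of composable morphisms in $\mathcal{C}[\epsilon]^n$ that become split short exact sequences in $\mathcal{C}$ under the forgetful functor $F:(X,\epsilon_X)\mapsto X$. An exact category is Frobenius if it has enough projectives and enough injectives and the projective objects coincide with the injective objects (with respect to its exact structure). The stable category $\underline{\mathcal{B}}$ of a Frobenius category $\mathcal{B}$ has the same objects as $\mathcal{B}$, and $\operatorname{Hom}_{\underline{\mathcal{B}}}(A,B)$ is $\operatorname{Hom}_{\mathcal{B}}(A,B)$ modulo the morphisms factoring through a projective object. The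 triangulated structure meant is Happel's standard one on the stable category of a Frobenius category. *)

theory Defs
  imports "HOL-Algebra.Coset"
begin

text \<open>
  Categories are small: objects and arrows are sets inside arbitrary types. Every arrow carries its
  source and target, so distinct hom-sets are disjoint; composition is written in the
  order \<open>g \<cdot> f\<close> (first \<open>f\<close>). The operations are only meaningful on composable, respectively parallel,
  arrows.
\<close>

record ('o, 'm) precat =
  Obj :: "'o set"
  Arr :: "'m set"
  Src :: "'m \<Rightarrow> 'o"
  Tgt :: "'m \<Rightarrow> 'o"
  Ident :: "'o \<Rightarrow> 'm"
  Comp :: "'m \<Rightarrow> 'm \<Rightarrow> 'm"  (infixr "\<cdot>\<index>" 70)
  Add :: "'m \<Rightarrow> 'm \<Rightarrow> 'm"  (infixl "\<oplus>\<index>" 65)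
  Zero :: "'o \<Rightarrow> 'o \<Rightarrow> 'm"

definition Hom :: "('o, 'm) precat \<Rightarrow> 'o \<Rightarrow> 'o \<Rightarrow> 'm set" where
  "Hom C X Y = {f \<in> Arr C. Src C f = X \<and> Tgt C f = Y}"

definition hom_group :: "('o, 'm) precat \<Rightarrow> 'o \<Rightarrow> 'o \<Rightarrow> 'm monoid" where
  "hom_group C X Y = \<lparr>carrier = Hom C X Y, mult = Add C, one = Zero C X Y\<rparr>"

definition neg :: "('o, 'm) precat \<Rightarrow> 'm \<Rightarrow> 'm" where
  "neg C f = inv\<^bsub>hom_group C (Src C f) (Tgt C f)\<^esub> f"


section \<open>Additive categories\<close>

locale category =
  fixes C :: "('o, 'm) precat" (structure)
  assumes src_obj: "f \<in> Arr C \<Longrightarrow> Src C f \<in> Obj C"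
    and tgt_obj: "f \<in> Arr C \<Longrightarrow> Tgt C f \<in> Obj C"
    and ident_hom: "X \<in> Obj C \<Longrightarrow> Ident C X \<in> Hom C X X"
    and comp_hom: "\<lbrakk>f \<in> Hom C X Y; g \<in> Hom C Y Z\<rbrakk> \<Longrightarrow> g \<cdot> f \<in> Hom C X Z"
    and comp_assoc: "\<lbrakk>f \<in> Hom C W X; g \<in> Hom C X Y; h \<in> Hom C Y Z\<rbrakk>
          \<Longrightarrow> (h \<cdot> g) \<cdot> f = h \<cdot> (g \<cdot> f)"
    and comp_ident_left: "f \<in> Hom C X Y \<Longrightarrow> Ident C Y \<cdot> f = f"
    and comp_ident_right: "f \<in> Hom C X Y \<Longrightarrow> f \<cdot> Ident C X = f"

locale preadditive_category = category +
  assumes hom_comm_group: "\<lbrakk>X \<in> Obj C; Y \<in> Obj C\<rbrakk> \<Longrightarrow> comm_group (hom_group C X Y)"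
    and comp_add_left: "\<lbrakk>f \<in> Hom C X Y; g \<in> Hom C Y Z; g' \<in> Hom C Y Z\<rbrakk>
          \<Longrightarrow> (g \<oplus> g') \<cdot> f = (g \<cdot> f) \<oplus> (g' \<cdot> f)"
    and comp_add_right: "\<lbrakk>f \<in> Hom C X Y; f' \<in> Hom C X Y; g \<in> Hom C Y Z\<rbrakk>
          \<Longrightarrow> g \<cdot> (f \<oplus> f') = (g \<cdot> f) \<oplus> (g \<cdot> f')"

definition zero_object :: "('o, 'm) precat \<Rightarrow> 'o \<Rightarrow> bool" where
  "zero_object C Z \<longleftrightarrow> Z \<in> Obj C \<and>
     (\<forall>X \<in> Obj C. (\<exists>!f. f \<in> Hom C X Z) \<and> (\<exists>!f. f \<in> Hom C Z X))"

definition biproduct ::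
  "('o, 'm) precat \<Rightarrow> 'o \<Rightarrow> 'o \<Rightarrow> 'o \<Rightarrow> 'm \<Rightarrow> 'm \<Rightarrow> 'm \<Rightarrow> 'm \<Rightarrow> bool" where
  "biproduct C X Y W i j p q \<longleftrightarrow>
     X \<in> Obj C \<and> Y \<in> Obj C \<and> W \<in> Obj C \<and>
     i \<in> Hom C X W \<and> j \<in> Hom C Y W \<and> p \<in> Hom C W X \<and> q \<in> Hom C W Y \<and>
     p \<cdot>\<^bsub>C\<^esub> i = Ident C X \<and> q \<cdot>\<^bsub>C\<^esub> j = Ident C Y \<and>
     p \<cdot>\<^bsub>C\<^esub> j = Zero C Y X \<and> q \<cdot>\<^bsub>C\<^esub> i = Zero C X Y \<and>
     (i \<cdot>\<^bsub>C\<^esub> p) \<oplus>\<^bsub>C\<^esub> (j \<cdot>\<^bsub>C\<^esub> q) = Ident C W"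

locale additive_category = preadditive_category +
  assumes ex_zero_object: "\<exists>Z. zero_object C Z"
    and ex_biproduct: "\<lbrakk>X \<in> Obj C; Y \<in> Obj C\<rbrakk> \<Longrightarrow> \<exists>W i j p q. biproduct C X Y W i j p q"

definition idempotent_complete :: "('o, 'm) precat \<Rightarrow> bool" where
  "idempotent_complete C \<longleftrightarrow>
     (\<forall>X \<in> Obj C. \<forall>e \<in> Hom C X X. e \<cdot>\<^bsub>C\<^esub> e = e \<longrightarrow>
        (\<exists>Y \<in> Obj C. \<exists>p \<in> Hom C X Y. \<exists>i \<in> Hom C Y X. e = i \<cdot>\<^bsub>C\<^esub> p \<and> p \<cdot>\<^bsub>C\<^esub> i = Ident C Y))"

definition iso_arr :: "('o, 'm) precat \<Rightarrow> 'm \<Rightarrow> bool" where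
  "iso_arr C f \<longleftrightarrow> f \<in> Arr C \<and>
     (\<exists>g \<in> Hom C (Tgt C f) (Src C f).
        g \<cdot>\<^bsub>C\<^esub> f = Ident C (Src C f) \<and> f \<cdot>\<^bsub>C\<^esub> g = Ident C (Tgt C f))"


section \<open>Exact categories\<close>

definition is_kernel :: "('o, 'm) precat \<Rightarrow> 'm \<Rightarrow> 'm \<Rightarrow> bool" where
  "is_kernel C i p \<longleftrightarrow> i \<in> Arr C \<and> p \<in> Arr C \<and> Tgt C i = Src C p \<and>
     p \<cdot>\<^bsub>C\<^esub> i = Zero C (Src C i) (Tgt C p) \<and>
     (\<forall>f \<in> Arr C. Tgt C f = Src C p \<and> p \<cdot>\<^bsub>C\<^esub> f = Zero C (Src C f) (Tgt C p) \<longrightarrow>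
        (\<exists>!g. g \<in> Hom C (Src C f) (Src C i) \<and> i \<cdot>\<^bsub>C\<^esub> g = f))"

definition is_cokernel :: "('o, 'm) precat \<Rightarrow> 'm \<Rightarrow> 'm \<Rightarrow> bool" where
  "is_cokernel C p i \<longleftrightarrow> i \<in> Arr C \<and> p \<in> Arr C \<and> Tgt C i = Src C p \<and>
     p \<cdot>\<^bsub>C\<^esub> i = Zero C (Src C i) (Tgt C p) \<and>
     (\<forall>f \<in> Arr C. Src C f = Tgt C i \<and> f \<cdot>\<^bsub>C\<^esub> i = Zero C (Src C i) (Tgt C f) \<longrightarrow>
        (\<exists>!g. g \<in> Hom C (Tgt C p) (Tgt C f) \<and> g \<cdot>\<^bsub>C\<^esub> p = f))"

text \<open>\<open>is_pushout C f g f' g'\<close>: the square \<open>f' \<cdot> f = g' \<cdot> g\<close> is a push-out of the span \<open>(f, g)\<close>, so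
  \<open>g'\<close> is the push-out of \<open>f\<close> along \<open>g\<close>. Dually, in \<open>is_pullback C f g f' g'\<close> the square is
  \<open>f \<cdot> f' = g \<cdot> g'\<close>, and \<open>g'\<close> is the pull-back of \<open>f\<close> along \<open>g\<close>.\<close>

definition is_pushout :: "('o, 'm) precat \<Rightarrow> 'm \<Rightarrow> 'm \<Rightarrow> 'm \<Rightarrow> 'm \<Rightarrow> bool" where
  "is_pushout C f g f' g' \<longleftrightarrow>
     f \<in> Arr C \<and> g \<in> Arr C \<and> f' \<in> Arr C \<and> g' \<in> Arr C \<and>
     Src C f = Src C g \<and> Src C f' = Tgt C f \<and> Src C g' = Tgt C g \<and> Tgt C f' = Tgt C g' \<and>
     f' \<cdot>\<^bsub>C\<^esub> f = g' \<cdot>\<^bsub>C\<^esub> g \<and>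
     (\<forall>a \<in> Arr C. \<forall>b \<in> Arr C.
        Src C a = Tgt C f \<and> Src C b = Tgt C g \<and> Tgt C a = Tgt C b \<and> a \<cdot>\<^bsub>C\<^esub> f = b \<cdot>\<^bsub>C\<^esub> g \<longrightarrow>
        (\<exists>!h. h \<in> Hom C (Tgt C f') (Tgt C a) \<and> h \<cdot>\<^bsub>C\<^esub> f' = a \<and> h \<cdot>\<^bsub>C\<^esub> g' = b))"

definition is_pullback :: "('o, 'm) precat \<Rightarrow> 'm \<Rightarrow> 'm \<Rightarrow> 'm \<Rightarrow> 'm \<Rightarrow> bool" where
  "is_pullback C f g f' g' \<longleftrightarrow>
     f \<in> Arr C \<and> g \<in> Arr C \<and> f' \<in> Arr C \<and> g' \<in> Arr C \<and>
     Tgt C f = Tgt C g \<and> Tgt C f' = Src C f \<and> Tgt C g' = Src C g \<and> Src C f' = Src C g' \<and>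
     f \<cdot>\<^bsub>C\<^esub> f' = g \<cdot>\<^bsub>C\<^esub> g' \<and>
     (\<forall>a \<in> Arr C. \<forall>b \<in> Arr C.
        Tgt C a = Src C f \<and> Tgt C b = Src C g \<and> Src C a = Src C b \<and> f \<cdot>\<^bsub>C\<^esub> a = g \<cdot>\<^bsub>C\<^esub> b \<longrightarrow>
        (\<exists>!h. h \<in> Hom C (Src C a) (Src C f') \<and> f' \<cdot>\<^bsub>C\<^esub> h = a \<and> g' \<cdot>\<^bsub>C\<^esub> h = b))"

definition adm_mono :: "('m \<times> 'm) set \<Rightarrow> 'm \<Rightarrow> bool" where
  "adm_mono E i \<longleftrightarrow> (\<exists>p. (i, p) \<in> E)"

definition adm_epi :: "('m \<times> 'm) set \<Rightarrow> 'm \<Rightarrow> bool" where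
  "adm_epi E p \<longleftrightarrow> (\<exists>i. (i, p) \<in> E)"

text \<open>Quillen's axioms in the self-dual form of Keller and Buehler (Quillen's redundant
  third axiom is omitted).\<close>

locale exact_category = additive_category +
  fixes E :: "('m \<times> 'm) set"
  assumes kernel_cokernel: "(i, p) \<in> E \<Longrightarrow> is_kernel C i p \<and> is_cokernel C p i"
    and iso_closed: "\<lbrakk>(i, p) \<in> E; i' \<in> Arr C; p' \<in> Arr C; Tgt C i' = Src C p';
           iso_arr C a; iso_arr C b; iso_arr C c;
           a \<in> Hom C (Src C i) (Src C i'); b \<in> Hom C (Tgt C i) (Tgt C i');
           c \<in> Hom C (Tgt C p) (Tgt C p');
           b \<cdot> i = i' \<cdot> a; c \<cdot> p = p' \<cdot> b\<rbrakk> \<Longrightarrow> (i', p') \<in> E"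
    and ident_adm_mono: "X \<in> Obj C \<Longrightarrow> adm_mono E (Ident C X)"
    and ident_adm_epi: "X \<in> Obj C \<Longrightarrow> adm_epi E (Ident C X)"
    and comp_adm_mono: "\<lbrakk>adm_mono E i; adm_mono E j; Tgt C i = Src C j\<rbrakk> \<Longrightarrow> adm_mono E (j \<cdot> i)"
    and comp_adm_epi: "\<lbrakk>adm_epi E p; adm_epi E q; Tgt C p = Src C q\<rbrakk> \<Longrightarrow> adm_epi E (q \<cdot> p)"
    and pushout_adm_mono: "\<lbrakk>adm_mono E i; f \<in> Arr C; Src C f = Src C i\<rbrakk>
          \<Longrightarrow> \<exists>f' i'. is_pushout C i f f' i' \<and> adm_mono E i'"
    and pullback_adm_epi: "\<lbrakk>adm_epi E p; f \<in> Arr C; Tgt C f = Tgt C p\<rbrakk>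
          \<Longrightarrow> \<exists>f' p'. is_pullback C p f f' p' \<and> adm_epi E p'"

text \<open>The split short exact sequences: those of the form \<open>X \<rightarrow> X \<oplus> Z \<rightarrow> Z\<close>, the maps being the
  inclusion and the projection of some biproduct diagram on the middle term.\<close>

definition trivial_exact :: "('o, 'm) precat \<Rightarrow> ('m \<times> 'm) set" where
  "trivial_exact C = {(i, p). i \<in> Arr C \<and> p \<in> Arr C \<and> Tgt C i = Src C p \<and>
     (\<exists>s r. biproduct C (Src C i) (Tgt C p) (Tgt C i) i s r p)}"


section \<open>Frobenius categories\<close>

definition projective_obj :: "('o, 'm) precat \<Rightarrow> ('m \<times> 'm) set \<Rightarrow> 'o \<Rightarrow> bool" where
  "projective_obj B E P \<longleftrightarrow> P \<in> Obj B \<and>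
     (\<forall>p f. adm_epi E p \<and> f \<in> Hom B P (Tgt B p) \<longrightarrow> (\<exists>g \<in> Hom B P (Src B p). p \<cdot>\<^bsub>B\<^esub> g = f))"

definition injective_obj :: "('o, 'm) precat \<Rightarrow> ('m \<times> 'm) set \<Rightarrow> 'o \<Rightarrow> bool" where
  "injective_obj B E I \<longleftrightarrow> I \<in> Obj B \<and>
     (\<forall>i f. adm_mono E i \<and> f \<in> Hom B (Src B i) I \<longrightarrow> (\<exists>g \<in> Hom B (Tgt B i) I. g \<cdot>\<^bsub>B\<^esub> i = f))"

definition enough_projectives :: "('o, 'm) precat \<Rightarrow> ('m \<times> 'm) set \<Rightarrow> bool" where
  "enough_projectives B E \<longleftrightarrow>
     (\<forall>X \<in> Obj B. \<exists>p. adm_epi E p \<and> Tgt B p = X \<and> projective_obj B E (Src B p))"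

definition enough_injectives :: "('o, 'm) precat \<Rightarrow> ('m \<times> 'm) set \<Rightarrow> bool" where
  "enough_injectives B E \<longleftrightarrow>
     (\<forall>X \<in> Obj B. \<exists>i. adm_mono E i \<and> Src B i = X \<and> injective_obj B E (Tgt B i))"

definition frobenius_category :: "('o, 'm) precat \<Rightarrow> ('m \<times> 'm) set \<Rightarrow> bool" where
  "frobenius_category B E \<longleftrightarrow> exact_category B E \<and>
     enough_projectives B E \<and> enough_injectives B E \<and>
     (\<forall>X. projective_obj B E X \<longleftrightarrow> injective_obj B E X)"


section \<open>The stable category\<close>

definition proj_ideal :: "('o, 'm) precat \<Rightarrow> ('m \<times> 'm) set \<Rightarrow> 'o \<Rightarrow> 'o \<Rightarrow> 'm set" where
  "proj_ideal B E X Y =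
     {h \<cdot>\<^bsub>B\<^esub> g | g h. \<exists>P. projective_obj B E P \<and> g \<in> Hom B X P \<and> h \<in> Hom B P Y}"

text \<open>Residue classes are tagged with source and target, so that these are functions of the arrow.\<close>

definition stable_class :: "('o, 'm) precat \<Rightarrow> ('m \<times> 'm) set \<Rightarrow> 'm \<Rightarrow> 'o \<times> 'm set \<times> 'o" where
  "stable_class B E f =
     (Src B f,
      proj_ideal B E (Src B f) (Tgt B f) #>\<^bsub>hom_group B (Src B f) (Tgt B f)\<^esub> f,
      Tgt B f)"

definition rep :: "'o \<times> 'm set \<times> 'o \<Rightarrow> 'm" where
  "rep F = (SOME f. f \<in> fst (snd F))"

definition stable_cat :: "('o, 'm) precat \<Rightarrow> ('m \<times> 'm) set \<Rightarrow> ('o, 'o \<times> 'm set \<times> 'o) precat" where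
  "stable_cat B E =
     \<lparr>Obj = Obj B,
      Arr = stable_class B E ` Arr B,
      Src = fst,
      Tgt = snd \<circ> snd,
      Ident = (\<lambda>X. stable_class B E (Ident B X)),
      Comp = (\<lambda>G F. stable_class B E (rep G \<cdot>\<^bsub>B\<^esub> rep F)),
      Add = (\<lambda>F G. stable_class B E (rep F \<oplus>\<^bsub>B\<^esub> rep G)),
      Zero = (\<lambda>X Y. stable_class B E (Zero B X Y))\<rparr>"


section \<open>Triangulated categories\<close>

definition additive_functor ::
  "('o, 'm) precat \<Rightarrow> ('p, 'k) precat \<Rightarrow> ('o \<Rightarrow> 'p) \<Rightarrow> ('m \<Rightarrow> 'k) \<Rightarrow> bool" where
  "additive_functor C D Fo Fa \<longleftrightarrow>
     (\<forall>X \<in> Obj C. Fo X \<in> Obj D \<and> Fa (Ident C X) = Ident D (Fo X)) \<and>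
     (\<forall>f \<in> Arr C. Fa f \<in> Hom D (Fo (Src C f)) (Fo (Tgt C f))) \<and>
     (\<forall>f \<in> Arr C. \<forall>g \<in> Arr C. Tgt C f = Src C g \<longrightarrow> Fa (g \<cdot>\<^bsub>C\<^esub> f) = Fa g \<cdot>\<^bsub>D\<^esub> Fa f) \<and>
     (\<forall>f \<in> Arr C. \<forall>g \<in> Arr C. Src C f = Src C g \<and> Tgt C f = Tgt C g \<longrightarrow>
        Fa (f \<oplus>\<^bsub>C\<^esub> g) = Fa f \<oplus>\<^bsub>D\<^esub> Fa g)"

definition naturally_isomorphic ::
  "('o, 'm) precat \<Rightarrow> ('p, 'k) precat \<Rightarrow> ('o \<Rightarrow> 'p) \<Rightarrow> ('m \<Rightarrow> 'k) \<Rightarrow> ('o \<Rightarrow> 'p) \<Rightarrow> ('m \<Rightarrow> 'k) \<Rightarrow> bool"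
where
  "naturally_isomorphic C D Fo Fa Go Ga \<longleftrightarrow>
     (\<exists>t. (\<forall>X \<in> Obj C. t X \<in> Hom D (Fo X) (Go X) \<and> iso_arr D (t X)) \<and>
          (\<forall>f \<in> Arr C. t (Tgt C f) \<cdot>\<^bsub>D\<^esub> Fa f = Ga f \<cdot>\<^bsub>D\<^esub> t (Src C f)))"

definition autoequivalence :: "('o, 'm) precat \<Rightarrow> ('o \<Rightarrow> 'o) \<Rightarrow> ('m \<Rightarrow> 'm) \<Rightarrow> bool" where
  "autoequivalence C So Sa \<longleftrightarrow> additive_functor C C So Sa \<and>
     (\<exists>Go Ga. additive_functor C C Go Ga \<and>
        naturally_isomorphic C C (Go \<circ> So) (Ga \<circ> Sa) id id \<and>
        naturally_isomorphic C C (So \<circ> Go) (Sa \<circ> Ga) id id)"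

definition triangle :: "('o, 'm) precat \<Rightarrow> ('o \<Rightarrow> 'o) \<Rightarrow> 'm \<times> 'm \<times> 'm \<Rightarrow> bool" where
  "triangle C So = (\<lambda>(u, v, w). u \<in> Arr C \<and> v \<in> Arr C \<and> w \<in> Arr C \<and>
     Src C v = Tgt C u \<and> Src C w = Tgt C v \<and> Tgt C w = So (Src C u))"

definition triangle_mor ::
  "('o, 'm) precat \<Rightarrow> ('m \<Rightarrow> 'm) \<Rightarrow> 'm \<times> 'm \<times> 'm \<Rightarrow> 'm \<times> 'm \<times> 'm \<Rightarrow> 'm \<Rightarrow> 'm \<Rightarrow> 'm \<Rightarrow> bool" where
  "triangle_mor C Sa = (\<lambda>(u, v, w) (u', v', w') f g h.
     f \<in> Hom C (Src C u) (Src C u') \<and> g \<in> Hom C (Src C v) (Src C v') \<and>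
     h \<in> Hom C (Src C w) (Src C w') \<and>
     g \<cdot>\<^bsub>C\<^esub> u = u' \<cdot>\<^bsub>C\<^esub> f \<and> h \<cdot>\<^bsub>C\<^esub> v = v' \<cdot>\<^bsub>C\<^esub> g \<and> Sa f \<cdot>\<^bsub>C\<^esub> w = w' \<cdot>\<^bsub>C\<^esub> h)"

definition triangle_iso ::
  "('o, 'm) precat \<Rightarrow> ('m \<Rightarrow> 'm) \<Rightarrow> 'm \<times> 'm \<times> 'm \<Rightarrow> 'm \<times> 'm \<times> 'm \<Rightarrow> bool" where
  "triangle_iso C Sa T T' \<longleftrightarrow>
     (\<exists>f g h. triangle_mor C Sa T T' f g h \<and> iso_arr C f \<and> iso_arr C g \<and> iso_arr C h)"

text \<open>Verdier's axioms; the suspension is required to be an autoequivalence. In the octahedral axiom,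
  the three given triangles are \<open>X \<rightarrow> Y \<rightarrow> Z' \<rightarrow> SX\<close>, \<open>Y \<rightarrow> Z \<rightarrow> X' \<rightarrow> SY\<close> and
  \<open>X \<rightarrow> Z \<rightarrow> Y' \<rightarrow> SX\<close>, on \<open>u\<close>, \<open>v\<close> and \<open>v \<cdot> u\<close>.\<close>

locale triangulated_category = additive_category +
  fixes So :: "'o \<Rightarrow> 'o" and Sa :: "'m \<Rightarrow> 'm" and Dist :: "('m \<times> 'm \<times> 'm) set"
  assumes suspension: "autoequivalence C So Sa"
    and dist_triangle: "T \<in> Dist \<Longrightarrow> triangle C So T"
    and TR1_iso: "\<lbrakk>T \<in> Dist; triangle C So T'; triangle_iso C Sa T T'\<rbrakk> \<Longrightarrow> T' \<in> Dist"
    and TR1_ident: "\<lbrakk>X \<in> Obj C; zero_object C Z\<rbrakk>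
          \<Longrightarrow> (Ident C X, Zero C X Z, Zero C Z (So X)) \<in> Dist"
    and TR1_cone: "u \<in> Arr C \<Longrightarrow> \<exists>v w. (u, v, w) \<in> Dist"
    and TR2: "triangle C So (u, v, w)
          \<Longrightarrow> (u, v, w) \<in> Dist \<longleftrightarrow> (v, w, neg C (Sa u)) \<in> Dist"
    and TR3: "\<lbrakk>(u, v, w) \<in> Dist; (u', v', w') \<in> Dist;
           f \<in> Hom C (Src C u) (Src C u'); g \<in> Hom C (Tgt C u) (Tgt C u');
           g \<cdot> u = u' \<cdot> f\<rbrakk> \<Longrightarrow> \<exists>h. triangle_mor C Sa (u, v, w) (u', v', w') f g h"
    and TR4: "\<lbrakk>(u, i, i') \<in> Dist; (v, j, j') \<in> Dist; (v \<cdot> u, k, k') \<in> Dist;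
           Tgt C u = Src C v\<rbrakk> \<Longrightarrow>
           \<exists>f g. triangle_mor C Sa (u, i, i') (v \<cdot> u, k, k') (Ident C (Src C u)) v f \<and>
                 triangle_mor C Sa (v \<cdot> u, k, k') (v, j, j') u (Ident C (Tgt C v)) g \<and>
                 (f, g, Sa i \<cdot> j') \<in> Dist"


section \<open>Happel's triangulated structure on the stable category\<close>

text \<open>A choice, for every object \<open>X\<close>, of a conflation \<open>X \<rightarrow> I(X) \<rightarrow> SX\<close> with \<open>I(X)\<close> injective. Such
  choices exist as soon as there are enough injectives.\<close>

definition injective_choice ::
  "('o, 'm) precat \<Rightarrow> ('m \<times> 'm) set \<Rightarrow> ('o \<Rightarrow> 'm) \<Rightarrow> ('o \<Rightarrow> 'm) \<Rightarrow> bool" where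
  "injective_choice B E \<mu> \<pi> \<longleftrightarrow>
     (\<forall>X \<in> Obj B. (\<mu> X, \<pi> X) \<in> E \<and> Src B (\<mu> X) = X \<and> injective_obj B E (Tgt B (\<mu> X)))"

definition susp_obj :: "('o, 'm) precat \<Rightarrow> ('o \<Rightarrow> 'm) \<Rightarrow> 'o \<Rightarrow> 'o" where
  "susp_obj B \<pi> X = Tgt B (\<pi> X)"

text \<open>The suspension of the class of \<open>f : X \<rightarrow> Y\<close> is the class of any \<open>g\<close> in a commutative diagram
  with rows \<open>X \<rightarrow> I(X) \<rightarrow> SX\<close> and \<open>Y \<rightarrow> I(Y) \<rightarrow> SY\<close> and vertical maps \<open>f\<close>, \<open>h\<close>, \<open>g\<close>.\<close>

definition susp_arr ::
  "('o, 'm) precat \<Rightarrow> ('m \<times> 'm) set \<Rightarrow> ('o \<Rightarrow> 'm) \<Rightarrow> ('o \<Rightarrow> 'm)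
     \<Rightarrow> 'o \<times> 'm set \<times> 'o \<Rightarrow> 'o \<times> 'm set \<times> 'o" where
  "susp_arr B E \<mu> \<pi> F =
     (let f = rep F; X = Src B f; Y = Tgt B f in
      stable_class B E (SOME g. g \<in> Hom B (susp_obj B \<pi> X) (susp_obj B \<pi> Y) \<and>
        (\<exists>h \<in> Hom B (Tgt B (\<mu> X)) (Tgt B (\<mu> Y)).
           h \<cdot>\<^bsub>B\<^esub> \<mu> X = \<mu> Y \<cdot>\<^bsub>B\<^esub> f \<and> g \<cdot>\<^bsub>B\<^esub> \<pi> X = \<pi> Y \<cdot>\<^bsub>B\<^esub> h)))"

text \<open>The standard triangle on \<open>u : X \<rightarrow> Y\<close> comes from the push-out \<open>v : Y \<rightarrow> Z\<close>, \<open>a : I(X) \<rightarrow> Z\<close> of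
  \<open>X \<rightarrow> I(X)\<close> along \<open>u\<close>, together with the induced map \<open>w : Z \<rightarrow> SX\<close>.\<close>

definition standard_triangles ::
  "('o, 'm) precat \<Rightarrow> ('m \<times> 'm) set \<Rightarrow> ('o \<Rightarrow> 'm) \<Rightarrow> ('o \<Rightarrow> 'm)
     \<Rightarrow> (('o \<times> 'm set \<times> 'o) \<times> ('o \<times> 'm set \<times> 'o) \<times> ('o \<times> 'm set \<times> 'o)) set" where
  "standard_triangles B E \<mu> \<pi> =
     {(stable_class B E u, stable_class B E v, stable_class B E w) | u v w.
        \<exists>a. is_pushout B (\<mu> (Src B u)) u a v \<and>
            w \<in> Hom B (Tgt B v) (susp_obj B \<pi> (Src B u)) \<and>
            w \<cdot>\<^bsub>B\<^esub> a = \<pi> (Src B u) \<and>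
            w \<cdot>\<^bsub>B\<^esub> v = Zero B (Tgt B u) (susp_obj B \<pi> (Src B u))}"

definition happel_triangles ::
  "('o, 'm) precat \<Rightarrow> ('m \<times> 'm) set \<Rightarrow> ('o \<Rightarrow> 'm) \<Rightarrow> ('o \<Rightarrow> 'm)
     \<Rightarrow> (('o \<times> 'm set \<times> 'o) \<times> ('o \<times> 'm set \<times> 'o) \<times> ('o \<times> 'm set \<times> 'o)) set" where
  "happel_triangles B E \<mu> \<pi> =
     {T. triangle (stable_cat B E) (susp_obj B \<pi>) T \<and>
         (\<exists>T' \<in> standard_triangles B E \<mu> \<pi>. triangle_iso (stable_cat B E) (susp_arr B E \<mu> \<pi>) T' T)}"


section \<open>Objects with a nilpotent endomorphism\<close>

definition endo_pow :: "('o, 'm) precat \<Rightarrow> 'o \<Rightarrow> 'm \<Rightarrow> nat \<Rightarrow> 'm" where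
  "endo_pow C X e n = ((\<lambda>f. e \<cdot>\<^bsub>C\<^esub> f) ^^ n) (Ident C X)"

definition eps_objects :: "('o, 'm) precat \<Rightarrow> nat \<Rightarrow> ('o \<times> 'm) set" where
  "eps_objects C n =
     {(X, e). X \<in> Obj C \<and> e \<in> Hom C X X \<and> endo_pow C X e n = Zero C X X}"

definition eps_cat ::
  "('o, 'm) precat \<Rightarrow> nat \<Rightarrow> ('o \<times> 'm, ('o \<times> 'm) \<times> 'm \<times> ('o \<times> 'm)) precat" where
  "eps_cat C n =
     \<lparr>Obj = eps_objects C n,
      Arr = {(A, f, B). A \<in> eps_objects C n \<and> B \<in> eps_objects C n \<and>
               f \<in> Hom C (fst A) (fst B) \<and> f \<cdot>\<^bsub>C\<^esub> snd A = snd B \<cdot>\<^bsub>C\<^esub> f},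
      Src = fst,
      Tgt = snd \<circ> snd,
      Ident = (\<lambda>A. (A, Ident C (fst A), A)),
      Comp = (\<lambda>(B', g, D) (A, f, B). (A, g \<cdot>\<^bsub>C\<^esub> f, D)),
      Add = (\<lambda>(A, f, B) (A', g, B'). (A, f \<oplus>\<^bsub>C\<^esub> g, B)),
      Zero = (\<lambda>A B. (A, Zero C (fst A) (fst B), B))\<rparr>"

definition forget_arr :: "('o \<times> 'm) \<times> 'm \<times> ('o \<times> 'm) \<Rightarrow> 'm" where
  "forget_arr f = fst (snd f)"

definition forget_exact ::
  "('o, 'm) precat \<Rightarrow> nat \<Rightarrow> ('m \<times> 'm) set
     \<Rightarrow> ((('o \<times> 'm) \<times> 'm \<times> ('o \<times> 'm)) \<times> (('o \<times> 'm) \<times> 'm \<times> ('o \<times> 'm))) set" where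
  "forget_exact C n E =
     {(f, g). f \<in> Arr (eps_cat C n) \<and> g \<in> Arr (eps_cat C n) \<and>
        Tgt (eps_cat C n) f = Src (eps_cat C n) g \<and> (forget_arr f, forget_arr g) \<in> E}"

end

theory Submission
  imports Defs
begin

text \<open>Two independent facts are combined: \<open>C[\<epsilon>]\<^sup>n\<close> is a Frobenius category, and the stable category of
  any Frobenius category is triangulated (Happel's theorem).

  For the first, everything about conflations is decided in \<open>C\<close>. If the arrow underlying \<open>f : X \<rightarrow> Y\<close> has a
  complement \<open>T\<close> in \<open>C\<close>, then \<open>\<epsilon>\<^sub>Y\<close> induces a nilpotent endomorphism on \<open>T\<close> that makes the projection
  \<open>Y \<rightarrow> T\<close> a cokernel, so \<open>f\<close> is an admissible monomorphism exactly if it is the inclusion of a direct summand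
  after forgetting \<open>\<epsilon>\<close> (\<open>adm_mono_iff\<close>, \<open>adm_epi_iff\<close>). The axioms of an exact category thus reduce to
  calculations with biproducts. Projective and injective objects are both described by Higman's criterion. For
  an arrow \<open>g\<close> of \<open>C\<close> the relative trace \<open>N(g) = \<Sum>\<^sub>k \<epsilon>\<^sup>n\<^sup>-\<^sup>1\<^sup>-\<^sup>k \<cdot> g \<cdot> \<epsilon>\<^sup>k\<close> commutes with \<open>\<epsilon>\<close>, and
  \<open>h \<cdot> N(g) = N(h \<cdot> g)\<close> and \<open>N(g) \<cdot> h = N(g \<cdot> h)\<close> for arrows \<open>h\<close> of \<open>C[\<epsilon>]\<^sup>n\<close>. If \<open>N(t) = 1\<close> on an object, then every
  extension or lifting problem for that object is solved by averaging a solution in \<open>C\<close> with \<open>N\<close>; so the object is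
  both injective and projective. The free object \<open>X \<otimes> \<int>[\<epsilon>]/\<epsilon>\<^sup>n\<close> has such a \<open>t\<close>. Every \<open>(X, \<epsilon>)\<close> embeds into it and
  is a quotient of it, by arrows that split in \<open>C\<close> and have complements because \<open>C\<close> is idempotent complete. Hence
  there are enough projectives and injectives, and both classes consist of the objects with \<open>N(t) = 1\<close> for some \<open>t\<close>.

  For the second, let \<open>X \<rightarrow> I X \<rightarrow> S X\<close> be the chosen conflations. An arrow vanishes stably iff it extends
  along \<open>X \<rightarrow> I X\<close>, so a diagram that commutes stably commutes in \<open>B\<close> up to an explicit correction. Standard
  triangles are push-outs of \<open>X \<rightarrow> I X\<close>, and maps out of a push-out are easily written down. This gives, for
  standard triangles only, the fill-in of morphisms, rotation in one direction, the factorisation of maps that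
  vanish on \<open>u\<close>, and one octahedron for each composable pair. The suspension is fully faithful because \<open>I X\<close> is
  also projective, and dense by Schanuel's argument. The rest is formal and is carried out in the locale
  \<open>cone_category\<close>: cones are unique up to isomorphism (\<open>cone_endo_iso\<close>), which yields rotation
  backwards and the octahedron for arbitrary distinguished triangles.\<close>

section \<open>Calculating in a preadditive category\<close>

context category begin

lemma hom_iff: "f \<in> Hom C X Y \<longleftrightarrow>
    f \<in> Arr C \<and> Src C f = X \<and> Tgt C f = Y \<and> X \<in> Obj C \<and> Y \<in> Obj C"
  using src_obj tgt_obj by (auto simp: Hom_def)

lemma homD:
  assumes "f \<in> Hom C X Y"
  shows "f \<in> Arr C" "Src C f = X" "Tgt C f = Y" "X \<in> Obj C" "Y \<in> Obj C"
  using assms by (simp_all add: hom_iff)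

lemma homI: "\<lbrakk>f \<in> Arr C; Src C f = X; Tgt C f = Y\<rbrakk> \<Longrightarrow> f \<in> Hom C X Y"
  by (simp add: Hom_def)

lemma src_tgt_obj [simp]: "f \<in> Arr C \<Longrightarrow> Src C f \<in> Obj C" "f \<in> Arr C \<Longrightarrow> Tgt C f \<in> Obj C"
  by (auto intro: src_obj tgt_obj)

text \<open>The rules for calculating are stated with \<open>Arr\<close>, \<open>Src\<close> and \<open>Tgt\<close> and not with \<open>Hom\<close>: their side
  conditions then contain no variables beyond those of the term being rewritten, so that the simplifier can
  discharge them.\<close>

lemma comp_typing [simp]:
  assumes "f \<in> Arr C" "g \<in> Arr C" "Tgt C f = Src C g"
  shows "g \<cdot> f \<in> Arr C" "Src C (g \<cdot> f) = Src C f" "Tgt C (g \<cdot> f) = Tgt C g"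
  using comp_hom [of f "Src C f" "Tgt C f" g "Tgt C g"] assms by (auto simp: hom_iff)

lemma comp_assoc_arr [simp]:
  "\<lbrakk>f \<in> Arr C; g \<in> Arr C; h \<in> Arr C; Tgt C f = Src C g; Tgt C g = Src C h\<rbrakk>
   \<Longrightarrow> (h \<cdot> g) \<cdot> f = h \<cdot> g \<cdot> f"
  by (rule comp_assoc [of f "Src C f" "Tgt C f" g "Tgt C g" h "Tgt C h"]) (auto simp: hom_iff)

lemma ident_typing [simp]:
  assumes "X \<in> Obj C"
  shows "Ident C X \<in> Arr C" "Src C (Ident C X) = X" "Tgt C (Ident C X) = X"
  using ident_hom [OF assms] by (auto simp: hom_iff)

lemma comp_ident [simp]:
  "\<lbrakk>f \<in> Arr C; Tgt C f = Y\<rbrakk> \<Longrightarrow> Ident C Y \<cdot> f = f"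
  "\<lbrakk>f \<in> Arr C; Src C f = X\<rbrakk> \<Longrightarrow> f \<cdot> Ident C X = f"
  using comp_ident_left comp_ident_right by (auto simp: hom_iff)

text \<open>Composites are normalised to the right, so an equation \<open>g \<cdot> f = k \<cdot> h\<close> used for rewriting has to
  be complemented by its consequence under precomposition.\<close>

lemma comp_reassoc:
  assumes "g \<cdot> f = k" "f \<in> Arr C" "g \<in> Arr C" "Tgt C f = Src C g" "x \<in> Arr C" "Tgt C x = Src C f"
  shows "g \<cdot> f \<cdot> x = k \<cdot> x"
  using assms comp_assoc_arr by metis

lemma comp_reassoc2:
  assumes "g \<cdot> f = k \<cdot> h" "f \<in> Arr C" "g \<in> Arr C" "Tgt C f = Src C g"
    "h \<in> Arr C" "k \<in> Arr C" "Tgt C h = Src C k" "x \<in> Arr C" "Tgt C x = Src C f" "Src C f = Src C h"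
  shows "g \<cdot> f \<cdot> x = k \<cdot> h \<cdot> x"
  using assms comp_assoc_arr by metis

lemma iso_arrI:
  assumes "f \<in> Hom C X Y" "g \<in> Hom C Y X" "g \<cdot> f = Ident C X" "f \<cdot> g = Ident C Y"
  shows "iso_arr C f"
  using assms by (auto simp: iso_arr_def hom_iff)

lemma iso_arrE:
  assumes "iso_arr C f" "f \<in> Hom C X Y"
  obtains g where "g \<in> Hom C Y X" "g \<cdot> f = Ident C X" "f \<cdot> g = Ident C Y" "iso_arr C g"
proof -
  have *: "Src C f = X" "Tgt C f = Y" "f \<in> Arr C" using assms(2) by (auto simp: hom_iff)
  then obtain g where g: "g \<in> Hom C Y X" "g \<cdot> f = Ident C X" "f \<cdot> g = Ident C Y"
    using assms(1) by (auto simp: iso_arr_def)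
  show thesis
    by (rule that [OF g]) (rule iso_arrI [OF g(1) assms(2) g(3,2)])
qed

lemma iso_arr_ident [simp]: "X \<in> Obj C \<Longrightarrow> iso_arr C (Ident C X)"
  by (rule iso_arrI [where g = "Ident C X"]) (auto simp: hom_iff)

lemma iso_arr_comp:
  assumes "iso_arr C f" "iso_arr C g" "Tgt C f = Src C g"
  shows "iso_arr C (g \<cdot> f)"
proof -
  obtain f' where f': "f' \<in> Hom C (Tgt C f) (Src C f)" "f' \<cdot> f = Ident C (Src C f)"
    "f \<cdot> f' = Ident C (Tgt C f)" and f: "f \<in> Arr C"
    using assms(1) by (auto simp: iso_arr_def)
  obtain g' where g': "g' \<in> Hom C (Tgt C g) (Src C g)" "g' \<cdot> g = Ident C (Src C g)"
    "g \<cdot> g' = Ident C (Tgt C g)" and g: "g \<in> Arr C"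
    using assms(2) by (auto simp: iso_arr_def)
  show ?thesis
  proof (rule iso_arrI [where g = "f' \<cdot> g'"])
    show "(f' \<cdot> g') \<cdot> g \<cdot> f = Ident C (Src C f)"
      using f g f' g' assms(3) comp_reassoc [OF g'(2), of f] by (simp add: hom_iff)
    show "(g \<cdot> f) \<cdot> f' \<cdot> g' = Ident C (Tgt C g)"
      using f g f' g' assms(3) comp_reassoc [OF f'(3), of g'] by (simp add: hom_iff)
  qed (use f g f' g' assms(3) in \<open>auto simp: hom_iff\<close>)
qed

end

context preadditive_category begin

lemma hom_group_simps [simp]:
  "carrier (hom_group C X Y) = Hom C X Y"
  "mult (hom_group C X Y) = Add C"
  "one (hom_group C X Y) = Zero C X Y"
  by (auto simp: hom_group_def)

lemma zero_typing [simp]: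
  assumes "X \<in> Obj C" "Y \<in> Obj C"
  shows "Zero C X Y \<in> Arr C" "Src C (Zero C X Y) = X" "Tgt C (Zero C X Y) = Y"
proof -
  interpret G: comm_group "hom_group C X Y" by (rule hom_comm_group [OF assms])
  show "Zero C X Y \<in> Arr C" "Src C (Zero C X Y) = X" "Tgt C (Zero C X Y) = Y"
    using G.one_closed by (auto simp: hom_iff)
qed

lemma add_typing [simp]:
  assumes "f \<in> Arr C" "g \<in> Arr C" "Src C g = Src C f" "Tgt C g = Tgt C f"
  shows "f \<oplus> g \<in> Arr C" "Src C (f \<oplus> g) = Src C f" "Tgt C (f \<oplus> g) = Tgt C f"
proof -
  interpret G: comm_group "hom_group C (Src C f) (Tgt C f)" by (rule hom_comm_group) (use assms in auto)
  show "f \<oplus> g \<in> Arr C" "Src C (f \<oplus> g) = Src C f" "Tgt C (f \<oplus> g) = Tgt C f"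
    using G.m_closed [of f g] assms by (auto simp: hom_iff)
qed

lemma neg_typing [simp]:
  assumes "f \<in> Arr C"
  shows "neg C f \<in> Arr C" "Src C (neg C f) = Src C f" "Tgt C (neg C f) = Tgt C f"
proof -
  interpret G: comm_group "hom_group C (Src C f) (Tgt C f)" by (rule hom_comm_group) (use assms in auto)
  show "neg C f \<in> Arr C" "Src C (neg C f) = Src C f" "Tgt C (neg C f) = Tgt C f"
    using G.inv_closed [of f] assms by (auto simp: hom_iff neg_def)
qed

lemma add_zero [simp]:
  assumes "f \<in> Arr C" "Src C f = X" "Tgt C f = Y"
  shows "f \<oplus> Zero C X Y = f" "Zero C X Y \<oplus> f = f"
proof -
  interpret G: comm_group "hom_group C X Y" by (rule hom_comm_group) (use assms in auto)
  show "f \<oplus> Zero C X Y = f" "Zero C X Y \<oplus> f = f"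
    using G.r_one [of f] G.l_one [of f] assms by (auto simp: hom_iff)
qed

lemma add_neg [simp]:
  assumes "f \<in> Arr C"
  shows "f \<oplus> neg C f = Zero C (Src C f) (Tgt C f)" "neg C f \<oplus> f = Zero C (Src C f) (Tgt C f)"
proof -
  interpret G: comm_group "hom_group C (Src C f) (Tgt C f)" by (rule hom_comm_group) (use assms in auto)
  show "f \<oplus> neg C f = Zero C (Src C f) (Tgt C f)" "neg C f \<oplus> f = Zero C (Src C f) (Tgt C f)"
    using G.r_inv [of f] G.l_inv [of f] assms by (auto simp: hom_iff neg_def)
qed

lemma add_assoc [simp]:
  assumes "f \<in> Arr C" "g \<in> Arr C" "h \<in> Arr C" "Src C g = Src C f" "Tgt C g = Tgt C f"
    "Src C h = Src C f" "Tgt C h = Tgt C f"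
  shows "(f \<oplus> g) \<oplus> h = f \<oplus> (g \<oplus> h)"
proof -
  interpret G: comm_group "hom_group C (Src C f) (Tgt C f)" by (rule hom_comm_group) (use assms in auto)
  show ?thesis using G.m_assoc [of f g h] assms by (auto simp: hom_iff)
qed

lemma add_commute:
  assumes "f \<in> Arr C" "g \<in> Arr C" "Src C g = Src C f" "Tgt C g = Tgt C f"
  shows "f \<oplus> g = g \<oplus> f"
proof -
  interpret G: comm_group "hom_group C (Src C f) (Tgt C f)" by (rule hom_comm_group) (use assms in auto)
  show ?thesis using G.m_comm [of f g] assms by (auto simp: hom_iff)
qed

lemma add_left_commute:
  assumes "f \<in> Arr C" "g \<in> Arr C" "h \<in> Arr C" "Src C g = Src C f" "Tgt C g = Tgt C f"
    "Src C h = Src C f" "Tgt C h = Tgt C f"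
  shows "f \<oplus> (g \<oplus> h) = g \<oplus> (f \<oplus> h)"
  using add_assoc [of f g h] add_assoc [of g f h] add_commute [of f g] assms by simp

lemma add_neg_cancel [simp]:
  assumes "f \<in> Arr C" "g \<in> Arr C" "Src C g = Src C f" "Tgt C g = Tgt C f"
  shows "f \<oplus> (neg C f \<oplus> g) = g" "neg C f \<oplus> (f \<oplus> g) = g"
  using add_assoc [of f "neg C f" g] add_assoc [of "neg C f" f g] assms by simp_all

lemma add_neg_cancel_right [simp]:
  assumes "f \<in> Arr C" "g \<in> Arr C" "Src C g = Src C f" "Tgt C g = Tgt C f"
  shows "f \<oplus> (g \<oplus> neg C f) = g"
  using assms by (simp add: add_commute [of g "neg C f"])

lemmas add_ac = add_commute add_left_commute

lemma add_left_cancel: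
  assumes "f \<in> Arr C" "g \<in> Arr C" "h \<in> Arr C" "Src C g = Src C f" "Tgt C g = Tgt C f"
    "Src C h = Src C f" "Tgt C h = Tgt C f"
  shows "f \<oplus> g = f \<oplus> h \<longleftrightarrow> g = h"
  by (metis assms add_neg_cancel(2))

lemma neg_unique:
  assumes "f \<in> Arr C" "g \<in> Arr C" "Src C g = Src C f" "Tgt C g = Tgt C f"
    "f \<oplus> g = Zero C (Src C f) (Tgt C f)"
  shows "g = neg C f"
  using add_left_cancel [of f g "neg C f"] assms by simp

lemma neg_neg [simp]: "f \<in> Arr C \<Longrightarrow> neg C (neg C f) = f"
  using neg_unique [of "neg C f" f] by simp

lemma neg_inject: "\<lbrakk>f \<in> Arr C; g \<in> Arr C\<rbrakk> \<Longrightarrow> neg C f = neg C g \<longleftrightarrow> f = g"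
  by (metis neg_neg)

lemma neg_add [simp]:
  assumes "f \<in> Arr C" "g \<in> Arr C" "Src C g = Src C f" "Tgt C g = Tgt C f"
  shows "neg C (f \<oplus> g) = neg C f \<oplus> neg C g"
proof (rule neg_unique [symmetric])
  have "(f \<oplus> g) \<oplus> (neg C f \<oplus> neg C g) = g \<oplus> (f \<oplus> (neg C f \<oplus> neg C g))"
    using assms by (simp add: add_left_commute)
  then show "(f \<oplus> g) \<oplus> (neg C f \<oplus> neg C g) = Zero C (Src C (f \<oplus> g)) (Tgt C (f \<oplus> g))"
    using assms by simp
qed (use assms in simp_all)

lemma neg_zero [simp]: "\<lbrakk>X \<in> Obj C; Y \<in> Obj C\<rbrakk> \<Longrightarrow> neg C (Zero C X Y) = Zero C X Y"
  using neg_unique [of "Zero C X Y" "Zero C X Y"] by simp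

lemma comp_distrib [simp]:
  "\<lbrakk>f \<in> Arr C; g \<in> Arr C; g' \<in> Arr C; Src C g = Tgt C f; Src C g' = Tgt C f; Tgt C g' = Tgt C g\<rbrakk>
   \<Longrightarrow> (g \<oplus> g') \<cdot> f = (g \<cdot> f) \<oplus> (g' \<cdot> f)"
  "\<lbrakk>f \<in> Arr C; f' \<in> Arr C; g \<in> Arr C; Src C g = Tgt C f; Tgt C f' = Tgt C f; Src C f' = Src C f\<rbrakk>
   \<Longrightarrow> g \<cdot> (f \<oplus> f') = (g \<cdot> f) \<oplus> (g \<cdot> f')"
  using comp_add_left [of f "Src C f" "Tgt C f" g "Tgt C g" g']
    comp_add_right [of f "Src C f" "Tgt C f" f' g "Tgt C g"] by (auto simp: hom_iff)

lemma add_self_zero: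
  assumes "f \<in> Arr C" "f \<oplus> f = f" "Src C f = X" "Tgt C f = Y"
  shows "f = Zero C X Y"
  using add_left_cancel [of f f "Zero C X Y"] assms by auto

lemma comp_zero [simp]:
  "\<lbrakk>f \<in> Arr C; Tgt C f = Y; Z \<in> Obj C\<rbrakk> \<Longrightarrow> Zero C Y Z \<cdot> f = Zero C (Src C f) Z"
  "\<lbrakk>f \<in> Arr C; Src C f = Y; X \<in> Obj C\<rbrakk> \<Longrightarrow> f \<cdot> Zero C X Y = Zero C X (Tgt C f)"
proof -
  assume a: "f \<in> Arr C" "Tgt C f = Y" "Z \<in> Obj C"
  then have [simp]: "Y \<in> Obj C" by auto
  show "Zero C Y Z \<cdot> f = Zero C (Src C f) Z"
    using a comp_distrib(1) [of f "Zero C Y Z" "Zero C Y Z"] by (intro add_self_zero) (auto simp del: comp_distrib)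
next
  assume a: "f \<in> Arr C" "Src C f = Y" "X \<in> Obj C"
  then have [simp]: "Y \<in> Obj C" by auto
  show "f \<cdot> Zero C X Y = Zero C X (Tgt C f)"
    using a comp_distrib(2) [of "Zero C X Y" "Zero C X Y" f] by (intro add_self_zero) (auto simp del: comp_distrib)
qed

lemma comp_neg [simp]:
  assumes "f \<in> Arr C" "g \<in> Arr C" "Tgt C f = Src C g"
  shows "neg C g \<cdot> f = neg C (g \<cdot> f)" "g \<cdot> neg C f = neg C (g \<cdot> f)"
proof -
  show "neg C g \<cdot> f = neg C (g \<cdot> f)"
    using comp_distrib(1) [of f g "neg C g"] assms by (intro neg_unique) (auto simp del: comp_distrib)
  show "g \<cdot> neg C f = neg C (g \<cdot> f)"
    using comp_distrib(2) [of f "neg C f" g] assms by (intro neg_unique) (auto simp del: comp_distrib)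
qed

lemma eq_add_iff:
  assumes "f \<in> Arr C" "g \<in> Arr C" "h \<in> Arr C" "Src C g = Src C f" "Tgt C g = Tgt C f"
    "Src C h = Src C f" "Tgt C h = Tgt C f"
  shows "f = g \<oplus> h \<longleftrightarrow> f \<oplus> neg C g = h"
proof
  assume "f \<oplus> neg C g = h"
  then have "g \<oplus> h = g \<oplus> (f \<oplus> neg C g)" by simp
  also have "\<dots> = f \<oplus> (g \<oplus> neg C g)" using assms by (intro add_left_commute) simp_all
  finally show "f = g \<oplus> h" using assms by simp
next
  assume "f = g \<oplus> h"
  moreover have "(g \<oplus> h) \<oplus> neg C g = h" using assms by (simp add: add_commute [of g h])
  ultimately show "f \<oplus> neg C g = h" by simp
qed

lemma zero_object_eq:
  assumes "zero_object C Z" "f \<in> Hom C X Z" "g \<in> Hom C X Z"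
  shows "f = g"
  using assms by (auto simp: zero_object_def hom_iff)

lemma zero_object_eq':
  assumes "zero_object C Z" "f \<in> Hom C Z X" "g \<in> Hom C Z X"
  shows "f = g"
  using assms by (auto simp: zero_object_def hom_iff)

end

section \<open>The stable category\<close>

text \<open>The setting of Happel's theorem: a Frobenius category with the chosen conflations
  \<open>X \<rightarrow> I X \<rightarrow> S X\<close>.\<close>

locale frobenius_choice = exact_category B E
  for B :: "('o, 'm) precat" (structure) and E :: "('m \<times> 'm) set" +
  fixes \<mu> \<pi> :: "'o \<Rightarrow> 'm"
  assumes frobenius: "frobenius_category B E"
    and choice: "injective_choice B E \<mu> \<pi>"
begin

abbreviation "I X \<equiv> Tgt B (\<mu> X)"
abbreviation "S \<equiv> susp_obj B \<pi>"
abbreviation "D \<equiv> stable_cat B E"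
abbreviation cls ("\<lbrakk>_\<rbrakk>") where "\<lbrakk>f\<rbrakk> \<equiv> stable_class B E f"

lemma conflation: "X \<in> Obj B \<Longrightarrow> (\<mu> X, \<pi> X) \<in> E"
  using choice by (auto simp: injective_choice_def)

lemma projective_iff_injective: "projective_obj B E P \<longleftrightarrow> injective_obj B E P"
  using frobenius by (auto simp: frobenius_category_def)

lemma adm_typing:
  assumes "(i, p) \<in> E"
  shows "i \<in> Arr B" "p \<in> Arr B" "Src B p = Tgt B i" "p \<cdot> i = Zero B (Src B i) (Tgt B p)"
  using kernel_cokernel [OF assms] by (auto simp: is_kernel_def)

lemma choice_typing [simp]:
  assumes "X \<in> Obj B"
  shows "\<mu> X \<in> Arr B" "Src B (\<mu> X) = X" "\<pi> X \<in> Arr B" "Src B (\<pi> X) = I X"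
    "Tgt B (\<pi> X) = S X" "\<pi> X \<cdot> \<mu> X = Zero B X (S X)" "S X \<in> Obj B" "injective_obj B E (I X)"
proof -
  have s: "Src B (\<mu> X) = X" "injective_obj B E (I X)" "Tgt B (\<pi> X) = S X"
    using choice assms by (auto simp: injective_choice_def susp_obj_def)
  note t = adm_typing [OF conflation [OF assms]]
  show "\<mu> X \<in> Arr B" "Src B (\<mu> X) = X" "\<pi> X \<in> Arr B" "Src B (\<pi> X) = I X"
    "Tgt B (\<pi> X) = S X" "\<pi> X \<cdot> \<mu> X = Zero B X (S X)" "injective_obj B E (I X)"
    using s t by auto
  show "S X \<in> Obj B" using s(3) t(2) by (metis tgt_obj)
qed

lemma choice_comp_zero [simp]:
  "\<lbrakk>X \<in> Obj B; x \<in> Arr B; Tgt B x = X\<rbrakk> \<Longrightarrow> \<pi> X \<cdot> \<mu> X \<cdot> x = Zero B (Src B x) (S X)"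
  by (subst comp_reassoc [OF choice_typing(6)]) auto

lemma kernel_factor:
  assumes "(i, p) \<in> E" "f \<in> Arr B" "Tgt B f = Src B p" "p \<cdot> f = Zero B (Src B f) (Tgt B p)"
  shows "\<exists>g \<in> Hom B (Src B f) (Src B i). i \<cdot> g = f"
  using kernel_cokernel [OF assms(1)] assms(2-4) unfolding is_kernel_def by blast

lemma cokernel_factor:
  assumes "(i, p) \<in> E" "f \<in> Arr B" "Src B f = Tgt B i" "f \<cdot> i = Zero B (Src B i) (Tgt B f)"
  shows "\<exists>g \<in> Hom B (Tgt B p) (Tgt B f). g \<cdot> p = f"
  using kernel_cokernel [OF assms(1)] assms(2-4) unfolding is_cokernel_def by blast

lemma kernel_mono:
  assumes "(i, p) \<in> E" "f \<in> Arr B" "g \<in> Arr B" "Tgt B f = Src B i" "Tgt B g = Src B i"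
    "Src B g = Src B f" "i \<cdot> f = i \<cdot> g"
  shows "f = g"
proof -
  note t = adm_typing [OF assms(1)]
  have "i \<cdot> g \<in> Arr B" "Tgt B (i \<cdot> g) = Src B p" using t assms by auto
  moreover have "p \<cdot> i \<cdot> g = Zero B (Src B (i \<cdot> g)) (Tgt B p)"
    using t assms comp_reassoc [OF t(4), of g] by auto
  ultimately have "\<exists>!h. h \<in> Hom B (Src B (i \<cdot> g)) (Src B i) \<and> i \<cdot> h = i \<cdot> g"
    using kernel_cokernel [OF assms(1)] by (simp add: is_kernel_def)
  moreover have "f \<in> Hom B (Src B (i \<cdot> g)) (Src B i)" "g \<in> Hom B (Src B (i \<cdot> g)) (Src B i)"
    using t assms by (auto simp: hom_iff)
  ultimately show ?thesis using assms(7) by blast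
qed

lemma cokernel_epi:
  assumes "(i, p) \<in> E" "f \<in> Arr B" "g \<in> Arr B" "Src B f = Tgt B p" "Src B g = Tgt B p"
    "Tgt B g = Tgt B f" "f \<cdot> p = g \<cdot> p"
  shows "f = g"
proof -
  note t = adm_typing [OF assms(1)]
  have "g \<cdot> p \<in> Arr B" "Src B (g \<cdot> p) = Tgt B i" using t assms by auto
  moreover have "(g \<cdot> p) \<cdot> i = Zero B (Src B i) (Tgt B (g \<cdot> p))"
    using t assms by auto
  ultimately have "\<exists>!h. h \<in> Hom B (Tgt B p) (Tgt B (g \<cdot> p)) \<and> h \<cdot> p = g \<cdot> p"
    using kernel_cokernel [OF assms(1)] by (simp add: is_cokernel_def)
  moreover have "f \<in> Hom B (Tgt B p) (Tgt B (g \<cdot> p))" "g \<in> Hom B (Tgt B p) (Tgt B (g \<cdot> p))"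
    using t assms by (auto simp: hom_iff)
  ultimately show ?thesis using assms(7) by blast
qed

lemma injective_extend:
  assumes "(i, p) \<in> E" "injective_obj B E J" "f \<in> Hom B (Src B i) J"
  shows "\<exists>g \<in> Hom B (Tgt B i) J. g \<cdot> i = f"
  using assms by (auto simp: injective_obj_def adm_mono_def)

lemma injective_lift:
  assumes "(i, p) \<in> E" "injective_obj B E J" "f \<in> Hom B J (Tgt B p)"
  shows "\<exists>g \<in> Hom B J (Src B p). p \<cdot> g = f"
  using assms by (auto simp: projective_iff_injective [symmetric] projective_obj_def adm_epi_def)

text \<open>Projective objects are injective, so an arrow from \<open>X\<close> into one of them extends along \<open>\<mu> X\<close>. This
  replaces the quantification over all projective objects by a single one, and shows that the ideal is a group.\<close>

lemma proj_ideal_eq: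
  assumes "X \<in> Obj B" "Y \<in> Obj B"
  shows "proj_ideal B E X Y = {k \<cdot> \<mu> X | k. k \<in> Hom B (I X) Y}"
proof (intro equalityI subsetI)
  fix f assume "f \<in> proj_ideal B E X Y"
  then obtain g h P where f: "f = h \<cdot> g" "injective_obj B E P" "g \<in> Hom B X P" "h \<in> Hom B P Y"
    by (auto simp: proj_ideal_def projective_iff_injective)
  obtain g' where "g' \<in> Hom B (I X) P" "g' \<cdot> \<mu> X = g"
    using injective_extend [OF conflation [OF assms(1)] f(2), of g] f(3) assms by auto
  then show "f \<in> {k \<cdot> \<mu> X | k. k \<in> Hom B (I X) Y}"
    using f assms by (intro CollectI exI [of _ "h \<cdot> g'"]) (auto simp: hom_iff)
next
  fix f assume "f \<in> {k \<cdot> \<mu> X | k. k \<in> Hom B (I X) Y}"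
  then obtain k where "f = k \<cdot> \<mu> X" "k \<in> Hom B (I X) Y" by auto
  then show "f \<in> proj_ideal B E X Y"
    using assms unfolding proj_ideal_def
    by (intro CollectI exI [of _ "\<mu> X"] exI [of _ k] conjI exI [of _ "I X"])
      (auto simp: projective_iff_injective hom_iff)
qed

lemma cls_eq:
  assumes "f \<in> Arr B"
  shows "\<lbrakk>f\<rbrakk> = (Src B f, {f \<oplus> k \<cdot> \<mu> (Src B f) | k. k \<in> Hom B (I (Src B f)) (Tgt B f)}, Tgt B f)"
proof -
  have "(k \<cdot> \<mu> (Src B f)) \<oplus> f = f \<oplus> k \<cdot> \<mu> (Src B f)" if "k \<in> Hom B (I (Src B f)) (Tgt B f)" for k
    using that assms by (intro add_commute) (auto simp: hom_iff)
  then show ?thesis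
    using assms by (fastforce simp: stable_class_def r_coset_def proj_ideal_eq)
qed

lemma cls_eq_iff:
  assumes "f \<in> Arr B" "g \<in> Arr B"
  shows "\<lbrakk>f\<rbrakk> = \<lbrakk>g\<rbrakk> \<longleftrightarrow> Src B f = Src B g \<and> Tgt B f = Tgt B g \<and>
    (\<exists>k \<in> Hom B (I (Src B f)) (Tgt B f). f = g \<oplus> k \<cdot> \<mu> (Src B f))"
proof
  assume eq: "\<lbrakk>f\<rbrakk> = \<lbrakk>g\<rbrakk>"
  have st: "Src B g = Src B f" "Tgt B g = Tgt B f" using eq assms by (auto simp: cls_eq)
  have "f \<in> fst (snd \<lbrakk>f\<rbrakk>)"
    unfolding cls_eq [OF assms(1)]
    by (auto simp: hom_iff assms intro!: exI [of _ "Zero B (I (Src B f)) (Tgt B f)"])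
  then show "Src B f = Src B g \<and> Tgt B f = Tgt B g \<and>
    (\<exists>k \<in> Hom B (I (Src B f)) (Tgt B f). f = g \<oplus> k \<cdot> \<mu> (Src B f))"
    unfolding eq unfolding cls_eq [OF assms(2)] st by auto
next
  assume "Src B f = Src B g \<and> Tgt B f = Tgt B g \<and>
    (\<exists>k \<in> Hom B (I (Src B f)) (Tgt B f). f = g \<oplus> k \<cdot> \<mu> (Src B f))"
  then obtain k where st: "Src B f = Src B g" "Tgt B f = Tgt B g"
    and k: "k \<in> Hom B (I (Src B g)) (Tgt B g)" and eq: "f = g \<oplus> k \<cdot> \<mu> (Src B g)" by auto
  let ?H = "Hom B (I (Src B g)) (Tgt B g)" and ?m = "\<mu> (Src B g)"
  have 1: "\<exists>l' \<in> ?H. f \<oplus> l \<cdot> ?m = g \<oplus> l' \<cdot> ?m" if "l \<in> ?H" for l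
    using that k assms by (intro bexI [of _ "k \<oplus> l"]) (auto simp: hom_iff eq)
  have 2: "\<exists>l' \<in> ?H. g \<oplus> l \<cdot> ?m = f \<oplus> l' \<cdot> ?m" if "l \<in> ?H" for l
    using that k assms by (intro bexI [of _ "neg B k \<oplus> l"]) (auto simp: hom_iff eq)
  have "{f \<oplus> l \<cdot> ?m | l. l \<in> ?H} = {g \<oplus> l \<cdot> ?m | l. l \<in> ?H}"
    using 1 2 by blast
  then show "\<lbrakk>f\<rbrakk> = \<lbrakk>g\<rbrakk>"
    unfolding cls_eq [OF assms(1)] cls_eq [OF assms(2)] st by simp
qed

text \<open>To identify stable classes, any injective object may serve in place of the chosen one.\<close>

lemma cls_eqI:
  assumes "f = g \<oplus> k \<cdot> j" "injective_obj B E J" "j \<in> Hom B X J" "k \<in> Hom B J Y" "g \<in> Hom B X Y"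
  shows "\<lbrakk>f\<rbrakk> = \<lbrakk>g\<rbrakk>"
proof -
  have X: "X \<in> Obj B" using assms(3) by (auto simp: hom_iff)
  obtain j' where "j' \<in> Hom B (I X) J" "j' \<cdot> \<mu> X = j"
    using injective_extend [OF conflation [OF X] assms(2), of j] assms(3) X by auto
  then have j': "j' \<in> Hom B (I X) J" "j = j' \<cdot> \<mu> X" by simp_all
  note [simp] = X homD [OF j'(1)] assms(4-5) [unfolded hom_iff]
  show ?thesis
    unfolding assms(1) j'(2)
    by (subst cls_eq_iff) (auto intro!: bexI [of _ "k \<cdot> j'"] homI)
qed

lemma cls_eqE:
  assumes "\<lbrakk>f\<rbrakk> = \<lbrakk>g\<rbrakk>" "f \<in> Arr B" "g \<in> Arr B"
  obtains k where "k \<in> Hom B (I (Src B f)) (Tgt B f)" "f = g \<oplus> k \<cdot> \<mu> (Src B f)"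
    "Src B g = Src B f" "Tgt B g = Tgt B f"
  using assms(1) that unfolding cls_eq_iff [OF assms(2,3)] by metis

lemma cls_zeroE:
  assumes "\<lbrakk>f\<rbrakk> = \<lbrakk>Zero B X Y\<rbrakk>" "f \<in> Arr B" "X \<in> Obj B" "Y \<in> Obj B"
  obtains k where "k \<in> Hom B (I X) Y" "f = k \<cdot> \<mu> X" "Src B f = X" "Tgt B f = Y"
proof -
  obtain k where k: "k \<in> Hom B (I (Src B f)) (Tgt B f)" "f = Zero B X Y \<oplus> k \<cdot> \<mu> (Src B f)"
    and st: "Src B f = X" "Tgt B f = Y"
    using cls_eqE [OF assms(1,2)] assms(3,4) by (metis zero_typing)
  have "Zero B X Y \<oplus> k \<cdot> \<mu> X = k \<cdot> \<mu> X"
    using homD [OF k(1)] assms(3,4) st by simp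
  then show thesis using that k st by metis
qed

lemma cls_zeroI:
  assumes "f = k \<cdot> j" "injective_obj B E J" "j \<in> Hom B X J" "k \<in> Hom B J Y"
  shows "\<lbrakk>f\<rbrakk> = \<lbrakk>Zero B X Y\<rbrakk>"
  using assms by (intro cls_eqI [of f "Zero B X Y" k j J X Y]) (auto simp: hom_iff)

lemma D_simps [simp]:
  "Obj D = Obj B"
  "f \<in> Arr B \<Longrightarrow> \<lbrakk>f\<rbrakk> \<in> Arr D"
  "Src D \<lbrakk>f\<rbrakk> = Src B f"
  "Tgt D \<lbrakk>f\<rbrakk> = Tgt B f"
  "Ident D X = \<lbrakk>Ident B X\<rbrakk>"
  "Zero D X Y = \<lbrakk>Zero B X Y\<rbrakk>"
  by (auto simp: stable_cat_def stable_class_def)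

lemma D_arrE:
  assumes "F \<in> Arr D"
  obtains f where "f \<in> Arr B" "F = \<lbrakk>f\<rbrakk>"
  using assms by (auto simp: stable_cat_def)

lemma rep_cls:
  assumes "f \<in> Arr B"
  shows "rep \<lbrakk>f\<rbrakk> \<in> Arr B" "\<lbrakk>rep \<lbrakk>f\<rbrakk>\<rbrakk> = \<lbrakk>f\<rbrakk>"
    "Src B (rep \<lbrakk>f\<rbrakk>) = Src B f" "Tgt B (rep \<lbrakk>f\<rbrakk>) = Tgt B f"
proof -
  have "f \<in> fst (snd \<lbrakk>f\<rbrakk>)"
    unfolding cls_eq [OF assms(1)]
    by (auto simp: hom_iff assms intro!: exI [of _ "Zero B (I (Src B f)) (Tgt B f)"])
  then have "rep \<lbrakk>f\<rbrakk> \<in> fst (snd \<lbrakk>f\<rbrakk>)" unfolding rep_def by (rule someI)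
  then obtain k where k: "k \<in> Hom B (I (Src B f)) (Tgt B f)" "rep \<lbrakk>f\<rbrakk> = f \<oplus> k \<cdot> \<mu> (Src B f)"
    unfolding cls_eq [OF assms(1)] by auto
  show st: "rep \<lbrakk>f\<rbrakk> \<in> Arr B" "Src B (rep \<lbrakk>f\<rbrakk>) = Src B f" "Tgt B (rep \<lbrakk>f\<rbrakk>) = Tgt B f"
    unfolding k(2) using k(1) assms by (auto simp: hom_iff)
  show "\<lbrakk>rep \<lbrakk>f\<rbrakk>\<rbrakk> = \<lbrakk>f\<rbrakk>"
    using k assms st by (subst cls_eq_iff) auto
qed

lemma cls_comp_cong:
  assumes "f \<in> Arr B" "g \<in> Arr B" "f' \<in> Arr B" "g' \<in> Arr B" "Tgt B f = Src B g"
    and eq: "\<lbrakk>f'\<rbrakk> = \<lbrakk>f\<rbrakk>" "\<lbrakk>g'\<rbrakk> = \<lbrakk>g\<rbrakk>"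
  shows "\<lbrakk>g' \<cdot> f'\<rbrakk> = \<lbrakk>g \<cdot> f\<rbrakk>"
proof -
  obtain k where k: "k \<in> Hom B (I (Src B f)) (Tgt B f)" "f' = f \<oplus> k \<cdot> \<mu> (Src B f)"
    using cls_eqE [OF eq(1)] assms by metis
  obtain l where l: "l \<in> Hom B (I (Src B g)) (Tgt B g)" "g' = g \<oplus> l \<cdot> \<mu> (Src B g)"
    using cls_eqE [OF eq(2)] assms by metis
  have "\<lbrakk>g' \<cdot> f'\<rbrakk> = \<lbrakk>g \<cdot> f'\<rbrakk>"
    by (rule cls_eqI [where k = l and j = "\<mu> (Src B g) \<cdot> f'" and J = "I (Src B g)"])
      (use k l assms in \<open>auto simp: hom_iff add_left_commute\<close>)
  also have "\<dots> = \<lbrakk>g \<cdot> f\<rbrakk>"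
    by (rule cls_eqI [where k = "g \<cdot> k" and j = "\<mu> (Src B f)" and J = "I (Src B f)"])
      (use k l assms in \<open>auto simp: hom_iff add_left_commute\<close>)
  finally show ?thesis .
qed

lemma cls_add_cong:
  assumes "f \<in> Arr B" "g \<in> Arr B" "f' \<in> Arr B" "g' \<in> Arr B" "Src B f = Src B g" "Tgt B f = Tgt B g"
    and eq: "\<lbrakk>f'\<rbrakk> = \<lbrakk>f\<rbrakk>" "\<lbrakk>g'\<rbrakk> = \<lbrakk>g\<rbrakk>"
  shows "\<lbrakk>g' \<oplus> f'\<rbrakk> = \<lbrakk>g \<oplus> f\<rbrakk>"
proof -
  obtain k where k: "k \<in> Hom B (I (Src B f)) (Tgt B f)" "f' = f \<oplus> k \<cdot> \<mu> (Src B f)"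
    using cls_eqE [OF eq(1)] assms by metis
  obtain l where l: "l \<in> Hom B (I (Src B g)) (Tgt B g)" "g' = g \<oplus> l \<cdot> \<mu> (Src B g)"
    using cls_eqE [OF eq(2)] assms by metis
  show ?thesis
    by (rule cls_eqI [where k = "l \<oplus> k" and j = "\<mu> (Src B f)" and J = "I (Src B f)"])
      (use k l assms in \<open>auto simp: hom_iff add_left_commute\<close>)
qed

lemma cls_comp [simp]:
  assumes "f \<in> Arr B" "g \<in> Arr B" "Tgt B f = Src B g"
  shows "\<lbrakk>g\<rbrakk> \<cdot>\<^bsub>D\<^esub> \<lbrakk>f\<rbrakk> = \<lbrakk>g \<cdot> f\<rbrakk>"
  using cls_comp_cong [of f g "rep \<lbrakk>f\<rbrakk>" "rep \<lbrakk>g\<rbrakk>"] rep_cls assms by (auto simp: stable_cat_def)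

lemma cls_add [simp]:
  assumes "f \<in> Arr B" "g \<in> Arr B" "Src B f = Src B g" "Tgt B f = Tgt B g"
  shows "\<lbrakk>g\<rbrakk> \<oplus>\<^bsub>D\<^esub> \<lbrakk>f\<rbrakk> = \<lbrakk>g \<oplus> f\<rbrakk>"
  using cls_add_cong [of f g "rep \<lbrakk>f\<rbrakk>" "rep \<lbrakk>g\<rbrakk>"] rep_cls assms by (auto simp: stable_cat_def)

lemma cls_hom [simp]: "f \<in> Hom B X Y \<Longrightarrow> \<lbrakk>f\<rbrakk> \<in> Hom D X Y"
  by (auto simp: Hom_def)

lemma D_homE:
  assumes "F \<in> Hom D X Y"
  obtains f where "f \<in> Hom B X Y" "F = \<lbrakk>f\<rbrakk>"
  using assms by (auto simp: Hom_def elim!: D_arrE)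

sublocale D: additive_category D
proof (intro additive_category.intro preadditive_category.intro category.intro
    additive_category_axioms.intro preadditive_category_axioms.intro)
  fix X Y assume XY: "X \<in> Obj D" "Y \<in> Obj D"
  show "comm_group (hom_group D X Y)"
  proof (rule comm_groupI)
    fix F assume "F \<in> carrier (hom_group D X Y)"
    then obtain f where f: "f \<in> Hom B X Y" "F = \<lbrakk>f\<rbrakk>" by (auto simp: hom_group_def elim: D_homE)
    show "\<exists>G\<in>carrier (hom_group D X Y). G \<otimes>\<^bsub>hom_group D X Y\<^esub> F = \<one>\<^bsub>hom_group D X Y\<^esub>"
      by (rule bexI [of _ "\<lbrakk>neg B f\<rbrakk>"])
        (use f in \<open>auto simp: hom_group_def hom_iff intro!: cls_hom\<close>)
  qed (use XY in \<open>auto simp: hom_group_def hom_iff add_ac elim!: D_homE intro!: cls_hom\<close>)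
next
  obtain Z where Z: "zero_object B Z" using ex_zero_object by blast
  have "\<exists>!F. F \<in> Hom D X Z" if X: "X \<in> Obj B" for X
  proof -
    obtain f where "f \<in> Hom B X Z" using Z X unfolding zero_object_def by blast
    then show ?thesis
      by (intro ex1I [of _ "\<lbrakk>f\<rbrakk>"]) (auto elim!: D_homE dest: zero_object_eq [OF Z])
  qed
  moreover have "\<exists>!F. F \<in> Hom D Z X" if X: "X \<in> Obj B" for X
  proof -
    obtain f where "f \<in> Hom B Z X" using Z X unfolding zero_object_def by blast
    then show ?thesis
      by (intro ex1I [of _ "\<lbrakk>f\<rbrakk>"]) (auto elim!: D_homE dest: zero_object_eq' [OF Z])
  qed
  ultimately have "zero_object D Z"
    using Z unfolding zero_object_def D_simps(1) by simp
  then show "\<exists>Z. zero_object D Z" ..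
next
  fix X Y assume "X \<in> Obj D" "Y \<in> Obj D"
  then obtain W i j p q where "biproduct B X Y W i j p q" using ex_biproduct [of X Y] by auto
  then have "biproduct D X Y W \<lbrakk>i\<rbrakk> \<lbrakk>j\<rbrakk> \<lbrakk>p\<rbrakk> \<lbrakk>q\<rbrakk>"
    by (auto simp: biproduct_def hom_iff intro!: cls_hom)
  then show "\<exists>W i j p q. biproduct D X Y W i j p q" by blast
qed (auto elim!: D_homE D_arrE simp: hom_iff intro!: cls_hom)

lemma cls_neg [simp]: "f \<in> Arr B \<Longrightarrow> neg D \<lbrakk>f\<rbrakk> = \<lbrakk>neg B f\<rbrakk>"
  using D.neg_unique [of "\<lbrakk>f\<rbrakk>" "\<lbrakk>neg B f\<rbrakk>"] by simp

end

section \<open>The suspension\<close>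

context frobenius_choice begin

abbreviation "Sa \<equiv> susp_arr B E \<mu> \<pi>"

lemma cokernel_diff:
  assumes "(i, p) \<in> E" "f \<in> Hom B (Tgt B i) W" "g \<in> Hom B (Tgt B i) W" "f \<cdot> i = g \<cdot> i"
  obtains e where "e \<in> Hom B (Tgt B p) W" "f = g \<oplus> e \<cdot> p"
proof -
  note [simp] = adm_typing [OF assms(1)] assms(2-3) [unfolded hom_iff] assms(4)
  have "(f \<oplus> neg B g) \<cdot> i = Zero B (Src B i) (Tgt B (f \<oplus> neg B g))" by simp
  then obtain e where e: "e \<in> Hom B (Tgt B p) W" "e \<cdot> p = f \<oplus> neg B g"
    using cokernel_factor [OF assms(1), of "f \<oplus> neg B g"] by auto
  note [simp] = homD [OF e(1)]
  have "f = g \<oplus> e \<cdot> p" by (subst eq_add_iff) (auto simp: e(2))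
  then show thesis using that e(1) by blast
qed

lemma kernel_diff:
  assumes "(i, p) \<in> E" "f \<in> Hom B W (Src B p)" "g \<in> Hom B W (Src B p)" "p \<cdot> f = p \<cdot> g"
  obtains e where "e \<in> Hom B W (Src B i)" "f = g \<oplus> i \<cdot> e"
proof -
  note [simp] = adm_typing [OF assms(1)] assms(2-3) [unfolded hom_iff] assms(4)
  have "p \<cdot> (f \<oplus> neg B g) = Zero B (Src B (f \<oplus> neg B g)) (Tgt B p)" by simp
  then obtain e where e: "e \<in> Hom B W (Src B i)" "i \<cdot> e = f \<oplus> neg B g"
    using kernel_factor [OF assms(1), of "f \<oplus> neg B g"] by auto
  note [simp] = homD [OF e(1)]
  have "f = g \<oplus> i \<cdot> e" by (subst eq_add_iff) (auto simp: e(2))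
  then show thesis using that e(1) by blast
qed

text \<open>The data in the diagram that defines the suspension of the class of \<open>f\<close>: \<open>h\<close> is the map of injective
  objects and \<open>g\<close> the induced map of cokernels.\<close>

definition susp_lift :: "'m \<Rightarrow> 'm \<Rightarrow> 'm \<Rightarrow> bool" where
  "susp_lift f h g \<longleftrightarrow> f \<in> Arr B \<and> h \<in> Hom B (I (Src B f)) (I (Tgt B f)) \<and>
     g \<in> Hom B (S (Src B f)) (S (Tgt B f)) \<and>
     h \<cdot> \<mu> (Src B f) = \<mu> (Tgt B f) \<cdot> f \<and> g \<cdot> \<pi> (Src B f) = \<pi> (Tgt B f) \<cdot> h"

lemma susp_liftD:
  assumes "susp_lift f h g"
  shows "f \<in> Arr B" "h \<in> Arr B" "Src B h = I (Src B f)" "Tgt B h = I (Tgt B f)"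
    "g \<in> Arr B" "Src B g = S (Src B f)" "Tgt B g = S (Tgt B f)"
    "h \<cdot> \<mu> (Src B f) = \<mu> (Tgt B f) \<cdot> f" "g \<cdot> \<pi> (Src B f) = \<pi> (Tgt B f) \<cdot> h"
  using assms by (auto simp: susp_lift_def hom_iff)

lemma susp_lift_ex:
  assumes "f \<in> Arr B"
  shows "\<exists>h g. susp_lift f h g"
proof -
  let ?X = "Src B f" and ?Y = "Tgt B f"
  note [simp] = assms
  obtain h where h: "h \<in> Hom B (I ?X) (I ?Y)" "h \<cdot> \<mu> ?X = \<mu> ?Y \<cdot> f"
    using injective_extend [OF conflation, of ?X "I ?Y" "\<mu> ?Y \<cdot> f"] by (auto simp: hom_iff)
  note [simp] = homD [OF h(1)]
  have "(\<pi> ?Y \<cdot> h) \<cdot> \<mu> ?X = Zero B (Src B (\<mu> ?X)) (Tgt B (\<pi> ?Y \<cdot> h))"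
    by (simp add: h(2))
  then obtain g where "g \<in> Hom B (S ?X) (S ?Y)" "g \<cdot> \<pi> ?X = \<pi> ?Y \<cdot> h"
    using cokernel_factor [OF conflation, of ?X "\<pi> ?Y \<cdot> h"] by auto
  then show ?thesis using h unfolding susp_lift_def by auto
qed

text \<open>If \<open>f - f' = k \<cdot> \<mu>\<close>, then \<open>h - h' - \<mu> \<cdot> k\<close> vanishes on \<open>X\<close>, hence factors as \<open>d \<cdot> \<pi>\<close>; composing with
  \<open>\<pi>\<close> gives \<open>g - g' = \<pi> \<cdot> d\<close>, which factors through an injective object.\<close>

lemma susp_lift_unique:
  assumes "susp_lift f h g" "susp_lift f' h' g'" "\<lbrakk>f\<rbrakk> = \<lbrakk>f'\<rbrakk>"
  shows "\<lbrakk>g\<rbrakk> = \<lbrakk>g'\<rbrakk>"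
proof -
  note l = susp_liftD [OF assms(1)] and l' = susp_liftD [OF assms(2)]
  define X Y where "X = Src B f" and "Y = Tgt B f"
  obtain k where k: "k \<in> Hom B (I X) Y" "f = f' \<oplus> k \<cdot> \<mu> X" and st: "Src B f' = X" "Tgt B f' = Y"
    using cls_eqE [OF assms(3) l(1) l'(1)] X_def Y_def by metis
  have [simp]: "X \<in> Obj B" "Y \<in> Obj B" "Src B f' = X" "Tgt B f' = Y" "Src B f = X" "Tgt B f = Y"
    using l(1) st by (auto simp: X_def Y_def)
  note [simp] = homD [OF k(1)] l l'
  have "h \<cdot> \<mu> X = \<mu> Y \<cdot> f" "h' \<cdot> \<mu> X = \<mu> Y \<cdot> f'" using l(8) l'(8) by simp_all
  moreover have "\<mu> Y \<cdot> f = \<mu> Y \<cdot> f' \<oplus> \<mu> Y \<cdot> k \<cdot> \<mu> X" by (subst k(2)) simp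
  ultimately have "h \<cdot> \<mu> X = (h' \<oplus> \<mu> Y \<cdot> k) \<cdot> \<mu> X" by simp
  then obtain d where d: "d \<in> Hom B (S X) (I Y)" "h = (h' \<oplus> \<mu> Y \<cdot> k) \<oplus> d \<cdot> \<pi> X"
    by (rule cokernel_diff [OF conflation, of X h "I Y" "h' \<oplus> \<mu> Y \<cdot> k", rotated 3])
      (auto simp: hom_iff)
  note [simp] = homD [OF d(1)]
  have "g = g' \<oplus> \<pi> Y \<cdot> d"
  proof (rule cokernel_epi [OF conflation, of X])
    have "g \<cdot> \<pi> X = \<pi> Y \<cdot> h" "g' \<cdot> \<pi> X = \<pi> Y \<cdot> h'" using l(9) l'(9) by simp_all
    moreover have "\<pi> Y \<cdot> h = \<pi> Y \<cdot> h' \<oplus> \<pi> Y \<cdot> d \<cdot> \<pi> X" by (subst d(2)) simp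
    ultimately show "g \<cdot> \<pi> X = (g' \<oplus> \<pi> Y \<cdot> d) \<cdot> \<pi> X" by simp
  qed auto
  then show ?thesis
    by (rule cls_eqI [where J = "I Y" and X = "S X" and Y = "S Y"]) (auto simp: hom_iff)
qed

lemma susp_cls:
  assumes "susp_lift f h g"
  shows "Sa \<lbrakk>f\<rbrakk> = \<lbrakk>g\<rbrakk>"
proof -
  let ?r = "rep \<lbrakk>f\<rbrakk>"
  note r = rep_cls [OF susp_liftD(1) [OF assms]]
  define P where "P g' \<longleftrightarrow> g' \<in> Hom B (S (Src B ?r)) (S (Tgt B ?r)) \<and>
        (\<exists>h' \<in> Hom B (Tgt B (\<mu> (Src B ?r))) (Tgt B (\<mu> (Tgt B ?r))).
           h' \<cdot> \<mu> (Src B ?r) = \<mu> (Tgt B ?r) \<cdot> ?r \<and> g' \<cdot> \<pi> (Src B ?r) = \<pi> (Tgt B ?r) \<cdot> h')" for g'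
  have P: "P g' \<longleftrightarrow> (\<exists>h'. susp_lift ?r h' g')" for g'
    unfolding P_def susp_lift_def using r(1) by auto
  have "P (SOME g'. P g')" by (rule someI_ex) (use susp_lift_ex [OF r(1)] P in blast)
  then obtain h' where "susp_lift ?r h' (SOME g'. P g')" using P by blast
  moreover have "Sa \<lbrakk>f\<rbrakk> = \<lbrakk>SOME g'. P g'\<rbrakk>" unfolding susp_arr_def Let_def P_def ..
  ultimately show ?thesis using susp_lift_unique [OF _ assms r(2)] by simp
qed

lemma susp_functor: "additive_functor D D S Sa"
  unfolding additive_functor_def
proof (intro conjI ballI impI)
  fix X assume X: "X \<in> Obj D"
  then show "S X \<in> Obj D" by simp
  have "susp_lift (Ident B X) (Ident B (I X)) (Ident B (S X))"
    using X by (auto simp: susp_lift_def hom_iff)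
  then show "Sa (Ident D X) = Ident D (S X)" by (simp add: susp_cls)
next
  fix F assume "F \<in> Arr D"
  then obtain f where f: "f \<in> Arr B" "F = \<lbrakk>f\<rbrakk>" by (rule D_arrE)
  obtain h g where "susp_lift f h g" using susp_lift_ex f(1) by blast
  then show "Sa F \<in> Hom D (S (Src D F)) (S (Tgt D F))"
    using f by (simp add: susp_cls D.hom_iff) (auto simp: susp_lift_def hom_iff)
next
  fix F F' assume F: "F \<in> Arr D" "F' \<in> Arr D"
  then obtain f f' where f: "f \<in> Arr B" "f' \<in> Arr B" "F = \<lbrakk>f\<rbrakk>" "F' = \<lbrakk>f'\<rbrakk>" by (metis D_arrE)
  obtain h g where l: "susp_lift f h g" using susp_lift_ex f(1) by blast
  obtain h' g' where l': "susp_lift f' h' g'" using susp_lift_ex f(2) by blast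
  note [simp] = susp_liftD [OF l] susp_liftD [OF l']
  {
    assume "Tgt D F = Src D F'"
    then have st: "Src B f' = Tgt B f" by (simp add: f)
    have st' [simp]: "Src B h' = I (Tgt B f)" "Src B g' = S (Tgt B f)" by (simp_all flip: st)
    have sq: "h' \<cdot> \<mu> (Tgt B f) = \<mu> (Tgt B f') \<cdot> f'" "g' \<cdot> \<pi> (Tgt B f) = \<pi> (Tgt B f') \<cdot> h'"
      using susp_liftD(8,9) [OF l'] by (simp_all add: st)
    then have "susp_lift (f' \<cdot> f) (h' \<cdot> h) (g' \<cdot> g)"
      using st comp_reassoc2 [OF sq(1), of f] comp_reassoc2 [OF sq(2), of h]
      by (simp add: susp_lift_def hom_iff)
    then show "Sa (F' \<cdot>\<^bsub>D\<^esub> F) = Sa F' \<cdot>\<^bsub>D\<^esub> Sa F"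
      using st l l' by (simp add: f susp_cls)
  }
  {
    assume "Src D F = Src D F' \<and> Tgt D F = Tgt D F'"
    then have st: "Src B f' = Src B f" "Tgt B f' = Tgt B f" by (simp_all add: f)
    have "h' \<cdot> \<mu> (Src B f) = \<mu> (Tgt B f) \<cdot> f'" "g' \<cdot> \<pi> (Src B f) = \<pi> (Tgt B f) \<cdot> h'"
      using susp_liftD(8,9) [OF l'] by (simp_all add: st)
    then have "susp_lift (f \<oplus> f') (h \<oplus> h') (g \<oplus> g')"
      using st by (simp add: susp_lift_def hom_iff)
    then show "Sa (F \<oplus>\<^bsub>D\<^esub> F') = Sa F \<oplus>\<^bsub>D\<^esub> Sa F'"
      using st l l' by (simp add: f susp_cls)
  }
qed

text \<open>Since \<open>I X\<close> is projective, an arrow between suspensions lifts to the injective objects, and the lift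
  restricts to the kernels.\<close>

lemma susp_full:
  assumes X: "X \<in> Obj B" and Y: "Y \<in> Obj B" and G: "G \<in> Hom D (S X) (S Y)"
  shows "\<exists>F \<in> Hom D X Y. Sa F = G"
proof -
  obtain g where g: "g \<in> Hom B (S X) (S Y)" "G = \<lbrakk>g\<rbrakk>" by (rule D_homE [OF G])
  note [simp] = X Y homD [OF g(1)]
  obtain h where h: "h \<in> Hom B (I X) (I Y)" "\<pi> Y \<cdot> h = g \<cdot> \<pi> X"
    using injective_lift [OF conflation [OF Y], of "I X" "g \<cdot> \<pi> X"] by (auto simp: hom_iff)
  note [simp] = homD [OF h(1)]
  have "\<pi> Y \<cdot> h \<cdot> \<mu> X = Zero B (Src B (h \<cdot> \<mu> X)) (Tgt B (\<pi> Y))"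
    using comp_reassoc2 [OF h(2), of "\<mu> X"] by simp
  then obtain f where f: "f \<in> Hom B X Y" "\<mu> Y \<cdot> f = h \<cdot> \<mu> X"
    using kernel_factor [OF conflation [OF Y], of "h \<cdot> \<mu> X"] by auto
  have "susp_lift f h g" using f h g by (simp add: susp_lift_def hom_iff)
  then show ?thesis using g f(1) by (intro bexI [of _ "\<lbrakk>f\<rbrakk>"]) (auto simp: susp_cls)
qed

text \<open>The difference of the two suspensions has the form \<open>\<pi> \<cdot> k\<close>. So \<open>h - h' - k \<cdot> \<pi>\<close> is killed by \<open>\<pi>\<close> and
  factors as \<open>\<mu> \<cdot> e\<close>; then \<open>f - f' = e \<cdot> \<mu>\<close>.\<close>

lemma susp_faithful:
  assumes F: "F \<in> Hom D X Y" "F' \<in> Hom D X Y" and eq: "Sa F = Sa F'"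
  shows "F = F'"
proof -
  obtain f where f: "f \<in> Hom B X Y" "F = \<lbrakk>f\<rbrakk>" by (rule D_homE [OF F(1)])
  obtain f' where f': "f' \<in> Hom B X Y" "F' = \<lbrakk>f'\<rbrakk>" by (rule D_homE [OF F(2)])
  note [simp] = homD [OF f(1)] homD [OF f'(1)]
  obtain h g where l: "susp_lift f h g" using susp_lift_ex [of f] by auto
  obtain h' g' where l': "susp_lift f' h' g'" using susp_lift_ex [of f'] by auto
  note [simp] = susp_liftD(1-7) [OF l] susp_liftD(1-7) [OF l']
  have "\<lbrakk>g\<rbrakk> = \<lbrakk>g'\<rbrakk>" using eq l l' f(2) f'(2) by (simp add: susp_cls)
  then obtain c where c: "c \<in> Hom B (I (S X)) (S Y)" "g = g' \<oplus> c \<cdot> \<mu> (S X)"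
    by (rule cls_eqE) auto
  note [simp] = homD [OF c(1)]
  \<comment> \<open>An arrow into \<open>S Y\<close> that factors through a projective object lifts along \<open>\<pi> Y\<close>.\<close>
  obtain c' where c': "c' \<in> Hom B (I (S X)) (I Y)" "\<pi> Y \<cdot> c' = c"
    using injective_lift [OF conflation [of Y], of "I (S X)" c] c(1) by auto
  define k where "k = c' \<cdot> \<mu> (S X)"
  note [simp] = homD [OF c'(1)]
  have [simp]: "k \<in> Arr B" "Src B k = S X" "Tgt B k = I Y" by (simp_all add: k_def)
  have gk: "g = g' \<oplus> \<pi> Y \<cdot> k"
    using c(2) c'(2) comp_reassoc [OF c'(2), of "\<mu> (S X)"] by (simp add: k_def)
  have "\<pi> Y \<cdot> h = \<pi> Y \<cdot> (h' \<oplus> k \<cdot> \<pi> X)"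
  proof -
    have "\<pi> Y \<cdot> h = g \<cdot> \<pi> X" "\<pi> Y \<cdot> h' = g' \<cdot> \<pi> X" using susp_liftD(9) [OF l] susp_liftD(9) [OF l'] by simp_all
    moreover have "g \<cdot> \<pi> X = g' \<cdot> \<pi> X \<oplus> \<pi> Y \<cdot> k \<cdot> \<pi> X" by (subst gk) simp
    ultimately show ?thesis by simp
  qed
  then obtain e where e: "e \<in> Hom B (I X) Y" "h = (h' \<oplus> k \<cdot> \<pi> X) \<oplus> \<mu> Y \<cdot> e"
    by (rule kernel_diff [OF conflation [of Y], of h "I X" "h' \<oplus> k \<cdot> \<pi> X", rotated 3])
      (auto simp: hom_iff)
  note [simp] = homD [OF e(1)]
  have "f = f' \<oplus> e \<cdot> \<mu> X"
  proof (rule kernel_mono [OF conflation [of Y]])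
    have "\<mu> Y \<cdot> f = h \<cdot> \<mu> X" "\<mu> Y \<cdot> f' = h' \<cdot> \<mu> X" using susp_liftD(8) [OF l] susp_liftD(8) [OF l'] by simp_all
    moreover have "h \<cdot> \<mu> X = h' \<cdot> \<mu> X \<oplus> \<mu> Y \<cdot> e \<cdot> \<mu> X" by (subst e(2)) simp
    ultimately show "\<mu> Y \<cdot> f = \<mu> Y \<cdot> (f' \<oplus> e \<cdot> \<mu> X)" by simp
  qed auto
  then have "\<lbrakk>f\<rbrakk> = \<lbrakk>f'\<rbrakk>"
    by (rule cls_eqI [where J = "I X" and X = X and Y = Y]) (auto simp: hom_iff)
  then show ?thesis using f f' by simp
qed

text \<open>Two injective objects \<open>J\<close>, \<open>J'\<close> around the same object have stably isomorphic cokernels: \<open>\<beta> \<cdot> \<alpha> - 1\<close> vanishes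
  on that object, so it factors as \<open>e \<cdot> p\<close>, and \<open>t \<cdot> s - 1 = p \<cdot> e\<close> factors through \<open>J\<close>.\<close>

lemma cokernel_comparison:
  assumes "(i, p) \<in> E" "injective_obj B E J" "Src B p = J"
    "\<alpha> \<in> Hom B J J'" "\<beta> \<in> Hom B J' J" "(\<beta> \<cdot> \<alpha>) \<cdot> i = i"
    "s \<in> Hom B (Tgt B p) Z" "t \<in> Hom B Z (Tgt B p)" "p' \<in> Hom B J' Z"
    "s \<cdot> p = p' \<cdot> \<alpha>" "t \<cdot> p' = p \<cdot> \<beta>"
  shows "\<lbrakk>t \<cdot> s\<rbrakk> = \<lbrakk>Ident B (Tgt B p)\<rbrakk>"
proof -
  note [simp] = adm_typing(1,2,4) [OF assms(1)] assms(4,5,7,8,9) [unfolded hom_iff] assms(3)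
  have [simp]: "Tgt B i = J" using adm_typing [OF assms(1)] assms(3) by simp
  have "(\<beta> \<cdot> \<alpha>) \<cdot> i = Ident B J \<cdot> i" using assms(6) by simp
  then obtain e where e: "e \<in> Hom B (Tgt B p) J" "\<beta> \<cdot> \<alpha> = Ident B J \<oplus> e \<cdot> p"
    by (rule cokernel_diff [OF assms(1), of "\<beta> \<cdot> \<alpha>" J "Ident B J", rotated 2]) (auto simp: hom_iff)
  note [simp] = homD [OF e(1)]
  have "t \<cdot> s = Ident B (Tgt B p) \<oplus> p \<cdot> e"
  proof (rule cokernel_epi [OF assms(1)])
    show "(t \<cdot> s) \<cdot> p = (Ident B (Tgt B p) \<oplus> p \<cdot> e) \<cdot> p"
      using assms(10) comp_reassoc2 [OF assms(11), of \<alpha>] e(2) by simp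
  qed auto
  then show ?thesis
    by (rule cls_eqI [where J = J and X = "Tgt B p" and Y = "Tgt B p"])
      (auto simp: hom_iff assms(2))
qed

text \<open>Take a conflation \<open>K \<rightarrow> P \<rightarrow> X\<close> with \<open>P\<close> projective. It and \<open>K \<rightarrow> I K \<rightarrow> S K\<close> are two embeddings of
  \<open>K\<close> into injective objects, so their cokernels are stably isomorphic (Schanuel).\<close>

lemma susp_dense:
  assumes "X \<in> Obj B"
  shows "\<exists>K \<in> Obj B. \<exists>t \<in> Hom D (S K) X. iso_arr D t"
proof -
  have "enough_projectives B E" using frobenius by (simp add: frobenius_category_def)
  then obtain i p where ip: "(i, p) \<in> E" and [simp]: "Tgt B p = X" and P: "injective_obj B E (Src B p)"
    using assms by (auto simp: enough_projectives_def adm_epi_def projective_iff_injective)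
  define K P where "K = Src B i" and "P = Src B p"
  have [simp]: "Src B i = K" "Tgt B i = P" "Src B p = P" "i \<in> Arr B" "p \<in> Arr B" "p \<cdot> i = Zero B K X"
    "K \<in> Obj B" "P \<in> Obj B" "X \<in> Obj B"
    using adm_typing [OF ip] assms by (auto simp: K_def P_def)
  have PJ: "injective_obj B E P" unfolding P_def by (fact P)
  obtain \<alpha> where \<alpha>: "\<alpha> \<in> Hom B P (I K)" "\<alpha> \<cdot> i = \<mu> K"
    using injective_extend [OF ip, of "I K" "\<mu> K"] by (auto simp: hom_iff)
  obtain \<beta> where \<beta>: "\<beta> \<in> Hom B (I K) P" "\<beta> \<cdot> \<mu> K = i"
    using injective_extend [OF conflation [of K], of P i] P by (auto simp: hom_iff)
  note [simp] = homD [OF \<alpha>(1)] homD [OF \<beta>(1)] \<alpha>(2) \<beta>(2)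
  obtain s where s: "s \<in> Hom B X (S K)" "s \<cdot> p = \<pi> K \<cdot> \<alpha>"
    using cokernel_factor [OF ip, of "\<pi> K \<cdot> \<alpha>"] by auto
  obtain t where t: "t \<in> Hom B (S K) X" "t \<cdot> \<pi> K = p \<cdot> \<beta>"
    using cokernel_factor [OF conflation [of K], of "p \<cdot> \<beta>"] by auto
  note [simp] = homD [OF s(1)] homD [OF t(1)]
  have "\<lbrakk>t \<cdot> s\<rbrakk> = \<lbrakk>Ident B X\<rbrakk>"
    using cokernel_comparison [OF ip PJ, of \<alpha> "I K" \<beta> s "S K" t "\<pi> K"] s t by (auto simp: hom_iff)
  moreover have "\<lbrakk>s \<cdot> t\<rbrakk> = \<lbrakk>Ident B (S K)\<rbrakk>"
    using cokernel_comparison [OF conflation [of K], of "I K" \<beta> P \<alpha> t X s p] s t by (auto simp: hom_iff)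
  ultimately have "iso_arr D \<lbrakk>t\<rbrakk>"
    by (intro D.iso_arrI [of _ "S K" X "\<lbrakk>s\<rbrakk>"]) (auto simp: D.hom_iff)
  then show ?thesis
    by (intro bexI [of _ K] bexI [of _ "\<lbrakk>t\<rbrakk>"]) (auto simp: D.hom_iff)
qed

end

section \<open>Triangulations from standard triangles\<close>

text \<open>The part of the axioms of a triangulated category that needs the construction of the standard
  triangles. For the octahedral axiom a single octahedron on each composable pair is enough, and rotation is
  assumed in one direction only; in exchange the suspension is fully faithful and dense, and \<open>v\<close> is a weak
  cokernel of \<open>u\<close>.\<close>

locale cone_category = additive_category D
  for D :: "('o, 'm) precat" (structure) +
  fixes So :: "'o \<Rightarrow> 'o" and Sa :: "'m \<Rightarrow> 'm" and Std :: "('m \<times> 'm \<times> 'm) set"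
  assumes S_functor: "additive_functor D D So Sa"
    and S_full: "\<lbrakk>X \<in> Obj D; Y \<in> Obj D; g \<in> Hom D (So X) (So Y)\<rbrakk> \<Longrightarrow> \<exists>f \<in> Hom D X Y. Sa f = g"
    and S_faithful: "\<lbrakk>f \<in> Hom D X Y; g \<in> Hom D X Y; Sa f = Sa g\<rbrakk> \<Longrightarrow> f = g"
    and S_dense: "X \<in> Obj D \<Longrightarrow> \<exists>Y \<in> Obj D. \<exists>t \<in> Hom D (So Y) X. iso_arr D t"
    and std_triangle: "T \<in> Std \<Longrightarrow> triangle D So T"
    and std_ex: "u \<in> Arr D \<Longrightarrow> \<exists>v w. (u, v, w) \<in> Std"
    and std_ident: "X \<in> Obj D \<Longrightarrow>
          \<exists>v w. (Ident D X, v, w) \<in> Std \<and> Ident D (Tgt D v) = Zero D (Tgt D v) (Tgt D v)"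
    and std_factor: "\<lbrakk>(u, v, w) \<in> Std; x \<in> Arr D; Src D x = Tgt D u;
          x \<cdot> u = Zero D (Src D u) (Tgt D x)\<rbrakk> \<Longrightarrow> \<exists>y \<in> Hom D (Tgt D v) (Tgt D x). x = y \<cdot> v"
    and std_rotate: "(u, v, w) \<in> Std \<Longrightarrow> \<exists>T \<in> Std. triangle_iso D Sa T (v, w, neg D (Sa u))"
    and std_mor: "\<lbrakk>(u, v, w) \<in> Std; (u', v', w') \<in> Std;
           f \<in> Hom D (Src D u) (Src D u'); g \<in> Hom D (Tgt D u) (Tgt D u');
           g \<cdot> u = u' \<cdot> f\<rbrakk> \<Longrightarrow> \<exists>h. triangle_mor D Sa (u, v, w) (u', v', w') f g h"
    and std_octahedron: "\<lbrakk>u \<in> Arr D; v \<in> Arr D; Tgt D u = Src D v\<rbrakk> \<Longrightarrow>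
           \<exists>i i' j j' k k' f g. (u, i, i') \<in> Std \<and> (v, j, j') \<in> Std \<and> (v \<cdot> u, k, k') \<in> Std \<and>
             triangle_mor D Sa (u, i, i') (v \<cdot> u, k, k') (Ident D (Src D u)) v f \<and>
             triangle_mor D Sa (v \<cdot> u, k, k') (v, j, j') u (Ident D (Tgt D v)) g \<and>
             (\<exists>T \<in> Std. triangle_iso D Sa T (f, g, Sa i \<cdot> j'))"
begin

definition "Dist = {T. triangle D So T \<and> (\<exists>T' \<in> Std. triangle_iso D Sa T' T)}"

lemma S_simps [simp]:
  "X \<in> Obj D \<Longrightarrow> So X \<in> Obj D"
  "X \<in> Obj D \<Longrightarrow> Sa (Ident D X) = Ident D (So X)"
  "f \<in> Arr D \<Longrightarrow> Sa f \<in> Arr D"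
  "f \<in> Arr D \<Longrightarrow> Src D (Sa f) = So (Src D f)"
  "f \<in> Arr D \<Longrightarrow> Tgt D (Sa f) = So (Tgt D f)"
  "\<lbrakk>f \<in> Arr D; g \<in> Arr D; Tgt D f = Src D g\<rbrakk> \<Longrightarrow> Sa (g \<cdot> f) = Sa g \<cdot> Sa f"
  "\<lbrakk>f \<in> Arr D; g \<in> Arr D; Src D f = Src D g; Tgt D f = Tgt D g\<rbrakk> \<Longrightarrow> Sa (f \<oplus> g) = Sa f \<oplus> Sa g"
  using S_functor unfolding additive_functor_def by (auto simp: hom_iff)

lemma S_zero [simp]: "\<lbrakk>X \<in> Obj D; Y \<in> Obj D\<rbrakk> \<Longrightarrow> Sa (Zero D X Y) = Zero D (So X) (So Y)"
  using S_simps(7) [of "Zero D X Y" "Zero D X Y"] by (intro add_self_zero) auto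

lemma S_neg [simp]: "f \<in> Arr D \<Longrightarrow> Sa (neg D f) = neg D (Sa f)"
  using S_simps(7) [of f "neg D f"] by (intro neg_unique) auto

lemma S_reflects_iso:
  assumes "f \<in> Arr D" "iso_arr D (Sa f)"
  shows "iso_arr D f"
proof -
  obtain g' where g': "g' \<in> Hom D (So (Tgt D f)) (So (Src D f))"
    "g' \<cdot> Sa f = Ident D (So (Src D f))" "Sa f \<cdot> g' = Ident D (So (Tgt D f))"
    using assms by (auto simp: iso_arr_def)
  obtain g where g: "g \<in> Hom D (Tgt D f) (Src D f)" "Sa g = g'"
    using S_full [of "Tgt D f" "Src D f" g'] g' assms by auto
  note [simp] = homD [OF g(1)] assms(1)
  have "g \<cdot> f = Ident D (Src D f)"
    by (rule S_faithful [of _ "Src D f" "Src D f"]) (use g'(2) g(2) in \<open>auto intro: homI\<close>)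
  moreover have "f \<cdot> g = Ident D (Tgt D f)"
    by (rule S_faithful [of _ "Tgt D f" "Tgt D f"]) (use g'(3) g(2) in \<open>auto intro: homI\<close>)
  ultimately show ?thesis
    by (intro iso_arrI [of f _ _ g]) (auto intro: homI)
qed

subsection \<open>Morphisms of triangles\<close>

lemma triangle_iff: "triangle D So (u, v, w) \<longleftrightarrow> u \<in> Arr D \<and> v \<in> Arr D \<and> w \<in> Arr D \<and>
     Src D v = Tgt D u \<and> Src D w = Tgt D v \<and> Tgt D w = So (Src D u)"
  by (simp add: triangle_def)

lemma triangle_morE:
  assumes "triangle_mor D Sa (u, v, w) (u', v', w') f g h"
  shows "f \<in> Hom D (Src D u) (Src D u')" "g \<in> Hom D (Src D v) (Src D v')"
    "h \<in> Hom D (Src D w) (Src D w')"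
    "g \<cdot> u = u' \<cdot> f" "h \<cdot> v = v' \<cdot> g" "Sa f \<cdot> w = w' \<cdot> h"
  using assms by (auto simp: triangle_mor_def)

lemma triangle_morI:
  assumes "f \<in> Hom D (Src D u) (Src D u')" "g \<in> Hom D (Src D v) (Src D v')"
    "h \<in> Hom D (Src D w) (Src D w')"
    "g \<cdot> u = u' \<cdot> f" "h \<cdot> v = v' \<cdot> g" "Sa f \<cdot> w = w' \<cdot> h"
  shows "triangle_mor D Sa (u, v, w) (u', v', w') f g h"
  using assms by (auto simp: triangle_mor_def)

lemma square_comp:
  assumes "g \<cdot> u = u' \<cdot> f" "g' \<cdot> u' = u'' \<cdot> f'"
    "u \<in> Hom D X Y" "u' \<in> Hom D X' Y'" "u'' \<in> Hom D X'' Y''"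
    "f \<in> Hom D X X'" "g \<in> Hom D Y Y'" "f' \<in> Hom D X' X''" "g' \<in> Hom D Y' Y''"
  shows "(g' \<cdot> g) \<cdot> u = u'' \<cdot> f' \<cdot> f"
proof -
  note [simp] = assms(3-9) [unfolded hom_iff]
  show ?thesis using assms(1) comp_reassoc2 [OF assms(2), of f] by simp
qed

lemma square_inverse:
  assumes "g \<cdot> u = u' \<cdot> f"
    "u \<in> Hom D X Y" "u' \<in> Hom D X' Y'" "f \<in> Hom D X X'" "g \<in> Hom D Y Y'"
    "f' \<in> Hom D X' X" "g' \<in> Hom D Y' Y" "f \<cdot> f' = Ident D X'" "g' \<cdot> g = Ident D Y"
  shows "g' \<cdot> u' = u \<cdot> f'"
proof -
  note [simp] = assms(2-7) [unfolded hom_iff]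
  have "g' \<cdot> u' = g' \<cdot> (u' \<cdot> f) \<cdot> f'" by (simp add: assms(8))
  also have "\<dots> = g' \<cdot> (g \<cdot> u) \<cdot> f'" by (simp only: assms(1))
  also have "\<dots> = u \<cdot> f'" using comp_reassoc [OF assms(9), of "u \<cdot> f'"] by simp
  finally show ?thesis .
qed

lemma triangle_mor_comp:
  assumes "triangle D So (u, v, w)" "triangle D So (u', v', w')" "triangle D So (u'', v'', w'')"
    and m: "triangle_mor D Sa (u, v, w) (u', v', w') f g h"
    and m': "triangle_mor D Sa (u', v', w') (u'', v'', w'') f' g' h'"
  shows "triangle_mor D Sa (u, v, w) (u'', v'', w'') (f' \<cdot> f) (g' \<cdot> g) (h' \<cdot> h)"
proof -
  note t = assms(1-3) [unfolded triangle_iff]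
  note e = triangle_morE [OF m] and e' = triangle_morE [OF m']
  note [simp] = e(1-3) [unfolded hom_iff]
    e'(1-3) [unfolded hom_iff]
  have "Sa (f' \<cdot> f) \<cdot> w = w'' \<cdot> h' \<cdot> h"
    using square_comp [OF e(6) e'(6)] t by (simp add: hom_iff)
  moreover have "(g' \<cdot> g) \<cdot> u = u'' \<cdot> f' \<cdot> f"
    by (rule square_comp [OF e(4) e'(4)]) (use t in \<open>auto intro: homI\<close>)
  moreover have "(h' \<cdot> h) \<cdot> v = v'' \<cdot> g' \<cdot> g"
    by (rule square_comp [OF e(5) e'(5)]) (use t in \<open>auto intro: homI\<close>)
  ultimately show ?thesis using t by (intro triangle_morI) (auto intro: homI)
qed

lemma triangle_mor_inverse:
  assumes "triangle D So (u, v, w)" "triangle D So (u', v', w')"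
    and m: "triangle_mor D Sa (u, v, w) (u', v', w') f g h"
    and iso: "iso_arr D f" "iso_arr D g" "iso_arr D h"
  obtains f' g' h' where "triangle_mor D Sa (u', v', w') (u, v, w) f' g' h'"
    "iso_arr D f'" "iso_arr D g'" "iso_arr D h'"
    "f \<cdot> f' = Ident D (Src D u')" "g \<cdot> g' = Ident D (Src D v')" "h \<cdot> h' = Ident D (Src D w')"
    "f' \<cdot> f = Ident D (Src D u)" "g' \<cdot> g = Ident D (Src D v)" "h' \<cdot> h = Ident D (Src D w)"
proof -
  note t = assms(1-2) [unfolded triangle_iff]
  note e = triangle_morE [OF m]
  obtain f' where f': "f' \<in> Hom D (Src D u') (Src D u)" "f' \<cdot> f = Ident D (Src D u)"
    "f \<cdot> f' = Ident D (Src D u')" "iso_arr D f'"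
    using iso_arrE [OF iso(1) e(1)] by metis
  obtain g' where g': "g' \<in> Hom D (Src D v') (Src D v)" "g' \<cdot> g = Ident D (Src D v)"
    "g \<cdot> g' = Ident D (Src D v')" "iso_arr D g'"
    using iso_arrE [OF iso(2) e(2)] by metis
  obtain h' where h': "h' \<in> Hom D (Src D w') (Src D w)" "h' \<cdot> h = Ident D (Src D w)"
    "h \<cdot> h' = Ident D (Src D w')" "iso_arr D h'"
    using iso_arrE [OF iso(3) e(3)] by metis
  note [simp] = homD [OF f'(1)] homD [OF e(1)]
  have "g' \<cdot> u' = u \<cdot> f'"
    by (rule square_inverse [OF e(4) _ _ e(1) _ f'(1) _ f'(3)]) (use t e g' in \<open>auto intro: homI\<close>)
  moreover have "h' \<cdot> v' = v \<cdot> g'"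
    by (rule square_inverse [OF e(5) _ _ e(2) _ g'(1) _ g'(3)]) (use t e h' in \<open>auto intro: homI\<close>)
  moreover have "Sa f' \<cdot> w' = w \<cdot> h'"
  proof (rule square_inverse [OF e(6) _ _ e(3) _ h'(1) _ h'(3)])
    have "Sa (f' \<cdot> f) = Ident D (So (Src D u))" unfolding f'(2) using t by simp
    then show "Sa f' \<cdot> Sa f = Ident D (So (Src D u))" by simp
  qed (use t in \<open>auto intro: homI\<close>)
  ultimately show thesis
    using f' g' h' by (intro that triangle_morI) auto
qed

lemma triangle_iso_sym:
  assumes "triangle D So T" "triangle D So T'" "triangle_iso D Sa T T'"
  shows "triangle_iso D Sa T' T"
proof -
  obtain u v w u' v' w' where T: "T = (u, v, w)" "T' = (u', v', w')" by (metis prod_cases3)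
  obtain f g h where "triangle_mor D Sa T T' f g h" "iso_arr D f" "iso_arr D g" "iso_arr D h"
    using assms(3) by (auto simp: triangle_iso_def)
  then show ?thesis
    using triangle_mor_inverse assms(1,2) unfolding T triangle_iso_def by metis
qed

lemma triangle_iso_trans:
  assumes "triangle D So T" "triangle D So T'" "triangle D So T''"
    "triangle_iso D Sa T T'" "triangle_iso D Sa T' T''"
  shows "triangle_iso D Sa T T''"
proof -
  obtain u v w u' v' w' u'' v'' w''
    where T: "T = (u, v, w)" "T' = (u', v', w')" "T'' = (u'', v'', w'')" by (metis prod_cases3)
  obtain f g h where m: "triangle_mor D Sa T T' f g h" "iso_arr D f" "iso_arr D g" "iso_arr D h"
    using assms(4) by (auto simp: triangle_iso_def)
  obtain f' g' h' where m': "triangle_mor D Sa T' T'' f' g' h'" "iso_arr D f'" "iso_arr D g'" "iso_arr D h'"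
    using assms(5) by (auto simp: triangle_iso_def)
  have "triangle_mor D Sa T T'' (f' \<cdot> f) (g' \<cdot> g) (h' \<cdot> h)"
    using triangle_mor_comp assms(1-3) m(1) m'(1) unfolding T by blast
  moreover have "Tgt D f = Src D f'" "Tgt D g = Src D g'" "Tgt D h = Src D h'"
    using triangle_morE(1-3) [OF m(1) [unfolded T]] triangle_morE(1-3) [OF m'(1) [unfolded T]]
    by (auto simp: hom_iff)
  ultimately show ?thesis
    unfolding triangle_iso_def using m m' iso_arr_comp by blast
qed

lemma triangle_iso_refl:
  assumes "triangle D So T"
  shows "triangle_iso D Sa T T"
proof -
  obtain u v w where T: "T = (u, v, w)" by (metis prod_cases3)
  note t = assms [unfolded T triangle_iff]
  show ?thesis unfolding triangle_iso_def T
    by (rule exI [of _ "Ident D (Src D u)"], rule exI [of _ "Ident D (Src D v)"],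
        rule exI [of _ "Ident D (Src D w)"], intro conjI triangle_morI)
      (use t in \<open>auto intro: homI\<close>)
qed

lemma Dist_triangle: "T \<in> Dist \<Longrightarrow> triangle D So T"
  by (simp add: Dist_def)

lemma Std_Dist: "T \<in> Std \<Longrightarrow> T \<in> Dist"
  using triangle_iso_refl std_triangle unfolding Dist_def by blast

lemma Dist_iso:
  assumes "T \<in> Dist" "triangle D So T'" "triangle_iso D Sa T T'"
  shows "T' \<in> Dist"
  using assms triangle_iso_trans std_triangle unfolding Dist_def by blast

lemma DistE:
  assumes "T \<in> Dist"
  obtains u v w f g h where "(u, v, w) \<in> Std" "triangle_mor D Sa (u, v, w) T f g h"
    "iso_arr D f" "iso_arr D g" "iso_arr D h" "triangle D So (u, v, w)"
proof -
  obtain T' f g h where T': "T' \<in> Std" "triangle_mor D Sa T' T f g h"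
    "iso_arr D f" "iso_arr D g" "iso_arr D h"
    using assms unfolding Dist_def triangle_iso_def by blast
  obtain u v w where "T' = (u, v, w)" by (metis prod_cases3)
  then show thesis using that T' std_triangle by metis
qed

lemma Dist_rotate:
  assumes "(u, v, w) \<in> Dist"
  shows "(v, w, neg D (Sa u)) \<in> Dist"
proof -
  obtain u' v' w' f g h where std: "(u', v', w') \<in> Std"
    and m: "triangle_mor D Sa (u', v', w') (u, v, w) f g h"
    and iso: "iso_arr D f" "iso_arr D g" "iso_arr D h"
    using DistE [OF assms] by metis
  note t = Dist_triangle [OF assms, unfolded triangle_iff]
  note t' = std_triangle [OF std, unfolded triangle_iff]
  note e = triangle_morE [OF m]
  note [simp] = e(1-3) [unfolded hom_iff]
  have "(v', w', neg D (Sa u')) \<in> Dist"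
    using std_rotate [OF std] t' by (auto simp: Dist_def triangle_iff)
  moreover have "triangle_mor D Sa (v', w', neg D (Sa u')) (v, w, neg D (Sa u)) g h (Sa f)"
  proof -
    have "Sa (g \<cdot> u') = Sa (u \<cdot> f)" by (simp only: e(4))
    then have "Sa g \<cdot> Sa u' = Sa u \<cdot> Sa f" using t t' by simp
    then show ?thesis using t t' e by (intro triangle_morI) (auto intro: homI)
  qed
  moreover have "iso_arr D (Sa f)"
  proof -
    obtain f' where f': "f' \<in> Hom D (Src D u) (Src D u')" "f' \<cdot> f = Ident D (Src D u')"
      "f \<cdot> f' = Ident D (Src D u)" using iso_arrE [OF iso(1) e(1)] by metis
    note [simp] = homD [OF f'(1)]
    have "Sa (f' \<cdot> f) = Sa (Ident D (Src D u'))" "Sa (f \<cdot> f') = Sa (Ident D (Src D u))"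
      by (simp_all only: f')
    then show ?thesis
      using t t' by (intro iso_arrI [of "Sa f" _ _ "Sa f'"]) (auto intro: homI)
  qed
  ultimately have "triangle_iso D Sa (v', w', neg D (Sa u')) (v, w, neg D (Sa u))"
    using iso unfolding triangle_iso_def by blast
  moreover have "triangle D So (v, w, neg D (Sa u))" using t by (simp add: triangle_iff)
  ultimately show ?thesis
    using Dist_iso \<open>(v', w', neg D (Sa u')) \<in> Dist\<close> by blast
qed

lemma Dist_factor:
  assumes "(u, v, w) \<in> Dist" "x \<in> Arr D" "Src D x = Tgt D u" "x \<cdot> u = Zero D (Src D u) (Tgt D x)"
  shows "\<exists>y \<in> Hom D (Tgt D v) (Tgt D x). x = y \<cdot> v"
proof -
  obtain u' v' w' f g h where std: "(u', v', w') \<in> Std"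
    and m: "triangle_mor D Sa (u', v', w') (u, v, w) f g h"
    and iso: "iso_arr D f" "iso_arr D g" "iso_arr D h"
    using DistE [OF assms(1)] by metis
  note t = Dist_triangle [OF assms(1), unfolded triangle_iff]
  note t' = std_triangle [OF std, unfolded triangle_iff]
  obtain f' g' h' where m': "triangle_mor D Sa (u, v, w) (u', v', w') f' g' h'"
    and i: "g \<cdot> g' = Ident D (Src D v)"
    using triangle_mor_inverse [OF _ _ m iso] Dist_triangle [OF assms(1)] std_triangle [OF std] by metis
  note e = triangle_morE [OF m] and e' = triangle_morE [OF m']
  note [simp] = e(1-3) [unfolded hom_iff]
    e'(1-3) [unfolded hom_iff]
  have "(x \<cdot> g) \<cdot> u' = Zero D (Src D u') (Tgt D x)"
    using t t' assms e(4) comp_reassoc [OF assms(4), of f] by simp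
  then obtain y where y: "y \<in> Hom D (Tgt D v') (Tgt D x)" "x \<cdot> g = y \<cdot> v'"
    using std_factor [OF std, of "x \<cdot> g"] t t' assms by auto
  note [simp] = homD [OF y(1)]
  have "x = x \<cdot> g \<cdot> g'" using i assms t by simp
  also have "\<dots> = y \<cdot> v' \<cdot> g'" using comp_reassoc2 [OF y(2), of g'] t t' assms by simp
  also have "\<dots> = (y \<cdot> h') \<cdot> v" using t t' e'(5) by simp
  finally have "x = (y \<cdot> h') \<cdot> v" .
  moreover have "y \<cdot> h' \<in> Hom D (Tgt D v) (Tgt D x)" using t t' by (auto intro: homI)
  ultimately show ?thesis by blast
qed

lemma Dist_mor:
  assumes d: "(u, v, w) \<in> Dist" "(u', v', w') \<in> Dist"
    and fg: "f \<in> Hom D (Src D u) (Src D u')" "g \<in> Hom D (Tgt D u) (Tgt D u')" "g \<cdot> u = u' \<cdot> f"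
  shows "\<exists>h. triangle_mor D Sa (u, v, w) (u', v', w') f g h"
proof -
  obtain u1 v1 w1 f1 g1 h1 where std1: "(u1, v1, w1) \<in> Std"
    and m1: "triangle_mor D Sa (u1, v1, w1) (u, v, w) f1 g1 h1"
    and iso1: "iso_arr D f1" "iso_arr D g1" "iso_arr D h1"
    using DistE [OF d(1)] by metis
  obtain u2 v2 w2 f2 g2 h2 where std2: "(u2, v2, w2) \<in> Std"
    and m2: "triangle_mor D Sa (u2, v2, w2) (u', v', w') f2 g2 h2"
    and iso2: "iso_arr D f2" "iso_arr D g2" "iso_arr D h2"
    using DistE [OF d(2)] by metis
  note T = Dist_triangle [OF d(1)] Dist_triangle [OF d(2)] std_triangle [OF std1] std_triangle [OF std2]
  note t = T [unfolded triangle_iff]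
  obtain f1' g1' h1' where m1': "triangle_mor D Sa (u, v, w) (u1, v1, w1) f1' g1' h1'"
    and i1: "f1 \<cdot> f1' = Ident D (Src D u)" "g1 \<cdot> g1' = Ident D (Src D v)"
    using triangle_mor_inverse [OF T(3) T(1) m1 iso1] by metis
  obtain f2' g2' h2' where m2': "triangle_mor D Sa (u', v', w') (u2, v2, w2) f2' g2' h2'"
    and i2: "f2 \<cdot> f2' = Ident D (Src D u')" "g2 \<cdot> g2' = Ident D (Src D v')"
    using triangle_mor_inverse [OF T(4) T(2) m2 iso2] by metis
  note e = triangle_morE [OF m1] triangle_morE [OF m2] triangle_morE [OF m1'] triangle_morE [OF m2']
  note [simp] = e(1-3,7-9,13-15,19-21) [unfolded hom_iff] fg(1,2) [unfolded hom_iff]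
  have 1: "(g \<cdot> g1) \<cdot> u1 = u' \<cdot> f \<cdot> f1"
    by (rule square_comp [OF e(4) fg(3)]) (use t in \<open>auto intro: homI\<close>)
  have "(g2' \<cdot> g \<cdot> g1) \<cdot> u1 = u2 \<cdot> f2' \<cdot> f \<cdot> f1"
    by (rule square_comp [OF 1 e(22)]) (use t in \<open>auto intro: homI\<close>)
  then have "\<exists>h. triangle_mor D Sa (u1, v1, w1) (u2, v2, w2) (f2' \<cdot> f \<cdot> f1) (g2' \<cdot> g \<cdot> g1) h"
    using t by (intro std_mor [OF std1 std2]) (auto intro: homI)
  then obtain h where "triangle_mor D Sa (u1, v1, w1) (u2, v2, w2) (f2' \<cdot> f \<cdot> f1) (g2' \<cdot> g \<cdot> g1) h" ..
  from triangle_mor_comp [OF T(3,4,2) this m2]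
  have "triangle_mor D Sa (u, v, w) (u', v', w') ((f2 \<cdot> f2' \<cdot> f \<cdot> f1) \<cdot> f1') ((g2 \<cdot> g2' \<cdot> g \<cdot> g1) \<cdot> g1') ((h2 \<cdot> h) \<cdot> h1')"
    by (rule triangle_mor_comp [OF T(1,3,2) m1'])
  moreover have "(f2 \<cdot> f2' \<cdot> f \<cdot> f1) \<cdot> f1' = f"
    using i1 comp_reassoc [OF i2(1), of f] t by simp
  moreover have "(g2 \<cdot> g2' \<cdot> g \<cdot> g1) \<cdot> g1' = g"
    using i1 comp_reassoc [OF i2(2), of g] t by simp
  ultimately show ?thesis by auto
qed

text \<open>An endomorphism \<open>h\<close> of the cone over two identities satisfies \<open>(h - 1) \<cdot> v = 0\<close> and
  \<open>w \<cdot> (h - 1) = 0\<close>; the first equation makes \<open>h - 1\<close> factor through \<open>w\<close>, and then the second gives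
  \<open>(h - 1)\<^sup>2 = 0\<close>.\<close>

lemma cone_endo_iso:
  assumes d: "(u, v, w) \<in> Dist"
    and m: "triangle_mor D Sa (u, v, w) (u, v, w) (Ident D (Src D u)) (Ident D (Src D v)) h"
  shows "iso_arr D h"
proof -
  note t = Dist_triangle [OF d, unfolded triangle_iff]
  note e = triangle_morE [OF m]
  let ?Z = "Src D w"
  note [simp] = homD [OF e(3)]
  define n where "n = h \<oplus> neg D (Ident D ?Z)"
  have [simp]: "n \<in> Arr D" "Src D n = ?Z" "Tgt D n = ?Z" using t by (auto simp: n_def)
  have h: "h = Ident D ?Z \<oplus> n"
    using t by (subst eq_add_iff) (auto simp: n_def)
  have "h \<cdot> v = v" using e(5) t by simp
  then have nv: "n \<cdot> v = Zero D (Src D v) (Tgt D n)" using t by (simp add: n_def)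
  have "w \<cdot> h = w" using e(6) t by simp
  then have wn: "w \<cdot> n = Zero D ?Z (Tgt D w)" using t by (simp add: n_def)
  obtain k where k: "k \<in> Hom D (Tgt D w) ?Z" "n = k \<cdot> w"
    using Dist_factor [OF Dist_rotate [OF d], of n] nv t by auto
  note [simp] = homD [OF k(1)]
  have nn: "n \<cdot> n = Zero D ?Z ?Z"
  proof -
    have "n \<cdot> n = k \<cdot> w \<cdot> n" using t comp_assoc_arr [of n w k] by (simp flip: k(2))
    then show ?thesis using wn t by simp
  qed
  show ?thesis
    by (rule iso_arrI [of h ?Z ?Z "Ident D ?Z \<oplus> neg D n"])
      (use t nn in \<open>auto intro: homI simp: h add_ac\<close>)
qed

text \<open>Given inverses of \<open>f\<close> and \<open>g\<close>, fill in a map \<open>h'\<close> of cones in the other direction. Both composites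
  are maps of cones over identities, hence isomorphisms.\<close>

lemma cone_mor_iso:
  assumes d: "(u, v, w) \<in> Dist" "(u', v', w') \<in> Dist"
    and m: "triangle_mor D Sa (u, v, w) (u', v', w') f g h" and iso: "iso_arr D f" "iso_arr D g"
  shows "iso_arr D h"
proof -
  note T = Dist_triangle [OF d(1)] Dist_triangle [OF d(2)]
  note t = T [unfolded triangle_iff]
  note e = triangle_morE [OF m]
  obtain f' where f': "f' \<in> Hom D (Src D u') (Src D u)" "f' \<cdot> f = Ident D (Src D u)"
    "f \<cdot> f' = Ident D (Src D u')"
    using iso_arrE [OF iso(1) e(1)] by metis
  obtain g' where g': "g' \<in> Hom D (Src D v') (Src D v)" "g' \<cdot> g = Ident D (Src D v)"
    "g \<cdot> g' = Ident D (Src D v')"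
    using iso_arrE [OF iso(2) e(2)] by metis
  note [simp] = homD [OF f'(1)] homD [OF g'(1)] e(1-3) [unfolded hom_iff]
  have "g' \<cdot> u' = u \<cdot> f'"
    by (rule square_inverse [OF e(4) _ _ e(1) _ f'(1) _ f'(3)]) (use t e g' in \<open>auto intro: homI\<close>)
  then obtain h' where m': "triangle_mor D Sa (u', v', w') (u, v, w) f' g' h'"
    using Dist_mor [OF d(2,1), of f' g'] f' g' t by auto
  note [simp] = homD [OF triangle_morE(3) [OF m']]
  have "iso_arr D (h' \<cdot> h)"
    using cone_endo_iso [OF d(1)] triangle_mor_comp [OF T(1,2,1) m m'] f' g' by simp
  then obtain x where x: "x \<in> Hom D (Src D w) (Src D w)" "x \<cdot> h' \<cdot> h = Ident D (Src D w)"
    by (rule iso_arrE [of _ "Src D w" "Src D w"]) (use t in \<open>auto intro: homI\<close>)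
  have "iso_arr D (h \<cdot> h')"
    using cone_endo_iso [OF d(2)] triangle_mor_comp [OF T(2,1,2) m' m] f' g' by simp
  then obtain y where y: "y \<in> Hom D (Src D w') (Src D w')" "(h \<cdot> h') \<cdot> y = Ident D (Src D w')"
    by (rule iso_arrE [of _ "Src D w'" "Src D w'"]) (use t in \<open>auto intro: homI\<close>)
  note [simp] = homD [OF x(1)] homD [OF y(1)]
  have hy: "h \<cdot> h' \<cdot> y = Ident D (Src D w')" using y t by simp
  \<comment> \<open>A left and a right inverse of \<open>h\<close> coincide.\<close>
  have "x \<cdot> h' = x \<cdot> h' \<cdot> h \<cdot> h' \<cdot> y" using t by (simp add: hy)
  also have "\<dots> = h' \<cdot> y" using t comp_reassoc [OF x(2), of "h' \<cdot> y"] by simp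
  finally have "x \<cdot> h' = h' \<cdot> y" .
  moreover have "(x \<cdot> h') \<cdot> h = Ident D (Src D w)" using x(2) t by simp
  ultimately have "(h' \<cdot> y) \<cdot> h = Ident D (Src D w)" by metis
  then show ?thesis
    by (rule iso_arrI [of h "Src D w" "Src D w'", rotated 2]) (use hy t in \<open>auto intro: homI\<close>)
qed

lemma Dist_cone_unique:
  assumes d: "(u, v, w) \<in> Dist" "(u, v', w') \<in> Dist"
  obtains h h' where "h \<in> Hom D (Src D w) (Src D w')" "h' \<in> Hom D (Src D w') (Src D w)"
    "h' \<cdot> h = Ident D (Src D w)" "h \<cdot> h' = Ident D (Src D w')"
    "h \<cdot> v = v'" "w' \<cdot> h = w" "h' \<cdot> v' = v" "w \<cdot> h' = w'" "iso_arr D h" "iso_arr D h'"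
proof -
  note T = Dist_triangle [OF d(1)] Dist_triangle [OF d(2)]
  note t = T [unfolded triangle_iff]
  obtain h where m: "triangle_mor D Sa (u, v, w) (u, v', w') (Ident D (Src D u)) (Ident D (Tgt D u)) h"
    using Dist_mor [OF d, of "Ident D (Src D u)" "Ident D (Tgt D u)"] t by (auto simp: hom_iff)
  note e = triangle_morE [OF m]
  have "iso_arr D h" by (rule cone_mor_iso [OF d m]) (use t in auto)
  moreover obtain h' where h': "h' \<in> Hom D (Src D w') (Src D w)" "h' \<cdot> h = Ident D (Src D w)"
    "h \<cdot> h' = Ident D (Src D w')" "iso_arr D h'"
    using iso_arrE [OF \<open>iso_arr D h\<close> e(3)] by metis
  note [simp] = homD [OF h'(1)] homD [OF e(3)]
  moreover have hv: "h \<cdot> v = v'" and wh: "w' \<cdot> h = w" using e(5) e(6) [symmetric] t by auto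
  moreover have "h' \<cdot> v' = v" using comp_reassoc [OF h'(2), of v] hv t by simp
  moreover have "w \<cdot> h' = w'" using comp_reassoc [OF wh, of h', symmetric] h'(3) t by simp
  ultimately show thesis using that e(3) h' by blast
qed

subsection \<open>Verdier's axioms\<close>

text \<open>Compare \<open>(u, v, w)\<close> with a standard triangle on \<open>u\<close>. After rotating the given triangle twice and the
  standard one three times, both start with \<open>- S u\<close>, so that their cones \<open>S Z\<close> and \<open>S Z\<^sub>0\<close> are isomorphic; the
  isomorphism and its compatibilities come from \<open>Z \<rightarrow> Z\<^sub>0\<close> because the suspension is fully faithful.\<close>

lemma Dist_rotate_back:
  assumes tri: "triangle D So (u, v, w)" and d: "(v, w, neg D (Sa u)) \<in> Dist"
  shows "(u, v, w) \<in> Dist"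
proof -
  note t = tri [unfolded triangle_iff]
  obtain v0 w0 where std: "(u, v0, w0) \<in> Std" using std_ex t by blast
  note d0 = Std_Dist [OF std]
  note t0 = Dist_triangle [OF d0, unfolded triangle_iff]
  have 1: "(neg D (Sa u), neg D (Sa v), neg D (Sa w)) \<in> Dist"
    using Dist_rotate [OF Dist_rotate [OF d]] .
  have 2: "(neg D (Sa u), neg D (Sa v0), neg D (Sa w0)) \<in> Dist"
    using Dist_rotate [OF Dist_rotate [OF Dist_rotate [OF d0]]] .
  obtain h where h: "h \<in> Hom D (So (Src D w)) (So (Src D w0))"
    "h \<cdot> neg D (Sa v) = neg D (Sa v0)" "neg D (Sa w0) \<cdot> h = neg D (Sa w)" "iso_arr D h"
    using Dist_cone_unique [OF 1 2] t t0 by auto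
  obtain k where k: "k \<in> Hom D (Src D w) (Src D w0)" "Sa k = h"
    using S_full [OF _ _ h(1)] t t0 by auto
  note [simp] = homD [OF h(1)] homD [OF k(1)]
  have "Sa (neg D (k \<cdot> v)) = Sa (neg D v0)" using h(2) k(2) t t0 by simp
  then have "neg D (k \<cdot> v) = neg D v0"
    by (rule S_faithful [rotated -1]) (use t t0 in \<open>auto simp: hom_iff\<close>)
  then have kv: "k \<cdot> v = v0"
    by (rule neg_inject [THEN iffD1, rotated -1]) (use t t0 in simp_all)
  have "Sa (neg D (w0 \<cdot> k)) = Sa (neg D w)" using h(3) k(2) t t0 by simp
  then have "neg D (w0 \<cdot> k) = neg D w"
    by (rule S_faithful [rotated -1]) (use t t0 in \<open>auto simp: hom_iff\<close>)
  then have wk: "w0 \<cdot> k = w"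
    by (rule neg_inject [THEN iffD1, rotated -1]) (use t t0 in simp_all)
  have "triangle_mor D Sa (u, v, w) (u, v0, w0) (Ident D (Src D u)) (Ident D (Src D v)) k"
    using t t0 kv wk by (intro triangle_morI) (auto simp: hom_iff)
  then have "triangle_iso D Sa (u, v, w) (u, v0, w0)"
    using S_reflects_iso [of k] h(4) k(2) t unfolding triangle_iso_def by fastforce
  then show ?thesis
    using Dist_iso [OF d0 tri] triangle_iso_sym tri Dist_triangle [OF d0] by blast
qed

text \<open>The cone \<open>?C\<close> of an identity is a zero object, hence isomorphic to any other.\<close>

lemma Dist_ident:
  assumes X: "X \<in> Obj D" and Z: "zero_object D Z"
  shows "(Ident D X, Zero D X Z, Zero D Z (So X)) \<in> Dist"
proof -
  obtain v w where std: "(Ident D X, v, w) \<in> Std"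
    and c0: "Ident D (Tgt D v) = Zero D (Tgt D v) (Tgt D v)" using std_ident [OF X] by blast
  note d = Std_Dist [OF std]
  note t = Dist_triangle [OF d, unfolded triangle_iff]
  let ?C = "Src D w"
  have ZO: "Z \<in> Obj D" using Z by (simp add: zero_object_def)
  have C0: "Ident D ?C = Zero D ?C ?C" using c0 t by simp
  have "v = Ident D ?C \<cdot> v" using t by simp
  also have "\<dots> = Zero D X ?C" unfolding C0 using t X by simp
  finally have v: "v = Zero D X ?C" .
  have "w = w \<cdot> Ident D ?C" using t by simp
  also have "\<dots> = Zero D ?C (So X)" unfolding C0 using t X by simp
  finally have w: "w = Zero D ?C (So X)" .
  have Z0: "Ident D Z = Zero D Z Z"
    using zero_object_eq [OF Z, of "Ident D Z" Z "Zero D Z Z"] ZO by (auto simp: hom_iff)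
  have "iso_arr D (Zero D ?C Z)"
    by (rule iso_arrI [of _ ?C Z "Zero D Z ?C"]) (use C0 Z0 ZO t in \<open>auto simp: hom_iff\<close>)
  moreover have "triangle_mor D Sa (Ident D X, v, w) (Ident D X, Zero D X Z, Zero D Z (So X))
      (Ident D X) (Ident D X) (Zero D ?C Z)"
    by (rule triangle_morI) (use X ZO t w [symmetric] in \<open>auto simp: hom_iff v\<close>)
  ultimately have "triangle_iso D Sa (Ident D X, v, w) (Ident D X, Zero D X Z, Zero D Z (So X))"
    using X unfolding triangle_iso_def by (metis iso_arr_ident)
  then show ?thesis
    using Dist_iso [OF d] X ZO by (simp add: triangle_iff)
qed

text \<open>Transport the octahedron on standard triangles along the isomorphisms of cones.\<close>

lemma Dist_octahedron:
  assumes d: "(u, i, i') \<in> Dist" "(v, j, j') \<in> Dist" "(v \<cdot> u, k, k') \<in> Dist"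
    and uv: "Tgt D u = Src D v"
  shows "\<exists>f g. triangle_mor D Sa (u, i, i') (v \<cdot> u, k, k') (Ident D (Src D u)) v f \<and>
               triangle_mor D Sa (v \<cdot> u, k, k') (v, j, j') u (Ident D (Tgt D v)) g \<and>
               (f, g, Sa i \<cdot> j') \<in> Dist"
proof -
  note T = d [THEN Dist_triangle]
  note t = T [unfolded triangle_iff]
  obtain i0 i0' j0 j0' k0 k0' f0 g0 where
    std: "(u, i0, i0') \<in> Std" "(v, j0, j0') \<in> Std" "(v \<cdot> u, k0, k0') \<in> Std"
    and m1: "triangle_mor D Sa (u, i0, i0') (v \<cdot> u, k0, k0') (Ident D (Src D u)) v f0"
    and m2: "triangle_mor D Sa (v \<cdot> u, k0, k0') (v, j0, j0') u (Ident D (Tgt D v)) g0"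
    and o: "\<exists>T \<in> Std. triangle_iso D Sa T (f0, g0, Sa i0 \<cdot> j0')"
    using std_octahedron [of u v] t uv by blast
  note d0 = std [THEN Std_Dist]
  note T0 = d0 [THEN Dist_triangle]
  note t0 = T0 [unfolded triangle_iff]
  obtain p p' where p: "p \<in> Hom D (Src D i') (Src D i0')" "p' \<in> Hom D (Src D i0') (Src D i')"
    "p' \<cdot> p = Ident D (Src D i')" "p \<cdot> i = i0" "i0' \<cdot> p = i'" "iso_arr D p'"
    using Dist_cone_unique [OF d(1) d0(1)] by metis
  obtain q q' where q: "q \<in> Hom D (Src D j') (Src D j0')" "q' \<in> Hom D (Src D j0') (Src D j')"
    "q' \<cdot> q = Ident D (Src D j')" "q \<cdot> q' = Ident D (Src D j0')" "q' \<cdot> j0 = j"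
    "j' \<cdot> q' = j0'" "iso_arr D q'"
    using Dist_cone_unique [OF d(2) d0(2)] by metis
  obtain r r' where r: "r \<in> Hom D (Src D k') (Src D k0')" "r' \<in> Hom D (Src D k0') (Src D k')"
    "r' \<cdot> r = Ident D (Src D k')" "r \<cdot> r' = Ident D (Src D k0')" "r \<cdot> k = k0" "r' \<cdot> k0 = k"
    "k0' \<cdot> r = k'" "k' \<cdot> r' = k0'" "iso_arr D r'"
    using Dist_cone_unique [OF d(3) d0(3)] by metis
  note e1 = triangle_morE [OF m1] and e2 = triangle_morE [OF m2]
  have H: "f0 \<in> Hom D (Src D i0') (Src D k0')" "g0 \<in> Hom D (Src D k0') (Src D j0')"
    using e1(3) e2(3) .
  note [simp] = p(1,2) [unfolded hom_iff]
    q(1,2) [unfolded hom_iff]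
    r(1,2) [unfolded hom_iff]
    H [unfolded hom_iff]
  define f where "f = r' \<cdot> f0 \<cdot> p"
  define g where "g = q' \<cdot> g0 \<cdot> r"
  have pi: "p \<cdot> i = i0" and qj: "q' \<cdot> j0 = j" by (fact p(4)) (fact q(5))
  have f0i0: "f0 \<cdot> i0 = k0 \<cdot> v" using e1(5) .
  have k0f0: "k0' \<cdot> f0 = i0'" using e1(6) [symmetric] t t0 uv by simp
  have g0k0: "g0 \<cdot> k0 = j0" using e2(5) t t0 uv by simp
  have j0g0: "j0' \<cdot> g0 = Sa u \<cdot> k0'" using e2(6) [symmetric] by simp
  have fm: "triangle_mor D Sa (u, i, i') (v \<cdot> u, k, k') (Ident D (Src D u)) v f"
  proof (rule triangle_morI)
    show "f \<cdot> i = k \<cdot> v"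
      using t t0 uv pi f0i0 comp_reassoc [OF r(6), of v] by (simp add: f_def)
    show "Sa (Ident D (Src D u)) \<cdot> i' = k' \<cdot> f"
      using t t0 uv comp_reassoc [OF r(8), of "f0 \<cdot> p"] comp_reassoc [OF k0f0, of p] p(5)
      by (simp add: f_def)
  qed (use t t0 uv in \<open>auto simp: f_def hom_iff\<close>)
  have gm: "triangle_mor D Sa (v \<cdot> u, k, k') (v, j, j') u (Ident D (Tgt D v)) g"
  proof (rule triangle_morI)
    show "g \<cdot> k = j \<cdot> Ident D (Tgt D v)"
      using t t0 uv r(5) g0k0 qj by (simp add: g_def)
    show "Sa u \<cdot> k' = j' \<cdot> g"
      using t t0 uv comp_reassoc [OF q(6), of "g0 \<cdot> r"] comp_reassoc2 [OF j0g0, of r] r(7)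
      by (simp add: g_def)
  qed (use t t0 uv in \<open>auto simp: g_def hom_iff\<close>)
  have tri: "triangle D So (f0, g0, Sa i0 \<cdot> j0')"
    using t t0 uv by (auto simp: triangle_iff)
  have "(f0, g0, Sa i0 \<cdot> j0') \<in> Dist"
    using o tri by (auto simp: Dist_def)
  moreover have "triangle_iso D Sa (f0, g0, Sa i0 \<cdot> j0') (f, g, Sa i \<cdot> j')"
    unfolding triangle_iso_def
  proof (intro exI conjI)
    show "triangle_mor D Sa (f0, g0, Sa i0 \<cdot> j0') (f, g, Sa i \<cdot> j') p' r' q'"
    proof (rule triangle_morI)
      have pp: "p \<cdot> p' = Ident D (Src D i0')"
      proof -
        obtain x where "x \<in> Hom D (Src D i') (Src D i0')" "p' \<cdot> x = Ident D (Src D i')"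
          "x \<cdot> p' = Ident D (Src D i0')"
          using iso_arrE [OF p(6) p(2)] by metis
        moreover from this have "x = p"
          using comp_reassoc [OF \<open>x \<cdot> p' = _\<close>, of p] p(3) t t0 by (simp add: hom_iff)
        ultimately show ?thesis by simp
      qed
      show "r' \<cdot> f0 = f \<cdot> p'" using t t0 by (simp add: f_def pp)
      show "q' \<cdot> g0 = g \<cdot> r'" using t t0 by (simp add: g_def r(4))
      have "Sa p' \<cdot> Sa i0 = Sa i"
      proof -
        have "p' \<cdot> i0 = i" using pi comp_reassoc [OF p(3), of i] t t0 by simp
        then have "Sa (p' \<cdot> i0) = Sa i" by simp
        then show ?thesis using t t0 by simp
      qed
      then show "Sa p' \<cdot> Sa i0 \<cdot> j0' = (Sa i \<cdot> j') \<cdot> q'"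
        using t t0 uv q(6) comp_reassoc [of "Sa p'" "Sa i0" "Sa i" j0'] by simp
    qed (use t t0 uv in \<open>auto simp: f_def g_def hom_iff\<close>)
  qed (fact p(6) r(9) q(7))+
  moreover have "triangle D So (f, g, Sa i \<cdot> j')"
    using t t0 uv by (auto simp: triangle_iff f_def g_def)
  ultimately have "(f, g, Sa i \<cdot> j') \<in> Dist" using Dist_iso by blast
  then show ?thesis using fm gm by blast
qed

text \<open>A fully faithful and dense functor has a quasi-inverse: choose for every \<open>X\<close> an isomorphism
  \<open>t X\<close> from the suspension of some \<open>G X\<close> to \<open>X\<close>, and transport arrows along these.\<close>

lemma S_autoequivalence: "autoequivalence D So Sa"
proof -
  have "\<exists>r. \<forall>X \<in> Obj D. fst (r X) \<in> Obj D \<and> snd (r X) \<in> Hom D (So (fst (r X))) X \<and> iso_arr D (snd (r X))"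
    using S_dense by (intro bchoice ballI) (metis fst_conv snd_conv)
  then obtain r where r: "\<And>X. X \<in> Obj D \<Longrightarrow>
      fst (r X) \<in> Obj D \<and> snd (r X) \<in> Hom D (So (fst (r X))) X \<and> iso_arr D (snd (r X))" by blast
  define Go where "Go X = fst (r X)" for X
  define t where "t X = snd (r X)" for X
  have G [simp]: "Go X \<in> Obj D" and tH: "t X \<in> Hom D (So (Go X)) X" and t_iso: "iso_arr D (t X)"
    if "X \<in> Obj D" for X using r [OF that] by (auto simp: Go_def t_def)
  have t_typing [simp]: "t X \<in> Arr D" "Src D (t X) = So (Go X)" "Tgt D (t X) = X"
    if "X \<in> Obj D" for X using homD [OF tH [OF that]] by auto
  have t_cancel: "f = g" if "X \<in> Obj D" "f \<in> Hom D W (So (Go X))" "g \<in> Hom D W (So (Go X))"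
    "t X \<cdot> f = t X \<cdot> g" for f g W X
  proof -
    note X = that(1)
    obtain t' where t': "t' \<in> Hom D X (So (Go X))" "t' \<cdot> t X = Ident D (So (Go X))"
      using iso_arrE [OF t_iso [OF X] tH [OF X]] by blast
    have "t' \<cdot> t X \<cdot> f = f" "t' \<cdot> t X \<cdot> g = g"
      using X homD [OF t'(1)] that(2-3) [unfolded hom_iff]
      by (simp_all add: comp_reassoc [OF t'(2)])
    then show ?thesis using that(4) by metis
  qed
  have ex: "\<exists>g. g \<in> Hom D (Go (Src D f)) (Go (Tgt D f)) \<and> t (Tgt D f) \<cdot> Sa g = f \<cdot> t (Src D f)"
    if f: "f \<in> Arr D" for f
  proof -
    obtain t' where t': "t' \<in> Hom D (Tgt D f) (So (Go (Tgt D f)))"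
      "t (Tgt D f) \<cdot> t' = Ident D (Tgt D f)"
      using iso_arrE [OF t_iso tH] src_tgt_obj(2) [OF f] by blast
    note [simp] = homD [OF t'(1)] f
    have "t' \<cdot> f \<cdot> t (Src D f) \<in> Hom D (So (Go (Src D f))) (So (Go (Tgt D f)))"
      by (auto intro: homI)
    then obtain g where "g \<in> Hom D (Go (Src D f)) (Go (Tgt D f))" "Sa g = t' \<cdot> f \<cdot> t (Src D f)"
      using S_full [of "Go (Src D f)" "Go (Tgt D f)"] f by auto
    then show ?thesis
      using comp_reassoc [OF t'(2), of "f \<cdot> t (Src D f)"] by auto
  qed
  define Ga where "Ga f = (SOME g. g \<in> Hom D (Go (Src D f)) (Go (Tgt D f)) \<and>
      t (Tgt D f) \<cdot> Sa g = f \<cdot> t (Src D f))" for f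
  have Ga: "Ga f \<in> Hom D (Go (Src D f)) (Go (Tgt D f))" "t (Tgt D f) \<cdot> Sa (Ga f) = f \<cdot> t (Src D f)"
    if "f \<in> Arr D" for f using someI_ex [OF ex [OF that]] by (auto simp: Ga_def)
  have Ga_typing [simp]: "Ga f \<in> Arr D" "Src D (Ga f) = Go (Src D f)" "Tgt D (Ga f) = Go (Tgt D f)"
    if "f \<in> Arr D" for f using homD [OF Ga(1) [OF that]] by auto
  have Ga_eq: "Ga f = g" if "f \<in> Arr D" "g \<in> Hom D (Go (Src D f)) (Go (Tgt D f))"
      "t (Tgt D f) \<cdot> Sa g = f \<cdot> t (Src D f)" for f g
  proof (rule S_faithful [OF Ga(1) that(2)])
    show "Sa (Ga f) = Sa g"
      by (rule t_cancel [of "Tgt D f" _ "So (Go (Src D f))"])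
        (use that Ga(2) homD [OF that(2)] in \<open>auto intro: homI\<close>)
  qed (fact that)
  have Ga_functor: "additive_functor D D Go Ga"
    unfolding additive_functor_def
  proof (intro conjI ballI impI)
    fix X assume "X \<in> Obj D"
    then show "Ga (Ident D X) = Ident D (Go X)" by (intro Ga_eq) (auto intro: homI)
  next
    fix f g assume f: "f \<in> Arr D" "g \<in> Arr D" and st: "Tgt D f = Src D g"
    have "t (Tgt D g) \<cdot> Sa (Ga g) \<cdot> Sa (Ga f) = g \<cdot> f \<cdot> t (Src D f)"
      using comp_reassoc2 [OF Ga(2) [OF f(2)], of "Sa (Ga f)"] Ga(2) [OF f(1)] f st by simp
    then show "Ga (g \<cdot> f) = Ga g \<cdot> Ga f"
      using f st by (intro Ga_eq) (auto intro: homI)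
  next
    fix f g assume f: "f \<in> Arr D" "g \<in> Arr D" and st: "Src D f = Src D g \<and> Tgt D f = Tgt D g"
    have "t (Tgt D g) \<cdot> Sa (Ga f) = f \<cdot> t (Src D g)" "t (Tgt D g) \<cdot> Sa (Ga g) = g \<cdot> t (Src D g)"
      using Ga(2) f st by metis+
    then show "Ga (f \<oplus> g) = Ga f \<oplus> Ga g"
      using f st by (intro Ga_eq) (auto intro: homI)
  qed (auto intro: homI)
  have "\<exists>s. s \<in> Hom D (Go (So X)) X \<and> Sa s = t (So X)" if "X \<in> Obj D" for X
    using S_full [of "Go (So X)" X "t (So X)"] that by (auto simp: tH)
  then obtain s where s: "\<And>X. X \<in> Obj D \<Longrightarrow> s X \<in> Hom D (Go (So X)) X \<and> Sa (s X) = t (So X)"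
    by metis
  have s_typing [simp]: "s X \<in> Arr D" "Src D (s X) = Go (So X)" "Tgt D (s X) = X" "Sa (s X) = t (So X)"
    if "X \<in> Obj D" for X using s [OF that] by (auto simp: hom_iff)
  have "naturally_isomorphic D D (Go \<circ> So) (Ga \<circ> Sa) id id"
    unfolding naturally_isomorphic_def
  proof (intro exI [of _ s] conjI ballI)
    fix X assume "X \<in> Obj D"
    then show "s X \<in> Hom D ((Go \<circ> So) X) (id X)" "iso_arr D (s X)"
      using S_reflects_iso [of "s X"] t_iso by (auto intro: homI)
  next
    fix f assume f [simp]: "f \<in> Arr D"
    show "s (Tgt D f) \<cdot> (Ga \<circ> Sa) f = id f \<cdot> s (Src D f)"
      by (rule S_faithful [of _ "Go (So (Src D f))" "Tgt D f"])
        (use Ga(2) [of "Sa f"] in \<open>auto intro: homI\<close>)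
  qed
  moreover have "naturally_isomorphic D D (So \<circ> Go) (Sa \<circ> Ga) id id"
    unfolding naturally_isomorphic_def
    by (intro exI [of _ t] conjI ballI) (auto simp: t_iso Ga(2) intro: homI)
  ultimately show ?thesis
    unfolding autoequivalence_def using S_functor Ga_functor by blast
qed

lemma triangulated: "triangulated_category D So Sa Dist"
proof (intro triangulated_category.intro triangulated_category_axioms.intro)
  show "additive_category D" ..
  show "autoequivalence D So Sa" by (rule S_autoequivalence)
  fix T assume T: "T \<in> Dist"
  then show "triangle D So T" by (rule Dist_triangle)
  fix T' assume "triangle D So T'" "triangle_iso D Sa T T'"
  with T show "T' \<in> Dist" by (rule Dist_iso)
next
  fix X Z assume "X \<in> Obj D" "zero_object D Z"
  then show "(Ident D X, Zero D X Z, Zero D Z (So X)) \<in> Dist" by (rule Dist_ident)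
next
  fix u assume "u \<in> Arr D"
  then show "\<exists>v w. (u, v, w) \<in> Dist" using std_ex Std_Dist by blast
next
  fix u v w assume "triangle D So (u, v, w)"
  then show "(u, v, w) \<in> Dist \<longleftrightarrow> (v, w, neg D (Sa u)) \<in> Dist"
    using Dist_rotate Dist_rotate_back by blast
qed (fact Dist_mor Dist_octahedron)+

end

section \<open>Standard triangles in the stable category\<close>

context category begin

lemma pushout_typing:
  assumes "is_pushout C f g f' g'"
  shows "f \<in> Arr C" "g \<in> Arr C" "f' \<in> Arr C" "g' \<in> Arr C"
    "Src C f = Src C g" "Src C f' = Tgt C f" "Src C g' = Tgt C g" "Tgt C f' = Tgt C g'"
    "f' \<cdot> f = g' \<cdot> g"
  using assms unfolding is_pushout_def by blast+

lemma pushout_map: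
  assumes "is_pushout C f g f' g'" "a \<in> Hom C (Tgt C f) W" "b \<in> Hom C (Tgt C g) W" "a \<cdot> f = b \<cdot> g"
  shows "\<exists>h \<in> Hom C (Tgt C f') W. h \<cdot> f' = a \<and> h \<cdot> g' = b"
proof -
  have "\<forall>a \<in> Arr C. \<forall>b \<in> Arr C.
        Src C a = Tgt C f \<and> Src C b = Tgt C g \<and> Tgt C a = Tgt C b \<and> a \<cdot> f = b \<cdot> g \<longrightarrow>
        (\<exists>!h. h \<in> Hom C (Tgt C f') (Tgt C a) \<and> h \<cdot> f' = a \<and> h \<cdot> g' = b)"
    using assms(1) unfolding is_pushout_def by blast
  then show ?thesis using assms(2-) by (metis homD(1,2,3))
qed

lemma pushout_eq:
  assumes p: "is_pushout C f g f' g'" and h: "h \<in> Hom C (Tgt C f') W" "k \<in> Hom C (Tgt C f') W"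
    and eq: "h \<cdot> f' = k \<cdot> f'" "h \<cdot> g' = k \<cdot> g'"
  shows "h = k"
proof -
  note t = pushout_typing [OF p] and [simp] = h(1-2) [unfolded hom_iff]
  have *: "\<exists>!h. h \<in> Hom C (Tgt C f') (Tgt C a) \<and> h \<cdot> f' = a \<and> h \<cdot> g' = b"
    if "a \<in> Arr C" "b \<in> Arr C" "Src C a = Tgt C f" "Src C b = Tgt C g" "Tgt C a = Tgt C b" "a \<cdot> f = b \<cdot> g"
    for a b
    using p that unfolding is_pushout_def by blast
  have "\<exists>!l. l \<in> Hom C (Tgt C f') (Tgt C (k \<cdot> f')) \<and> l \<cdot> f' = k \<cdot> f' \<and> l \<cdot> g' = k \<cdot> g'"
    by (rule *) (use t in auto)
  moreover have "Tgt C (k \<cdot> f') = W" using t by simp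
  ultimately show ?thesis using h eq by metis
qed

end

context frobenius_choice begin

lemma susp_lift_simps:
  assumes "susp_lift f h g" "f \<in> Hom B X Y"
  shows "h \<in> Arr B" "Src B h = I X" "Tgt B h = I Y" "g \<in> Arr B" "Src B g = S X" "Tgt B g = S Y"
    "h \<cdot> \<mu> X = \<mu> Y \<cdot> f" "g \<cdot> \<pi> X = \<pi> Y \<cdot> h"
    "\<lbrakk>x \<in> Arr B; Tgt B x = X\<rbrakk> \<Longrightarrow> h \<cdot> \<mu> X \<cdot> x = \<mu> Y \<cdot> f \<cdot> x"
    "\<lbrakk>x \<in> Arr B; Tgt B x = I X\<rbrakk> \<Longrightarrow> g \<cdot> \<pi> X \<cdot> x = \<pi> Y \<cdot> h \<cdot> x"
proof -
  note [simp] = homD [OF assms(2)]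
  show *: "h \<in> Arr B" "Src B h = I X" "Tgt B h = I Y" "g \<in> Arr B" "Src B g = S X" "Tgt B g = S Y"
    "h \<cdot> \<mu> X = \<mu> Y \<cdot> f" "g \<cdot> \<pi> X = \<pi> Y \<cdot> h"
    using susp_liftD [OF assms(1)] by simp_all
  show "\<lbrakk>x \<in> Arr B; Tgt B x = X\<rbrakk> \<Longrightarrow> h \<cdot> \<mu> X \<cdot> x = \<mu> Y \<cdot> f \<cdot> x"
    "\<lbrakk>x \<in> Arr B; Tgt B x = I X\<rbrakk> \<Longrightarrow> g \<cdot> \<pi> X \<cdot> x = \<pi> Y \<cdot> h \<cdot> x"
    using * comp_reassoc2 [OF *(7), of x] comp_reassoc2 [OF *(8), of x] by simp_all
qed

text \<open>A standard triangle \<open>(u, v, w)\<close> at the level of \<open>B\<close>, with its three objects named and with the second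
  leg \<open>a : I X \<rightarrow> Z\<close> of the push-out square.\<close>

definition cone :: "'o \<Rightarrow> 'o \<Rightarrow> 'o \<Rightarrow> 'm \<Rightarrow> 'm \<Rightarrow> 'm \<Rightarrow> 'm \<Rightarrow> bool" where
  "cone X Y Z u a v w \<longleftrightarrow> u \<in> Hom B X Y \<and> v \<in> Hom B Y Z \<and> w \<in> Hom B Z (S X) \<and>
     is_pushout B (\<mu> X) u a v \<and> w \<cdot> a = \<pi> X \<and> w \<cdot> v = Zero B Y (S X)"

lemma cone_typing:
  assumes "cone X Y Z u a v w"
  shows "X \<in> Obj B" "Y \<in> Obj B" "Z \<in> Obj B"
    "u \<in> Arr B" "Src B u = X" "Tgt B u = Y" "v \<in> Arr B" "Src B v = Y" "Tgt B v = Z"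
    "a \<in> Arr B" "Src B a = I X" "Tgt B a = Z" "w \<in> Arr B" "Src B w = Z" "Tgt B w = S X"
    "a \<cdot> \<mu> X = v \<cdot> u" "w \<cdot> a = \<pi> X" "w \<cdot> v = Zero B Y (S X)"
proof -
  have p: "is_pushout B (\<mu> X) u a v" using assms by (simp add: cone_def)
  show "X \<in> Obj B" "Y \<in> Obj B" "Z \<in> Obj B"
    "u \<in> Arr B" "Src B u = X" "Tgt B u = Y" "v \<in> Arr B" "Src B v = Y" "Tgt B v = Z"
    "w \<in> Arr B" "Src B w = Z" "Tgt B w = S X" "w \<cdot> a = \<pi> X" "w \<cdot> v = Zero B Y (S X)"
    using assms by (simp_all add: cone_def hom_iff)
  then show "a \<in> Arr B" "Src B a = I X" "Tgt B a = Z" "a \<cdot> \<mu> X = v \<cdot> u"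
    using pushout_typing [OF p] by simp_all
qed

lemma cone_reassoc:
  assumes "cone X Y Z u a v w" "x \<in> Arr B"
  shows "Tgt B x = X \<Longrightarrow> a \<cdot> \<mu> X \<cdot> x = v \<cdot> u \<cdot> x"
    "Tgt B x = I X \<Longrightarrow> w \<cdot> a \<cdot> x = \<pi> X \<cdot> x"
    "Tgt B x = Y \<Longrightarrow> w \<cdot> v \<cdot> x = Zero B (Src B x) (S X)"
proof -
  note [simp] = cone_typing(1-15) [OF assms(1)] assms(2) and e = cone_typing(16-18) [OF assms(1)]
  show "Tgt B x = X \<Longrightarrow> a \<cdot> \<mu> X \<cdot> x = v \<cdot> u \<cdot> x"
    "Tgt B x = I X \<Longrightarrow> w \<cdot> a \<cdot> x = \<pi> X \<cdot> x"
    "Tgt B x = Y \<Longrightarrow> w \<cdot> v \<cdot> x = Zero B (Src B x) (S X)"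
    using comp_reassoc2 [OF e(1), of x] comp_reassoc [OF e(2), of x] comp_reassoc [OF e(3), of x]
    by simp_all
qed

lemmas coneD = cone_typing cone_reassoc

lemma cone_map:
  assumes "cone X Y Z u a v w" "b \<in> Hom B (I X) W" "c \<in> Hom B Y W" "b \<cdot> \<mu> X = c \<cdot> u"
  obtains h where "h \<in> Hom B Z W" "h \<cdot> a = b" "h \<cdot> v = c"
    "\<And>x. \<lbrakk>x \<in> Arr B; Tgt B x = I X\<rbrakk> \<Longrightarrow> h \<cdot> a \<cdot> x = b \<cdot> x"
    "\<And>x. \<lbrakk>x \<in> Arr B; Tgt B x = Y\<rbrakk> \<Longrightarrow> h \<cdot> v \<cdot> x = c \<cdot> x"
proof -
  note [simp] = coneD [OF assms(1)]
  have "is_pushout B (\<mu> X) u a v" using assms(1) by (simp add: cone_def)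
  from pushout_map [OF this, of b W c] assms(2-)
  obtain h where h: "h \<in> Hom B Z W" "h \<cdot> a = b" "h \<cdot> v = c" by auto
  show thesis
    by (rule that [OF h]) (use homD [OF h(1)] in \<open>simp_all add: comp_reassoc [OF h(2)] comp_reassoc [OF h(3)]\<close>)
qed

lemma cone_eq:
  assumes "cone X Y Z u a v w" "h \<in> Hom B Z W" "k \<in> Hom B Z W" "h \<cdot> a = k \<cdot> a" "h \<cdot> v = k \<cdot> v"
  shows "h = k"
proof -
  have "is_pushout B (\<mu> X) u a v" using assms(1) by (simp add: cone_def)
  from pushout_eq [OF this, of h W k] show ?thesis using assms coneD [OF assms(1)] by auto
qed

lemma cone_ex:
  assumes "u \<in> Hom B X Y"
  shows "\<exists>Z a v w. cone X Y Z u a v w"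
proof -
  note [simp] = homD [OF assms]
  have "adm_mono E (\<mu> X)" using conflation [of X] by (auto simp: adm_mono_def)
  then obtain a v where p: "is_pushout B (\<mu> X) u a v"
    using pushout_adm_mono [of "\<mu> X" u] by auto
  note t = pushout_typing [OF p]
  obtain w where "w \<in> Hom B (Tgt B a) (S X)" "w \<cdot> a = \<pi> X" "w \<cdot> v = Zero B Y (S X)"
    using pushout_map [OF p, of "\<pi> X" "S X" "Zero B Y (S X)"] by (auto simp: hom_iff)
  then have "cone X Y (Tgt B v) u a v w"
    using p t assms by (simp add: cone_def hom_iff)
  then show ?thesis by blast
qed

abbreviation "Std \<equiv> standard_triangles B E \<mu> \<pi>"

lemma Std_iff: "T \<in> Std \<longleftrightarrow> (\<exists>X Y Z u a v w. cone X Y Z u a v w \<and> T = (\<lbrakk>u\<rbrakk>, \<lbrakk>v\<rbrakk>, \<lbrakk>w\<rbrakk>))"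
proof
  assume "T \<in> Std"
  then obtain u v w a where T: "T = (\<lbrakk>u\<rbrakk>, \<lbrakk>v\<rbrakk>, \<lbrakk>w\<rbrakk>)" and p: "is_pushout B (\<mu> (Src B u)) u a v"
    and w: "w \<in> Hom B (Tgt B v) (S (Src B u))" "w \<cdot> a = \<pi> (Src B u)" "w \<cdot> v = Zero B (Tgt B u) (S (Src B u))"
    by (auto simp: standard_triangles_def)
  note t = pushout_typing [OF p]
  have "cone (Src B u) (Tgt B u) (Tgt B v) u a v w"
    unfolding cone_def using p w t by (auto intro: homI)
  then show "\<exists>X Y Z u a v w. cone X Y Z u a v w \<and> T = (\<lbrakk>u\<rbrakk>, \<lbrakk>v\<rbrakk>, \<lbrakk>w\<rbrakk>)" using T by blast
next
  assume "\<exists>X Y Z u a v w. cone X Y Z u a v w \<and> T = (\<lbrakk>u\<rbrakk>, \<lbrakk>v\<rbrakk>, \<lbrakk>w\<rbrakk>)"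
  then obtain X Y Z u a v w where c: "cone X Y Z u a v w" and T: "T = (\<lbrakk>u\<rbrakk>, \<lbrakk>v\<rbrakk>, \<lbrakk>w\<rbrakk>)" by blast
  have "is_pushout B (\<mu> (Src B u)) u a v \<and> w \<in> Hom B (Tgt B v) (S (Src B u)) \<and>
      w \<cdot> a = \<pi> (Src B u) \<and> w \<cdot> v = Zero B (Tgt B u) (S (Src B u))"
    using c coneD [OF c] by (simp add: cone_def)
  then show "T \<in> Std"
    unfolding standard_triangles_def T by blast
qed

lemma StdE:
  assumes "(U, V, W) \<in> Std"
  obtains X Y Z u a v w where "cone X Y Z u a v w" "U = \<lbrakk>u\<rbrakk>" "V = \<lbrakk>v\<rbrakk>" "W = \<lbrakk>w\<rbrakk>"
  using assms by (auto simp: Std_iff)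

lemma cls_triangle_mor:
  assumes "cone X Y Z u a v w" "cone X' Y' Z' u' a' v' w'"
    and "f \<in> Hom B X X'" "g \<in> Hom B Y Y'" "h \<in> Hom B Z Z'" "susp_lift f F s"
    and "\<lbrakk>g \<cdot> u\<rbrakk> = \<lbrakk>u' \<cdot> f\<rbrakk>" "\<lbrakk>h \<cdot> v\<rbrakk> = \<lbrakk>v' \<cdot> g\<rbrakk>" "\<lbrakk>s \<cdot> w\<rbrakk> = \<lbrakk>w' \<cdot> h\<rbrakk>"
  shows "triangle_mor D Sa (\<lbrakk>u\<rbrakk>, \<lbrakk>v\<rbrakk>, \<lbrakk>w\<rbrakk>) (\<lbrakk>u'\<rbrakk>, \<lbrakk>v'\<rbrakk>, \<lbrakk>w'\<rbrakk>) \<lbrakk>f\<rbrakk> \<lbrakk>g\<rbrakk> \<lbrakk>h\<rbrakk>"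
  using coneD [OF assms(1)] coneD [OF assms(2)] assms(3-5) [unfolded hom_iff]
    susp_lift_simps [OF assms(6,3)] assms(7-)
  by (simp add: triangle_mor_def susp_cls [OF assms(6)] D.hom_iff)

text \<open>The cone \<open>C\<close> of \<open>v\<close> is a push-out of \<open>I X\<close> and \<open>I Y\<close> along \<open>X\<close>, and collapsing \<open>I Y\<close> gives \<open>q : C \<rightarrow> S X\<close>.
  The map \<open>X \<rightarrow> I Y\<close> extends to \<open>h : I X \<rightarrow> I Y\<close>, so \<open>q\<close> has a section \<open>s\<close>, induced by the difference of \<open>I X \<rightarrow> C\<close>
  and \<open>h\<close> followed by \<open>I Y \<rightarrow> C\<close>; \<open>1 - s \<cdot> q\<close> factors through \<open>I Y\<close>. On \<open>s\<close> the third map of the cone of \<open>v\<close> is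
  \<open>- \<pi> \<cdot> h\<close>, which is where the sign of \<open>- S u\<close> comes from.\<close>

lemma std_rotate:
  assumes "(U, V, W) \<in> Std"
  shows "\<exists>T \<in> Std. triangle_iso D Sa T (V, W, neg D (Sa U))"
proof -
  obtain X Y Z u a v w where c: "cone X Y Z u a v w" and UVW: "U = \<lbrakk>u\<rbrakk>" "V = \<lbrakk>v\<rbrakk>" "W = \<lbrakk>w\<rbrakk>"
    using StdE [OF assms] by metis
  note [simp] = coneD [OF c]
  obtain C b k w' where c': "cone Y Z C v b k w'"
    using cone_ex [of v Y Z] by (auto simp: hom_iff)
  note [simp] = coneD [OF c']
  obtain h g where l: "susp_lift u h g" using susp_lift_ex [of u] by auto
  note [simp] = susp_lift_simps [OF l, of X Y, simplified hom_iff, simplified]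
  obtain q where q: "q \<in> Hom B C (S X)" "q \<cdot> b = Zero B (I Y) (S X)" "q \<cdot> k = w"
    and q': "\<And>x. \<lbrakk>x \<in> Arr B; Tgt B x = I Y\<rbrakk> \<Longrightarrow> q \<cdot> b \<cdot> x = Zero B (I Y) (S X) \<cdot> x"
      "\<And>x. \<lbrakk>x \<in> Arr B; Tgt B x = Z\<rbrakk> \<Longrightarrow> q \<cdot> k \<cdot> x = w \<cdot> x"
    by (rule cone_map [OF c', of "Zero B (I Y) (S X)" "S X" w]) (auto simp: hom_iff)
  note [simp] = homD [OF q(1)] q(2,3) q'
  have "(k \<cdot> a \<oplus> neg B (b \<cdot> h)) \<cdot> \<mu> X = Zero B (Src B (\<mu> X)) (Tgt B (k \<cdot> a \<oplus> neg B (b \<cdot> h)))"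
    by simp
  then obtain s where s: "s \<in> Hom B (S X) C" "s \<cdot> \<pi> X = k \<cdot> a \<oplus> neg B (b \<cdot> h)"
    using cokernel_factor [OF conflation [of X], of "k \<cdot> a \<oplus> neg B (b \<cdot> h)"] by auto
  note [simp] = homD [OF s(1)] s(2)
  obtain d where d: "d \<in> Hom B Z (I Y)" "d \<cdot> a = h" "d \<cdot> v = \<mu> Y"
    by (rule cone_map [OF c, of h "I Y" "\<mu> Y"]) (auto simp: hom_iff)
  note [simp] = homD [OF d(1)] d(2,3)
  obtain r where r: "r \<in> Hom B C (I Y)" "r \<cdot> b = Ident B (I Y)" "r \<cdot> k = d"
    by (rule cone_map [OF c', of "Ident B (I Y)" "I Y" d]) (auto simp: hom_iff)
  note [simp] = homD [OF r(1)] r(2,3)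
  have qs: "q \<cdot> s = Ident B (S X)"
    by (rule cokernel_epi [OF conflation [of X]]) auto
  have ws: "w' \<cdot> s = neg B g"
    by (rule cokernel_epi [OF conflation [of X]]) auto
  have k: "k = s \<cdot> w \<oplus> b \<cdot> d"
    by (rule cone_eq [OF c, of _ C]) (auto simp: hom_iff)
  have "Ident B C = s \<cdot> q \<oplus> b \<cdot> r"
    by (rule cone_eq [OF c', of _ C]) (auto simp: hom_iff simp flip: k)
  then have sq: "\<lbrakk>Ident B C\<rbrakk> = \<lbrakk>s \<cdot> q\<rbrakk>"
    by (rule cls_eqI [where J = "I Y" and X = C and Y = C]) (auto simp: hom_iff)
  have "\<lbrakk>w'\<rbrakk> = \<lbrakk>w'\<rbrakk> \<cdot>\<^bsub>D\<^esub> \<lbrakk>Ident B C\<rbrakk>" by simp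
  also have "\<dots> = \<lbrakk>w' \<cdot> s \<cdot> q\<rbrakk>" unfolding sq by simp
  also have "\<dots> = \<lbrakk>neg B (g \<cdot> q)\<rbrakk>" using comp_reassoc [OF ws, of q] by simp
  finally have w': "\<lbrakk>w'\<rbrakk> = \<lbrakk>neg B (g \<cdot> q)\<rbrakk>" .
  have "triangle_mor D Sa (\<lbrakk>v\<rbrakk>, \<lbrakk>k\<rbrakk>, \<lbrakk>w'\<rbrakk>) (V, W, neg D (Sa U)) \<lbrakk>Ident B Y\<rbrakk> \<lbrakk>Ident B Z\<rbrakk> \<lbrakk>q\<rbrakk>"
  proof -
    have "susp_lift (Ident B Y) (Ident B (I Y)) (Ident B (S Y))"
      by (auto simp: susp_lift_def hom_iff)
    then have [simp]: "Sa \<lbrakk>Ident B Y\<rbrakk> = \<lbrakk>Ident B (S Y)\<rbrakk>" by (rule susp_cls)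
    have [simp]: "Sa \<lbrakk>u\<rbrakk> = \<lbrakk>g\<rbrakk>" by (rule susp_cls [OF l])
    show ?thesis using w' unfolding UVW by (simp add: triangle_mor_def D.hom_iff)
  qed
  moreover have "iso_arr D \<lbrakk>q\<rbrakk>"
    by (rule D.iso_arrI [of _ C "S X" "\<lbrakk>s\<rbrakk>"]) (simp_all add: D.hom_iff qs sq)
  moreover have "iso_arr D \<lbrakk>Ident B Y\<rbrakk>" "iso_arr D \<lbrakk>Ident B Z\<rbrakk>"
    using D.iso_arr_ident [of Y] D.iso_arr_ident [of Z] by simp_all
  ultimately have "triangle_iso D Sa (\<lbrakk>v\<rbrakk>, \<lbrakk>k\<rbrakk>, \<lbrakk>w'\<rbrakk>) (V, W, neg D (Sa U))"
    unfolding triangle_iso_def by blast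
  then show ?thesis using c' Std_iff by blast
qed

text \<open>If \<open>g \<cdot> u = u' \<cdot> f + k \<cdot> \<mu>\<close>, the correction \<open>k\<close> can be absorbed into the map on \<open>I X\<close>, and the push-out property
  gives a map of cones that makes the other two squares commute in \<open>B\<close>.\<close>

lemma std_mor:
  assumes "(U, V, W) \<in> Std" "(U', V', W') \<in> Std"
    and FG: "F \<in> Hom D (Src D U) (Src D U')" "G \<in> Hom D (Tgt D U) (Tgt D U')"
    and sq: "G \<cdot>\<^bsub>D\<^esub> U = U' \<cdot>\<^bsub>D\<^esub> F"
  shows "\<exists>H. triangle_mor D Sa (U, V, W) (U', V', W') F G H"
proof -
  obtain X Y Z u a v w where c: "cone X Y Z u a v w" and UVW: "U = \<lbrakk>u\<rbrakk>" "V = \<lbrakk>v\<rbrakk>" "W = \<lbrakk>w\<rbrakk>"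
    using StdE [OF assms(1)] by metis
  obtain X' Y' Z' u' a' v' w' where c': "cone X' Y' Z' u' a' v' w'"
    and UVW': "U' = \<lbrakk>u'\<rbrakk>" "V' = \<lbrakk>v'\<rbrakk>" "W' = \<lbrakk>w'\<rbrakk>"
    using StdE [OF assms(2)] by metis
  note [simp] = coneD [OF c] coneD [OF c']
  obtain f where f: "f \<in> Hom B X X'" "F = \<lbrakk>f\<rbrakk>" using D_homE [OF FG(1)] by (auto simp: UVW UVW')
  obtain g where g: "g \<in> Hom B Y Y'" "G = \<lbrakk>g\<rbrakk>" using D_homE [OF FG(2)] by (auto simp: UVW UVW')
  note [simp] = homD [OF f(1)] homD [OF g(1)]
  have "\<lbrakk>g \<cdot> u\<rbrakk> = \<lbrakk>u' \<cdot> f\<rbrakk>" using sq by (simp add: UVW UVW' f g)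
  then obtain k where k: "k \<in> Hom B (I X) Y'" "g \<cdot> u = u' \<cdot> f \<oplus> k \<cdot> \<mu> X"
    by (rule cls_eqE) auto
  note [simp] = homD [OF k(1)] k(2)
  obtain h s where l: "susp_lift f h s" using susp_lift_ex [of f] by auto
  note [simp] = susp_lift_simps [OF l f(1)]
  obtain m where m: "m \<in> Hom B Z Z'" "m \<cdot> a = a' \<cdot> h \<oplus> v' \<cdot> k" "m \<cdot> v = v' \<cdot> g"
    by (rule cone_map [OF c, of "a' \<cdot> h \<oplus> v' \<cdot> k" Z' "v' \<cdot> g"]) (auto simp: hom_iff)
  note [simp] = homD [OF m(1)] m(2,3)
  have "s \<cdot> w = w' \<cdot> m"
    by (rule cone_eq [OF c, of _ "S X'"]) (auto simp: hom_iff)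
  then have "triangle_mor D Sa (U, V, W) (U', V', W') F G \<lbrakk>m\<rbrakk>"
    unfolding UVW UVW' f g
    using cls_triangle_mor [OF c c' f(1) g(1) m(1) l] \<open>\<lbrakk>g \<cdot> u\<rbrakk> = \<lbrakk>u' \<cdot> f\<rbrakk>\<close> by simp
  then show ?thesis ..
qed

lemma std_factor:
  assumes "(U, V, W) \<in> Std" "F \<in> Arr D" "Src D F = Tgt D U"
    "F \<cdot>\<^bsub>D\<^esub> U = Zero D (Src D U) (Tgt D F)"
  shows "\<exists>G \<in> Hom D (Tgt D V) (Tgt D F). F = G \<cdot>\<^bsub>D\<^esub> V"
proof -
  obtain X Y Z u a v w where c: "cone X Y Z u a v w" and UVW: "U = \<lbrakk>u\<rbrakk>" "V = \<lbrakk>v\<rbrakk>" "W = \<lbrakk>w\<rbrakk>"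
    using StdE [OF assms(1)] by metis
  note [simp] = coneD [OF c]
  obtain f where f: "f \<in> Arr B" "F = \<lbrakk>f\<rbrakk>" using assms(2) by (rule D_arrE)
  have [simp]: "Src B f = Y" using assms(3) by (simp add: UVW f)
  have "\<lbrakk>f \<cdot> u\<rbrakk> = \<lbrakk>Zero B X (Tgt B f)\<rbrakk>" using assms(4) f(1) by (simp add: UVW f)
  then obtain k where "k \<in> Hom B (I X) (Tgt B f)" "f \<cdot> u = k \<cdot> \<mu> X"
    by (rule cls_zeroE) (use f(1) in auto)
  then obtain g where g: "g \<in> Hom B Z (Tgt B f)" "g \<cdot> v = f"
    using cone_map [OF c, of k "Tgt B f" f] f(1) by (metis homI \<open>Src B f = Y\<close>)
  then show ?thesis
    using homD [OF g(1)] by (intro bexI [of _ "\<lbrakk>g\<rbrakk>"]) (auto simp: UVW f D.hom_iff)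
qed

text \<open>With strictly composed representatives \<open>u\<close>, \<open>v\<close>, \<open>v \<cdot> u\<close>, the maps \<open>f\<close> and \<open>g\<close> are induced by the push-outs. For the
  third triangle, \<open>Y'\<close> is the push-out of \<open>v\<close> along \<open>i\<close>, so \<open>X'\<close> is the push-out of \<open>f\<close> along a map \<open>d\<close> from \<open>Z'\<close> to the
  injective object \<open>I Y\<close>. The cone \<open>Q\<close> of \<open>f\<close> is the push-out of \<open>f\<close> along \<open>Z' \<rightarrow> I Z'\<close>, and it does not matter stably
  which map into an injective object is used, as long as each extends over the other.\<close>

lemma std_octahedron:
  assumes "U \<in> Arr D" "V \<in> Arr D" "Tgt D U = Src D V"
  shows "\<exists>i i' j j' k k' f g. (U, i, i') \<in> Std \<and> (V, j, j') \<in> Std \<and> (V \<cdot>\<^bsub>D\<^esub> U, k, k') \<in> Std \<and>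
             triangle_mor D Sa (U, i, i') (V \<cdot>\<^bsub>D\<^esub> U, k, k') (Ident D (Src D U)) V f \<and>
             triangle_mor D Sa (V \<cdot>\<^bsub>D\<^esub> U, k, k') (V, j, j') U (Ident D (Tgt D V)) g \<and>
             (\<exists>T \<in> Std. triangle_iso D Sa T (f, g, Sa i \<cdot>\<^bsub>D\<^esub> j'))"
proof -
  obtain u where u: "u \<in> Arr B" "U = \<lbrakk>u\<rbrakk>" using assms(1) by (rule D_arrE)
  obtain v where v: "v \<in> Arr B" "V = \<lbrakk>v\<rbrakk>" using assms(2) by (rule D_arrE)
  define X Y Z where XYZ: "X = Src B u" "Y = Tgt B u" "Z = Tgt B v"
  have uH: "u \<in> Hom B X Y" and vH: "v \<in> Hom B Y Z"
    using assms(3) u v by (auto simp: XYZ intro: homI)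
  note [simp] = homD [OF uH] homD [OF vH]
  obtain Z' a i i' where cu: "cone X Y Z' u a i i'" using cone_ex [OF uH] by blast
  obtain X' c j j' where cv: "cone Y Z X' v c j j'" using cone_ex [OF vH] by blast
  obtain Y' b k k' where cvu: "cone X Z Y' (v \<cdot> u) b k k'"
    using cone_ex [of "v \<cdot> u" X Z] by (auto simp: hom_iff)
  note [simp] = coneD [OF cu] coneD [OF cv] coneD [OF cvu]
  obtain h su where lu: "susp_lift u h su" using susp_lift_ex [of u] by auto
  note [simp] = susp_lift_simps [OF lu uH]
  have iH: "i \<in> Hom B Y Z'" by (auto simp: hom_iff)
  obtain H si where li: "susp_lift i H si" using susp_lift_ex [of i] by auto
  note [simp] = susp_lift_simps [OF li iH]
  obtain f where f: "f \<in> Hom B Z' Y'" "f \<cdot> a = b" "f \<cdot> i = k \<cdot> v"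
    and f': "\<And>x. \<lbrakk>x \<in> Arr B; Tgt B x = I X\<rbrakk> \<Longrightarrow> f \<cdot> a \<cdot> x = b \<cdot> x"
      "\<And>x. \<lbrakk>x \<in> Arr B; Tgt B x = Y\<rbrakk> \<Longrightarrow> f \<cdot> i \<cdot> x = (k \<cdot> v) \<cdot> x"
    by (rule cone_map [OF cu, of b Y' "k \<cdot> v"]) (auto simp: hom_iff)
  note [simp] = homD [OF f(1)] f(2,3) f'
  obtain g where g: "g \<in> Hom B Y' X'" "g \<cdot> b = c \<cdot> h" "g \<cdot> k = j"
    and g': "\<And>x. \<lbrakk>x \<in> Arr B; Tgt B x = I X\<rbrakk> \<Longrightarrow> g \<cdot> b \<cdot> x = (c \<cdot> h) \<cdot> x"
      "\<And>x. \<lbrakk>x \<in> Arr B; Tgt B x = Z\<rbrakk> \<Longrightarrow> g \<cdot> k \<cdot> x = j \<cdot> x"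
    by (rule cone_map [OF cvu, of "c \<cdot> h" X' j]) (auto simp: hom_iff)
  note [simp] = homD [OF g(1)] g(2,3) g'
  have [simp]: "k' \<cdot> f = i'" by (rule cone_eq [OF cu, of _ "S X"]) (auto simp: hom_iff)
  have [simp]: "j' \<cdot> g = su \<cdot> k'" by (rule cone_eq [OF cvu, of _ "S Y"]) (auto simp: hom_iff)
  have lid: "susp_lift (Ident B W) (Ident B (I W)) (Ident B (S W))" if "W \<in> Obj B" for W
    using that by (auto simp: susp_lift_def hom_iff)
  have m1: "triangle_mor D Sa (\<lbrakk>u\<rbrakk>, \<lbrakk>i\<rbrakk>, \<lbrakk>i'\<rbrakk>) (\<lbrakk>v \<cdot> u\<rbrakk>, \<lbrakk>k\<rbrakk>, \<lbrakk>k'\<rbrakk>) \<lbrakk>Ident B X\<rbrakk> \<lbrakk>v\<rbrakk> \<lbrakk>f\<rbrakk>"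
    by (rule cls_triangle_mor [OF cu cvu _ vH f(1) lid]) (auto simp: hom_iff)
  have m2: "triangle_mor D Sa (\<lbrakk>v \<cdot> u\<rbrakk>, \<lbrakk>k\<rbrakk>, \<lbrakk>k'\<rbrakk>) (\<lbrakk>v\<rbrakk>, \<lbrakk>j\<rbrakk>, \<lbrakk>j'\<rbrakk>) \<lbrakk>u\<rbrakk> \<lbrakk>Ident B Z\<rbrakk> \<lbrakk>g\<rbrakk>"
    by (rule cls_triangle_mor [OF cvu cv uH _ g(1) lu]) (auto simp: hom_iff)
  \<comment> \<open>The cone of \<open>f\<close> is compared with \<open>X'\<close>, by \<open>\<alpha>\<close> in one direction and \<open>\<beta>\<close> in the other.\<close>
  obtain Q m e wQ where cf: "cone Z' Y' Q f m e wQ" using cone_ex [OF f(1)] by blast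
  note [simp] = coneD [OF cf]
  obtain d where d: "d \<in> Hom B Z' (I Y)" "d \<cdot> a = h" "d \<cdot> i = \<mu> Y"
    and d': "\<And>x. \<lbrakk>x \<in> Arr B; Tgt B x = I X\<rbrakk> \<Longrightarrow> d \<cdot> a \<cdot> x = h \<cdot> x"
      "\<And>x. \<lbrakk>x \<in> Arr B; Tgt B x = Y\<rbrakk> \<Longrightarrow> d \<cdot> i \<cdot> x = \<mu> Y \<cdot> x"
    by (rule cone_map [OF cu, of h "I Y" "\<mu> Y"]) (auto simp: hom_iff)
  note [simp] = homD [OF d(1)] d(2,3) d'
  have "\<exists>x \<in> Hom B (I Z') (I Y). x \<cdot> \<mu> Z' = d"
    using injective_extend [OF conflation [of Z'], of "I Y" d] d(1) by simp
  then obtain D' where D': "D' \<in> Hom B (I Z') (I Y)" "D' \<cdot> \<mu> Z' = d" by blast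
  note [simp] = homD [OF D'(1)] D'(2) comp_reassoc [OF D'(2)]
  have gf: "g \<cdot> f = c \<cdot> d" by (rule cone_eq [OF cu, of _ X']) (auto simp: hom_iff)
  obtain \<alpha> where \<alpha>: "\<alpha> \<in> Hom B Q X'" "\<alpha> \<cdot> m = c \<cdot> D'" "\<alpha> \<cdot> e = g"
    and \<alpha>': "\<And>x. \<lbrakk>x \<in> Arr B; Tgt B x = I Z'\<rbrakk> \<Longrightarrow> \<alpha> \<cdot> m \<cdot> x = (c \<cdot> D') \<cdot> x"
      "\<And>x. \<lbrakk>x \<in> Arr B; Tgt B x = Y'\<rbrakk> \<Longrightarrow> \<alpha> \<cdot> e \<cdot> x = g \<cdot> x"
    by (rule cone_map [OF cf, of "c \<cdot> D'" X' g]) (auto simp: hom_iff gf)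
  note [simp] = homD [OF \<alpha>(1)] \<alpha>(2,3) \<alpha>'
  obtain \<beta> where \<beta>: "\<beta> \<in> Hom B X' Q" "\<beta> \<cdot> c = m \<cdot> H" "\<beta> \<cdot> j = e \<cdot> k"
    and \<beta>': "\<And>x. \<lbrakk>x \<in> Arr B; Tgt B x = I Y\<rbrakk> \<Longrightarrow> \<beta> \<cdot> c \<cdot> x = (m \<cdot> H) \<cdot> x"
      "\<And>x. \<lbrakk>x \<in> Arr B; Tgt B x = Z\<rbrakk> \<Longrightarrow> \<beta> \<cdot> j \<cdot> x = (e \<cdot> k) \<cdot> x"
    by (rule cone_map [OF cv, of "m \<cdot> H" Q "e \<cdot> k"]) (auto simp: hom_iff)
  note [simp] = homD [OF \<beta>(1)] \<beta>(2,3) \<beta>'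
  have w\<beta>: "wQ \<cdot> \<beta> = si \<cdot> j'" by (rule cone_eq [OF cv, of _ "S Z'"]) (auto simp: hom_iff)
  \<comment> \<open>The difference of \<open>\<beta> \<cdot> g\<close> and \<open>e\<close> vanishes on \<open>k\<close> and comes from \<open>I Z'\<close> on \<open>b\<close>, so it is \<open>m \<cdot> t\<close> with this \<open>t\<close>.\<close>
  obtain t where t: "t \<in> Hom B Y' (I Z')" "t \<cdot> b = H \<cdot> h \<oplus> neg B (\<mu> Z' \<cdot> a)" "t \<cdot> k = Zero B Z (I Z')"
    and t': "\<And>x. \<lbrakk>x \<in> Arr B; Tgt B x = I X\<rbrakk> \<Longrightarrow> t \<cdot> b \<cdot> x = (H \<cdot> h \<oplus> neg B (\<mu> Z' \<cdot> a)) \<cdot> x"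
      "\<And>x. \<lbrakk>x \<in> Arr B; Tgt B x = Z\<rbrakk> \<Longrightarrow> t \<cdot> k \<cdot> x = Zero B Z (I Z') \<cdot> x"
    by (rule cone_map [OF cvu, of "H \<cdot> h \<oplus> neg B (\<mu> Z' \<cdot> a)" "I Z'" "Zero B Z (I Z')"])
      (auto simp: hom_iff)
  note [simp] = homD [OF t(1)] t(2,3) t'
  have \<beta>g: "\<beta> \<cdot> g = e \<oplus> m \<cdot> t"
    by (rule cone_eq [OF cvu, of _ Q]) (auto simp: hom_iff add_ac)
  then have c\<beta>g: "\<lbrakk>\<beta> \<cdot> g\<rbrakk> = \<lbrakk>e\<rbrakk>"
    by (rule cls_eqI [where J = "I Z'" and X = Y' and Y = Q]) (auto simp: hom_iff)
  obtain r where r: "r \<in> Hom B X' (I Y)" "r \<cdot> c = D' \<cdot> H \<oplus> neg B (Ident B (I Y))" "r \<cdot> j = Zero B Z (I Y)"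
    by (rule cone_map [OF cv, of "D' \<cdot> H \<oplus> neg B (Ident B (I Y))" "I Y" "Zero B Z (I Y)"])
      (auto simp: hom_iff)
  note [simp] = homD [OF r(1)] r(2,3)
  have "\<alpha> \<cdot> \<beta> = Ident B X' \<oplus> c \<cdot> r"
    by (rule cone_eq [OF cv, of _ X']) (auto simp: hom_iff)
  then have \<alpha>\<beta>: "\<lbrakk>\<alpha> \<cdot> \<beta>\<rbrakk> = \<lbrakk>Ident B X'\<rbrakk>"
    by (rule cls_eqI [where J = "I Y" and X = X' and Y = X']) (auto simp: hom_iff)
  have tf: "t \<cdot> f = H \<cdot> d \<oplus> neg B (\<mu> Z')"
    by (rule cone_eq [OF cu, of _ "I Z'"]) (auto simp: hom_iff)
  obtain x where x: "x \<in> Hom B Q (I Z')" "x \<cdot> m = H \<cdot> D' \<oplus> neg B (Ident B (I Z'))" "x \<cdot> e = t"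
    by (rule cone_map [OF cf, of "H \<cdot> D' \<oplus> neg B (Ident B (I Z'))" "I Z'" t])
      (auto simp: hom_iff tf)
  note [simp] = homD [OF x(1)] x(2,3)
  have "\<beta> \<cdot> \<alpha> = Ident B Q \<oplus> m \<cdot> x"
    by (rule cone_eq [OF cf, of _ Q]) (auto simp: hom_iff \<beta>g)
  then have \<beta>\<alpha>: "\<lbrakk>\<beta> \<cdot> \<alpha>\<rbrakk> = \<lbrakk>Ident B Q\<rbrakk>"
    by (rule cls_eqI [where J = "I Z'" and X = Q and Y = Q]) (auto simp: hom_iff)
  have "\<lbrakk>si \<cdot> j' \<cdot> \<alpha>\<rbrakk> = \<lbrakk>wQ\<rbrakk>"
  proof -
    have "\<lbrakk>si \<cdot> j' \<cdot> \<alpha>\<rbrakk> = \<lbrakk>wQ\<rbrakk> \<cdot>\<^bsub>D\<^esub> \<lbrakk>\<beta> \<cdot> \<alpha>\<rbrakk>"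
      using comp_reassoc2 [OF w\<beta>, of \<alpha>] by simp
    then show ?thesis unfolding \<beta>\<alpha> by simp
  qed
  then have "triangle_mor D Sa (\<lbrakk>f\<rbrakk>, \<lbrakk>e\<rbrakk>, \<lbrakk>wQ\<rbrakk>) (\<lbrakk>f\<rbrakk>, \<lbrakk>g\<rbrakk>, Sa \<lbrakk>i\<rbrakk> \<cdot>\<^bsub>D\<^esub> \<lbrakk>j'\<rbrakk>) \<lbrakk>Ident B Z'\<rbrakk> \<lbrakk>Ident B Y'\<rbrakk> \<lbrakk>\<alpha>\<rbrakk>"
    by (simp add: triangle_mor_def D.hom_iff susp_cls [OF li] susp_cls [OF lid])
  moreover have "iso_arr D \<lbrakk>\<alpha>\<rbrakk>"
    by (rule D.iso_arrI [of _ Q X' "\<lbrakk>\<beta>\<rbrakk>"]) (simp_all add: D.hom_iff \<alpha>\<beta> \<beta>\<alpha>)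
  moreover have "iso_arr D \<lbrakk>Ident B Z'\<rbrakk>" "iso_arr D \<lbrakk>Ident B Y'\<rbrakk>"
    using D.iso_arr_ident [of Z'] D.iso_arr_ident [of Y'] by simp_all
  ultimately have "\<exists>T \<in> Std. triangle_iso D Sa T (\<lbrakk>f\<rbrakk>, \<lbrakk>g\<rbrakk>, Sa \<lbrakk>i\<rbrakk> \<cdot>\<^bsub>D\<^esub> \<lbrakk>j'\<rbrakk>)"
    unfolding triangle_iso_def using cf Std_iff by blast
  moreover have "(\<lbrakk>u\<rbrakk>, \<lbrakk>i\<rbrakk>, \<lbrakk>i'\<rbrakk>) \<in> Std" "(\<lbrakk>v\<rbrakk>, \<lbrakk>j\<rbrakk>, \<lbrakk>j'\<rbrakk>) \<in> Std" "(\<lbrakk>v \<cdot> u\<rbrakk>, \<lbrakk>k\<rbrakk>, \<lbrakk>k'\<rbrakk>) \<in> Std"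
    using cu cv cvu Std_iff by blast+
  moreover have "V \<cdot>\<^bsub>D\<^esub> U = \<lbrakk>v \<cdot> u\<rbrakk>" "Ident D (Src D U) = \<lbrakk>Ident B X\<rbrakk>" "Ident D (Tgt D V) = \<lbrakk>Ident B Z\<rbrakk>"
    by (simp_all add: u v)
  ultimately show ?thesis using m1 m2 unfolding u(2) v(2) by metis
qed

text \<open>The push-out of \<open>\<mu> X\<close> along an identity is \<open>I X\<close>, which vanishes stably.\<close>

lemma std_ident:
  assumes "X \<in> Obj B"
  shows "\<exists>V W. (\<lbrakk>Ident B X\<rbrakk>, V, W) \<in> Std \<and> \<lbrakk>Ident B (Tgt D V)\<rbrakk> = \<lbrakk>Zero B (Tgt D V) (Tgt D V)\<rbrakk>"
proof -
  obtain Z a v w where c: "cone X X Z (Ident B X) a v w"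
    using cone_ex [of "Ident B X" X X] assms by (auto simp: hom_iff)
  note [simp] = coneD(1-18) [OF c]
  obtain h where h: "h \<in> Hom B Z (I X)" "h \<cdot> a = Ident B (I X)" "h \<cdot> v = \<mu> X"
    by (rule cone_map [OF c, of "Ident B (I X)" "I X" "\<mu> X"]) (auto simp: hom_iff)
  note [simp] = homD [OF h(1)] h(2,3)
  have "Ident B Z = a \<cdot> h"
    by (rule cone_eq [OF c, of _ Z]) (auto simp: hom_iff)
  then have "\<lbrakk>Ident B Z\<rbrakk> = \<lbrakk>Zero B Z Z\<rbrakk>"
    by (rule cls_zeroI [where J = "I X"]) (auto simp: hom_iff)
  moreover have "(\<lbrakk>Ident B X\<rbrakk>, \<lbrakk>v\<rbrakk>, \<lbrakk>w\<rbrakk>) \<in> Std" using c Std_iff by blast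
  ultimately show ?thesis
    by (intro exI [of _ "\<lbrakk>v\<rbrakk>"] exI [of _ "\<lbrakk>w\<rbrakk>"]) simp
qed

theorem stable_triangulated:
  "triangulated_category D S Sa (happel_triangles B E \<mu> \<pi>)"
proof -
  interpret cone_category D S Sa Std
  proof
    show "additive_functor D D S Sa" by (rule susp_functor)
    fix T assume "T \<in> Std"
    then show "triangle D S T" by (auto simp: Std_iff triangle_def coneD)
  next
    fix U assume "U \<in> Arr D"
    then obtain u where u: "u \<in> Arr B" "U = \<lbrakk>u\<rbrakk>" by (rule D_arrE)
    then show "\<exists>V W. (U, V, W) \<in> Std"
      using cone_ex [of u "Src B u" "Tgt B u"] Std_iff homI by blast
  next
    fix X assume "X \<in> Obj D"
    then show "\<exists>V W. (Ident D X, V, W) \<in> Std \<and> Ident D (Tgt D V) = Zero D (Tgt D V) (Tgt D V)"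
      using std_ident by simp
  qed (use susp_full susp_faithful susp_dense std_factor std_rotate std_mor std_octahedron in auto)
  have "Dist = happel_triangles B E \<mu> \<pi>"
    unfolding Dist_def happel_triangles_def ..
  then show ?thesis using triangulated by simp
qed

end

section \<open>Biproducts\<close>

context preadditive_category begin

lemma biproduct_typing:
  assumes "biproduct C X Y W i j p q"
  shows "X \<in> Obj C" "Y \<in> Obj C" "W \<in> Obj C"
    "i \<in> Arr C" "Src C i = X" "Tgt C i = W" "j \<in> Arr C" "Src C j = Y" "Tgt C j = W"
    "p \<in> Arr C" "Src C p = W" "Tgt C p = X" "q \<in> Arr C" "Src C q = W" "Tgt C q = Y"
    "p \<cdot> i = Ident C X" "q \<cdot> j = Ident C Y" "p \<cdot> j = Zero C Y X" "q \<cdot> i = Zero C X Y"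
  using assms by (auto simp: biproduct_def hom_iff)

lemma biproduct_reassoc:
  assumes "biproduct C X Y W i j p q" "x \<in> Arr C"
  shows "Tgt C x = X \<Longrightarrow> p \<cdot> i \<cdot> x = x" "Tgt C x = Y \<Longrightarrow> q \<cdot> j \<cdot> x = x"
    "Tgt C x = Y \<Longrightarrow> p \<cdot> j \<cdot> x = Zero C (Src C x) X" "Tgt C x = X \<Longrightarrow> q \<cdot> i \<cdot> x = Zero C (Src C x) Y"
  using biproduct_typing [OF assms(1)] assms(2) by (simp_all flip: comp_assoc_arr)

lemma biproduct_sum:
  assumes "biproduct C X Y W i j p q"
  shows "(i \<cdot> p) \<oplus> (j \<cdot> q) = Ident C W"
  using assms by (simp add: biproduct_def)

lemmas biproductD = biproduct_typing biproduct_reassoc biproduct_sum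

lemma biproduct_epi:
  assumes b: "biproduct C X Y W i j p q"
    and f: "f \<in> Hom C W V" "g \<in> Hom C W V" "f \<cdot> i = g \<cdot> i" "f \<cdot> j = g \<cdot> j"
  shows "f = g"
proof -
  note [simp] = biproductD(1-23) [OF b] f(1-2) [unfolded hom_iff]
  have *: "h = (h \<cdot> i) \<cdot> p \<oplus> (h \<cdot> j) \<cdot> q" if "h \<in> Hom C W V" for h
  proof -
    note [simp] = homD [OF that]
    have "h = h \<cdot> ((i \<cdot> p) \<oplus> (j \<cdot> q))" unfolding biproductD(24) [OF b] by simp
    then show ?thesis by simp
  qed
  show ?thesis using *[OF f(1)] *[OF f(2)] f(3,4) by simp
qed

lemma biproduct_mono:
  assumes b: "biproduct C X Y W i j p q"
    and f: "f \<in> Hom C V W" "g \<in> Hom C V W" "p \<cdot> f = p \<cdot> g" "q \<cdot> f = q \<cdot> g"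
  shows "f = g"
proof -
  note [simp] = biproductD(1-23) [OF b] f(1-2) [unfolded hom_iff]
  have *: "h = i \<cdot> p \<cdot> h \<oplus> j \<cdot> q \<cdot> h" if "h \<in> Hom C V W" for h
  proof -
    note [simp] = homD [OF that]
    have "h = ((i \<cdot> p) \<oplus> (j \<cdot> q)) \<cdot> h" unfolding biproductD(24) [OF b] by simp
    then show ?thesis by simp
  qed
  show ?thesis using *[OF f(1)] *[OF f(2)] f(3,4) by simp
qed

lemma biproduct_swap:
  assumes "biproduct C X Y W i j p q"
  shows "biproduct C Y X W j i q p"
proof -
  note [simp] = biproductD(1-23) [OF assms]
  show ?thesis
    unfolding biproduct_def using biproductD(24) [OF assms]
    by (simp add: hom_iff add_commute [of "j \<cdot> q" "i \<cdot> p"])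
qed

lemma biproduct_zero:
  assumes "zero_object C Z" "X \<in> Obj C"
  shows "biproduct C X Z X (Ident C X) (Zero C Z X) (Ident C X) (Zero C X Z)"
proof -
  have "Z \<in> Obj C" using assms by (simp add: zero_object_def)
  then have "Zero C Z Z = Ident C Z"
    using zero_object_eq [OF assms(1), of "Zero C Z Z" Z "Ident C Z"] by (auto simp: hom_iff)
  then show ?thesis using assms(2) \<open>Z \<in> Obj C\<close> by (simp add: biproduct_def hom_iff)
qed

lemma biproduct_iso:
  assumes b: "biproduct C X Y W i j p q"
    and a: "a \<in> Hom C X X'" "a' \<in> Hom C X' X" "a' \<cdot> a = Ident C X" "a \<cdot> a' = Ident C X'"
    and b': "b \<in> Hom C W W'" "b' \<in> Hom C W' W" "b' \<cdot> b = Ident C W" "b \<cdot> b' = Ident C W'"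
    and c: "c \<in> Hom C Y Y'" "c' \<in> Hom C Y' Y" "c' \<cdot> c = Ident C Y" "c \<cdot> c' = Ident C Y'"
    and i': "i' \<in> Hom C X' W'" "b \<cdot> i = i' \<cdot> a" and q': "q' \<in> Hom C W' Y'" "c \<cdot> q = q' \<cdot> b"
  shows "biproduct C X' Y' W' i' (b \<cdot> j \<cdot> c') (a \<cdot> p \<cdot> b') q'"
proof -
  note [simp] = biproductD(1-23) [OF b] a(1-2) [unfolded hom_iff] b'(1-2) [unfolded hom_iff] c(1-2) [unfolded hom_iff] homD [OF i'(1)] homD [OF q'(1)] a(3,4) b'(3,4) c(3,4)
    comp_reassoc [OF a(3)] comp_reassoc [OF a(4)] comp_reassoc [OF b'(3)] comp_reassoc [OF b'(4)]
    comp_reassoc [OF c(3)] comp_reassoc [OF c(4)]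
  have i: "i' = b \<cdot> i \<cdot> a'" using comp_reassoc2 [OF i'(2), of a'] by simp
  have q: "q' = c \<cdot> q \<cdot> b'" using comp_reassoc2 [OF q'(2), of b'] by simp
  have "b \<cdot> ((i \<cdot> p) \<oplus> (j \<cdot> q)) \<cdot> b' = Ident C W'" unfolding biproductD(24) [OF b] by simp
  then show ?thesis
    unfolding biproduct_def i q by (simp add: hom_iff)
qed

text \<open>A complement of \<open>j \<cdot> i\<close> is the sum of the complements of \<open>i\<close> and \<open>j\<close>.\<close>

lemma biproduct_comp:
  assumes b: "biproduct C X T Y i s r q" and b': "biproduct C Y T' W j s' r' q'"
    and u: "biproduct C T T' U k k' l l'"
  shows "biproduct C X U W (j \<cdot> i) ((j \<cdot> s \<cdot> l) \<oplus> (s' \<cdot> l')) (r \<cdot> r') ((k \<cdot> q \<cdot> r') \<oplus> (k' \<cdot> q'))"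
proof -
  note [simp] = biproductD(1-23) [OF b] biproductD(1-23) [OF b'] biproductD [OF u]
  let ?J = "(j \<cdot> s \<cdot> l) \<oplus> (s' \<cdot> l')" and ?P = "(k \<cdot> q \<cdot> r') \<oplus> (k' \<cdot> q')"
  have "((j \<cdot> i) \<cdot> r \<cdot> r') \<oplus> ?J \<cdot> ?P = Ident C W"
  proof (rule biproduct_epi [OF b', of _ W])
    show "(((j \<cdot> i) \<cdot> r \<cdot> r') \<oplus> ?J \<cdot> ?P) \<cdot> j = Ident C W \<cdot> j"
      by (rule biproduct_epi [OF b, of _ W]) (auto simp: hom_iff)
    show "(((j \<cdot> i) \<cdot> r \<cdot> r') \<oplus> ?J \<cdot> ?P) \<cdot> s' = Ident C W \<cdot> s'" by simp
  qed (auto simp: hom_iff)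
  then show ?thesis unfolding biproduct_def by (simp add: hom_iff)
qed

text \<open>The complement is the image of the idempotent \<open>1 - f \<cdot> r\<close>.\<close>

lemma split_mono_biproduct:
  assumes ic: "idempotent_complete C" and f: "f \<in> Hom C X Y" "r \<in> Hom C Y X" "r \<cdot> f = Ident C X"
  shows "\<exists>T s q. biproduct C X T Y f s r q"
proof -
  note [simp] = f(1-2) [unfolded hom_iff] f(3) comp_reassoc [OF f(3)]
  let ?e = "Ident C Y \<oplus> neg C (f \<cdot> r)"
  have "?e \<in> Hom C Y Y" "?e \<cdot> ?e = ?e" by (simp_all add: hom_iff)
  then obtain T q s where T: "T \<in> Obj C" "q \<in> Hom C Y T" "s \<in> Hom C T Y" "?e = s \<cdot> q" "q \<cdot> s = Ident C T"
    using ic unfolding idempotent_complete_def by (metis homD(4) f(2))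
  note [simp] = T(2-3) [unfolded hom_iff] T(5) comp_reassoc [OF T(5)]
  have "q \<cdot> f = q \<cdot> (s \<cdot> q) \<cdot> f" by simp
  also have "\<dots> = Zero C X T" unfolding T(4) [symmetric] by simp
  finally have qf: "q \<cdot> f = Zero C X T" .
  have "r \<cdot> s = r \<cdot> (s \<cdot> q) \<cdot> s" by simp
  also have "\<dots> = Zero C T X" unfolding T(4) [symmetric] by simp
  finally have rs: "r \<cdot> s = Zero C T X" .
  have "(f \<cdot> r) \<oplus> (s \<cdot> q) = Ident C Y"
    unfolding T(4) [symmetric] by simp
  then show ?thesis using qf rs T by (intro exI [of _ T] exI [of _ s] exI [of _ q]) (simp add: biproduct_def hom_iff)
qed

section \<open>Powers and traces\<close>

lemma endo_pow_simps [simp]: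
  "endo_pow C X e 0 = Ident C X"
  "endo_pow C X e (Suc k) = e \<cdot> endo_pow C X e k"
  by (simp_all add: endo_pow_def)

lemma endo_pow_typing [simp]:
  assumes "e \<in> Arr C" "Src C e = X" "Tgt C e = X"
  shows "endo_pow C X e k \<in> Arr C" "Src C (endo_pow C X e k) = X" "Tgt C (endo_pow C X e k) = X"
proof -
  have "X \<in> Obj C" using assms by auto
  then have "endo_pow C X e k \<in> Arr C \<and> Src C (endo_pow C X e k) = X \<and> Tgt C (endo_pow C X e k) = X"
    using assms by (induction k) auto
  then show "endo_pow C X e k \<in> Arr C" "Src C (endo_pow C X e k) = X" "Tgt C (endo_pow C X e k) = X"
    by auto
qed

lemma endo_pow_intertwine:
  assumes "f \<in> Hom C X Y" "e \<in> Hom C X X" "e' \<in> Hom C Y Y" "f \<cdot> e = e' \<cdot> f"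
  shows "f \<cdot> endo_pow C X e k = endo_pow C Y e' k \<cdot> f"
proof (induction k)
  note [simp] = assms(1-3) [unfolded hom_iff]
  case 0
  then show ?case by simp
next
  note [simp] = assms(1-3) [unfolded hom_iff]
  case (Suc k)
  then show ?case
    using comp_reassoc2 [OF assms(4), of "endo_pow C X e k"] by simp
qed

lemma endo_pow_commute:
  "e \<in> Hom C X X \<Longrightarrow> e \<cdot> endo_pow C X e k = endo_pow C X e k \<cdot> e"
  by (rule endo_pow_intertwine) auto

text \<open>The relative trace \<open>\<Sum>\<^sub>i\<^sub><\<^sub>k e'\<^sup>k\<^sup>-\<^sup>1\<^sup>-\<^sup>i \<cdot> g \<cdot> e\<^sup>i\<close> of \<open>g : X \<rightarrow> Y\<close>, in the form of its Horner recursion.\<close>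

primrec trace :: "'a \<Rightarrow> 'b \<Rightarrow> 'a \<Rightarrow> 'b \<Rightarrow> 'b \<Rightarrow> nat \<Rightarrow> 'b" where
  "trace X e Y e' g 0 = Zero C X Y"
| "trace X e Y e' g (Suc k) = e' \<cdot> trace X e Y e' g k \<oplus> g \<cdot> endo_pow C X e k"

lemma trace_typing [simp]:
  assumes "g \<in> Arr C" "Src C g = X" "Tgt C g = Y"
    "e \<in> Arr C" "Src C e = X" "Tgt C e = X" "e' \<in> Arr C" "Src C e' = Y" "Tgt C e' = Y"
  shows "trace X e Y e' g k \<in> Arr C" "Src C (trace X e Y e' g k) = X" "Tgt C (trace X e Y e' g k) = Y"
proof -
  have "X \<in> Obj C" "Y \<in> Obj C" using assms by auto
  then have "trace X e Y e' g k \<in> Arr C \<and> Src C (trace X e Y e' g k) = X \<and> Tgt C (trace X e Y e' g k) = Y"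
    using assms by (induction k) auto
  then show "trace X e Y e' g k \<in> Arr C" "Src C (trace X e Y e' g k) = X" "Tgt C (trace X e Y e' g k) = Y"
    by auto
qed

text \<open>Splitting off the last instead of the first power. The two recursions together say that the commutator of
  the trace with the endomorphisms telescopes to \<open>e'\<^sup>k \<cdot> g - g \<cdot> e\<^sup>k\<close>, which vanishes for \<open>k = n\<close>.\<close>

lemma trace_Suc':
  assumes "g \<in> Hom C X Y" "e \<in> Hom C X X" "e' \<in> Hom C Y Y"
  shows "trace X e Y e' g (Suc k) = trace X e Y e' g k \<cdot> e \<oplus> endo_pow C Y e' k \<cdot> g"
proof (induction k)
  note [simp] = assms(1-3) [unfolded hom_iff]
  case 0
  then show ?case by simp
next
  note [simp] = assms(1-3) [unfolded hom_iff]
  case (Suc k)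
  have "trace X e Y e' g (Suc (Suc k)) = e' \<cdot> trace X e Y e' g (Suc k) \<oplus> g \<cdot> endo_pow C X e k \<cdot> e"
    using endo_pow_commute [OF assms(2)] by simp
  also have "\<dots> = (e' \<cdot> trace X e Y e' g k \<cdot> e \<oplus> e' \<cdot> endo_pow C Y e' k \<cdot> g) \<oplus> g \<cdot> endo_pow C X e k \<cdot> e"
    unfolding Suc by simp
  also have "\<dots> = trace X e Y e' g (Suc k) \<cdot> e \<oplus> endo_pow C Y e' (Suc k) \<cdot> g"
    by (simp add: add_ac)
  finally show ?case .
qed

lemma trace_intertwine:
  assumes "g \<in> Hom C X Y" "e \<in> Hom C X X" "e' \<in> Hom C Y Y"
    "endo_pow C X e n = Zero C X X" "endo_pow C Y e' n = Zero C Y Y"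
  shows "trace X e Y e' g n \<cdot> e = e' \<cdot> trace X e Y e' g n"
  using trace_Suc' [OF assms(1-3), of n] assms(1-3) [unfolded hom_iff] assms(4,5)
  by simp

lemma trace_comp_left:
  assumes "g \<in> Hom C X Y" "e \<in> Hom C X X" "e' \<in> Hom C Y Y"
    "h \<in> Hom C Y Z" "e'' \<in> Hom C Z Z" "h \<cdot> e' = e'' \<cdot> h"
  shows "h \<cdot> trace X e Y e' g k = trace X e Z e'' (h \<cdot> g) k"
proof (induction k)
  note [simp] = assms(1-5) [unfolded hom_iff]
  case 0
  then show ?case by simp
next
  note [simp] = assms(1-5) [unfolded hom_iff]
  case (Suc k)
  then show ?case
    using comp_reassoc2 [OF assms(6), of "trace X e Y e' g k"] by simp
qed

lemma trace_comp_right: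
  assumes "g \<in> Hom C X Y" "e \<in> Hom C X X" "e' \<in> Hom C Y Y"
    "h \<in> Hom C Z X" "e'' \<in> Hom C Z Z" "h \<cdot> e'' = e \<cdot> h"
  shows "trace X e Y e' g k \<cdot> h = trace Z e'' Y e' (g \<cdot> h) k"
proof (induction k)
  note [simp] = assms(1-5) [unfolded hom_iff]
  case 0
  then show ?case by simp
next
  note [simp] = assms(1-5) [unfolded hom_iff]
  case (Suc k)
  then show ?case
    using endo_pow_intertwine [OF assms(4,5,2,6), of k] by simp
qed

section \<open>Free objects\<close>

text \<open>\<open>W\<close> with \<open>d\<close> is the free object \<open>X \<otimes> \<int>[\<epsilon>]/\<epsilon>\<^sup>m\<^sup>+\<^sup>1\<close>, that is, a sum of \<open>m + 1\<close> copies of \<open>X\<close> shifted by \<open>d\<close>. The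
  map \<open>u\<close> is the inclusion of the generating copy, \<open>c\<close> the projection to the copy killed by \<open>d\<close>. The exponent is \<open>Suc m\<close> so
  that the index \<open>m\<close> of the last nonzero power needs no subtraction.\<close>

definition free_on :: "'a \<Rightarrow> nat \<Rightarrow> 'a \<Rightarrow> 'b \<Rightarrow> 'b \<Rightarrow> 'b \<Rightarrow> bool" where
  "free_on X m W d u c \<longleftrightarrow> d \<in> Hom C W W \<and> u \<in> Hom C X W \<and> c \<in> Hom C W X \<and>
     endo_pow C W d (Suc m) = Zero C W W \<and>
     (\<forall>k<m. c \<cdot> endo_pow C W d k \<cdot> u = Zero C X X) \<and> c \<cdot> endo_pow C W d m \<cdot> u = Ident C X \<and>
     trace W d W d (u \<cdot> c) (Suc m) = Ident C W"

text \<open>In \<open>c \<cdot> \<Sum>\<^sub>k d\<^sup>m\<^sup>-\<^sup>k \<cdot> u \<cdot> g \<cdot> e\<^sup>k\<close> only the summand with \<open>k = 0\<close> survives, because \<open>c \<cdot> d\<^sup>m\<^sup>-\<^sup>k \<cdot> u\<close> is \<open>1\<close> for \<open>k = 0\<close> and \<open>0\<close>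
  otherwise. For \<open>g = 1\<close> the trace is a section of \<open>c\<close>.\<close>

lemma free_counit_trace:
  assumes "d \<in> Hom C W W" "u \<in> Hom C X W" "c \<in> Hom C W X"
    "\<And>k. k < m \<Longrightarrow> c \<cdot> endo_pow C W d k \<cdot> u = Zero C X X" "c \<cdot> endo_pow C W d m \<cdot> u = Ident C X"
    "g \<in> Hom C Y X" "e \<in> Hom C Y Y"
  shows "c \<cdot> trace Y e W d (u \<cdot> g) (Suc m) = g"
proof -
  note h = assms(1-3,6,7)
  note [simp] = h [unfolded hom_iff]
  have step: "c \<cdot> trace Y e W d (u \<cdot> g) (Suc k) =
      (c \<cdot> trace Y e W d (u \<cdot> g) k) \<cdot> e \<oplus> (c \<cdot> endo_pow C W d k \<cdot> u) \<cdot> g" for k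
    by (subst trace_Suc') (auto simp: hom_iff)
  have "k \<le> m \<Longrightarrow> c \<cdot> trace Y e W d (u \<cdot> g) k = Zero C Y X" for k
  proof (induction k)
    case (Suc k)
    then show ?case unfolding step using assms(4) [of k] by simp
  qed simp
  then show ?thesis unfolding step using assms(5) by simp
qed

text \<open>The dual computation: only the summand with \<open>k = m\<close> survives.\<close>

lemma free_trace_unit:
  assumes "d \<in> Hom C W W" "u \<in> Hom C X W" "c \<in> Hom C W X"
    "\<And>k. k < m \<Longrightarrow> c \<cdot> endo_pow C W d k \<cdot> u = Zero C X X" "c \<cdot> endo_pow C W d m \<cdot> u = Ident C X"
    "g \<in> Hom C X Y" "e \<in> Hom C Y Y"
  shows "trace W d Y e (g \<cdot> c) (Suc m) \<cdot> u = g"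
proof -
  note h = assms(1-3,6,7)
  note [simp] = h [unfolded hom_iff]
  have step: "trace W d Y e (g \<cdot> c) (Suc k) \<cdot> u =
      e \<cdot> (trace W d Y e (g \<cdot> c) k \<cdot> u) \<oplus> g \<cdot> (c \<cdot> endo_pow C W d k \<cdot> u)" for k
    by simp
  have "k \<le> m \<Longrightarrow> trace W d Y e (g \<cdot> c) k \<cdot> u = Zero C X Y" for k
  proof (induction k)
    case (Suc k)
    then show ?case unfolding step using assms(4) [of k] by simp
  qed simp
  then show ?thesis unfolding step using assms(5) by simp
qed

end

context additive_category begin

text \<open>One copy of \<open>X\<close> is added to \<open>W\<close> at the bottom: the new endomorphism \<open>d'\<close> acts on \<open>W\<close> as \<open>d\<close> plus the
  old projection \<open>c\<close> into the new copy, which \<open>d'\<close> kills.\<close>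

lemma free_ex: "X \<in> Obj C \<Longrightarrow> \<exists>W d u c. free_on X m W d u c"
proof (induction m)
  case 0
  then show ?case
    by (intro exI [of _ X] exI [of _ "Zero C X X"] exI [of _ "Ident C X"])
      (simp add: free_on_def hom_iff)
next
  case (Suc m)
  then obtain W d u c where F: "free_on X m W d u c" by blast
  then have h: "d \<in> Hom C W W" "u \<in> Hom C X W" "c \<in> Hom C W X"
    and nil: "endo_pow C W d (Suc m) = Zero C W W"
    and orth: "\<And>k. k < m \<Longrightarrow> c \<cdot> endo_pow C W d k \<cdot> u = Zero C X X" "c \<cdot> endo_pow C W d m \<cdot> u = Ident C X"
    and tr: "trace W d W d (u \<cdot> c) (Suc m) = Ident C W"
    unfolding free_on_def by blast+
  note [simp] = h [unfolded hom_iff]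
  obtain V i j p q where b: "biproduct C W X V i j p q" using ex_biproduct [of W X] by auto
  note [simp] = biproductD(1-23) [OF b]
  define d' where "d' = i \<cdot> d \<cdot> p \<oplus> j \<cdot> c \<cdot> p"
  have [simp]: "d' \<in> Arr C" "Src C d' = V" "Tgt C d' = V" by (simp_all add: d'_def)
  have pd: "p \<cdot> d' = d \<cdot> p" and qd: "q \<cdot> d' = c \<cdot> p" by (simp_all add: d'_def)
  have pk: "p \<cdot> endo_pow C V d' k = endo_pow C W d k \<cdot> p" for k
    by (rule endo_pow_intertwine [OF _ _ _ pd]) (auto simp: hom_iff)
  have qk: "q \<cdot> endo_pow C V d' (Suc k) = c \<cdot> endo_pow C W d k \<cdot> p" for k
    using comp_reassoc2 [OF qd, of "endo_pow C V d' k"] by (simp add: pk)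
  have orth': "q \<cdot> endo_pow C V d' k \<cdot> i \<cdot> u = (if k = Suc m then Ident C X else Zero C X X)"
    if "k \<le> Suc m" for k
  proof (cases k)
    case (Suc l)
    then show ?thesis
      using that orth comp_reassoc2 [OF qk [of l], of "i \<cdot> u"] by (auto simp del: endo_pow_simps)
  qed simp
  let ?T = "trace V d' V d' ((i \<cdot> u) \<cdot> q)"
  have nil': "endo_pow C V d' (Suc (Suc m)) = Zero C V V"
  proof (rule biproduct_mono [OF b, of _ V])
    show "p \<cdot> endo_pow C V d' (Suc (Suc m)) = p \<cdot> Zero C V V"
      unfolding pk using nil by (simp add: comp_reassoc [OF nil [unfolded endo_pow_simps]])
    show "q \<cdot> endo_pow C V d' (Suc (Suc m)) = q \<cdot> Zero C V V"
      unfolding qk nil by simp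
  qed (auto simp: hom_iff)
  have ptr: "trace V d' W d (u \<cdot> q) (Suc k) = trace W d W d (u \<cdot> c) k \<cdot> p \<oplus> endo_pow C W d k \<cdot> u \<cdot> q" for k
  proof (induction k)
    case (Suc k)
    have "trace V d' W d (u \<cdot> q) (Suc (Suc k)) =
        d \<cdot> trace V d' W d (u \<cdot> q) (Suc k) \<oplus> u \<cdot> q \<cdot> endo_pow C V d' (Suc k)" by simp
    also have "\<dots> = trace W d W d (u \<cdot> c) (Suc k) \<cdot> p \<oplus> endo_pow C W d (Suc k) \<cdot> u \<cdot> q"
      unfolding Suc qk by (simp add: add_ac)
    finally show ?case .
  qed simp
  have "?T (Suc (Suc m)) = Ident C V"
  proof (rule biproduct_mono [OF b, of _ V])
    have "p \<cdot> ?T (Suc (Suc m)) = trace V d' W d (p \<cdot> (i \<cdot> u) \<cdot> q) (Suc (Suc m))"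
      by (rule trace_comp_left [OF _ _ _ _ _ pd]) (auto simp: hom_iff)
    also have "\<dots> = trace V d' W d (u \<cdot> q) (Suc (Suc m))" by simp
    also have "\<dots> = p" unfolding ptr tr nil by simp
    finally show "p \<cdot> ?T (Suc (Suc m)) = p \<cdot> Ident C V" by simp
    show "q \<cdot> ?T (Suc (Suc m)) = q \<cdot> Ident C V"
      using free_counit_trace [of d' V "i \<cdot> u" X q "Suc m" q V d'] orth'
      by (auto simp: hom_iff simp del: endo_pow_simps trace.simps)
  qed (auto simp: hom_iff simp del: trace.simps)
  then have "free_on X (Suc m) V d' (i \<cdot> u) q"
    unfolding free_on_def using nil' orth'
    by (auto simp: hom_iff simp del: endo_pow_simps trace.simps)
  then show ?case by blast
qed

end

section \<open>The category of objects with a nilpotent endomorphism\<close>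

locale nilpotent_category = additive_category C
  for C :: "('o, 'm) precat" (structure) +
  fixes n :: nat
begin

abbreviation "B \<equiv> eps_cat C n"
abbreviation "E \<equiv> forget_exact C n (trivial_exact C)"

lemma eps_obj_iff: "(X, e) \<in> eps_objects C n \<longleftrightarrow>
    X \<in> Obj C \<and> e \<in> Arr C \<and> Src C e = X \<and> Tgt C e = X \<and> endo_pow C X e n = Zero C X X"
  by (auto simp: eps_objects_def hom_iff)

lemma B_simps [simp]:
  "Obj B = eps_objects C n"
  "Src B (A, f, A') = A" "Tgt B (A, f, A') = A'"
  "Ident B A = (A, Ident C (fst A), A)"
  "(A1, g, A') \<cdot>\<^bsub>B\<^esub> (A, f, A2) = (A, g \<cdot> f, A')"
  "(A, f, A') \<oplus>\<^bsub>B\<^esub> (A1, g, A2) = (A, f \<oplus> g, A')"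
  "Zero B A A' = (A, Zero C (fst A) (fst A'), A')"
  "forget_arr (A, f, A') = f"
  by (auto simp: eps_cat_def forget_arr_def)

lemma B_arr_iff: "((X, e), f, (Y, e')) \<in> Arr B \<longleftrightarrow> (X, e) \<in> eps_objects C n \<and>
    (Y, e') \<in> eps_objects C n \<and> f \<in> Arr C \<and> Src C f = X \<and> Tgt C f = Y \<and> f \<cdot> e = e' \<cdot> f"
  by (auto simp: eps_cat_def hom_iff eps_obj_iff)

lemma B_hom_iff: "F \<in> Hom B (X, e) (Y, e') \<longleftrightarrow> (\<exists>f. F = ((X, e), f, (Y, e')) \<and> F \<in> Arr B)"
  by (cases F) (auto simp: Hom_def)

lemma B_arrE:
  assumes "F \<in> Arr B"
  obtains X e f Y e' where "F = ((X, e), f, (Y, e'))" "((X, e), f, (Y, e')) \<in> Arr B"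
  using assms by (metis prod_cases3 surj_pair)

lemma B_arr_src_ex:
  assumes "F \<in> Arr B" "Src B F = (X, e)"
  shows "\<exists>f Y e'. F = ((X, e), f, (Y, e')) \<and> ((X, e), f, (Y, e')) \<in> Arr B"
  by (rule B_arrE [OF assms(1)]) (use assms(2) in auto)

lemma B_arr_tgt_ex:
  assumes "F \<in> Arr B" "Tgt B F = (Y, e')"
  shows "\<exists>X e f. F = ((X, e), f, (Y, e')) \<and> ((X, e), f, (Y, e')) \<in> Arr B"
  by (rule B_arrE [OF assms(1)]) (use assms(2) in auto)

lemma B_homE:
  assumes "F \<in> Hom B A A'"
  obtains X e f Y e' where "A = (X, e)" "A' = (Y, e')" "F = ((X, e), f, (Y, e'))"
    "((X, e), f, (Y, e')) \<in> Arr B"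
  using assms by (cases A, cases A') (auto simp: B_hom_iff)

lemma B_arr_typing:
  assumes "((X, e), f, (Y, e')) \<in> Arr B"
  shows "X \<in> Obj C" "Y \<in> Obj C" "e \<in> Arr C" "Src C e = X" "Tgt C e = X"
    "e' \<in> Arr C" "Src C e' = Y" "Tgt C e' = Y" "f \<in> Arr C" "Src C f = X" "Tgt C f = Y"
    "endo_pow C X e n = Zero C X X" "endo_pow C Y e' n = Zero C Y Y"
    "(X, e) \<in> eps_objects C n" "(Y, e') \<in> eps_objects C n" "f \<cdot> e = e' \<cdot> f"
  using assms by (auto simp: B_arr_iff eps_obj_iff)

lemma B_arr_reassoc:
  assumes "((X, e), f, (Y, e')) \<in> Arr B" "x \<in> Arr C" "Tgt C x = X"
  shows "f \<cdot> e \<cdot> x = e' \<cdot> f \<cdot> x"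
  using B_arr_typing(1-15) [OF assms(1)] comp_reassoc2 [OF B_arr_typing(16) [OF assms(1)]] assms(2,3)
  by simp

lemmas B_arrD = B_arr_typing B_arr_reassoc

text \<open>An endomorphism is nilpotent as soon as it is so on two arrows \<open>i\<close>, \<open>j\<close> through which the identity decomposes.
  These need not be inclusions of a biproduct; for push-outs, \<open>j\<close> is a structure map,
  and for a split quotient both are the projection.\<close>

lemma nilpotent_glue:
  assumes d: "d \<in> Hom C W W" and "i \<in> Hom C X W" "j \<in> Hom C Y W" "p \<in> Hom C W X" "q \<in> Hom C W Y"
    "i \<cdot> p \<oplus> j \<cdot> q = Ident C W"
    "(X, e) \<in> eps_objects C n" "(Y, e') \<in> eps_objects C n" "i \<cdot> e = d \<cdot> i" "j \<cdot> e' = d \<cdot> j"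
  shows "(W, d) \<in> eps_objects C n"
proof -
  note [simp] = assms(1-5) [unfolded hom_iff] assms(7,8) [unfolded eps_obj_iff]
  have i: "endo_pow C W d n \<cdot> i = Zero C X W"
    using endo_pow_intertwine [OF assms(2) _ d assms(9), of n] by (simp add: hom_iff)
  have j: "endo_pow C W d n \<cdot> j = Zero C Y W"
    using endo_pow_intertwine [OF assms(3) _ d assms(10), of n] by (simp add: hom_iff)
  have "endo_pow C W d n = endo_pow C W d n \<cdot> (i \<cdot> p \<oplus> j \<cdot> q)" unfolding assms(6) by simp
  also have "\<dots> = Zero C W W" using comp_reassoc [OF i, of p] comp_reassoc [OF j, of q] by simp
  finally show ?thesis using d by (auto simp: eps_obj_iff)
qed

text \<open>The dual form serves for pull-backs and for subobjects.\<close>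

lemma nilpotent_coglue:
  assumes d: "d \<in> Hom C W W" and "i \<in> Hom C X W" "j \<in> Hom C Y W" "p \<in> Hom C W X" "q \<in> Hom C W Y"
    "i \<cdot> p \<oplus> j \<cdot> q = Ident C W"
    "(X, e) \<in> eps_objects C n" "(Y, e') \<in> eps_objects C n" "p \<cdot> d = e \<cdot> p" "q \<cdot> d = e' \<cdot> q"
  shows "(W, d) \<in> eps_objects C n"
proof -
  note [simp] = assms(1-5) [unfolded hom_iff] assms(7,8) [unfolded eps_obj_iff]
  have p: "p \<cdot> endo_pow C W d n = Zero C W X"
    using endo_pow_intertwine [OF assms(4) d _ assms(9), of n] by (simp add: hom_iff)
  have q: "q \<cdot> endo_pow C W d n = Zero C W Y"
    using endo_pow_intertwine [OF assms(5) d _ assms(10), of n] by (simp add: hom_iff)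
  have "endo_pow C W d n = (i \<cdot> p \<oplus> j \<cdot> q) \<cdot> endo_pow C W d n" unfolding assms(6) by simp
  also have "\<dots> = Zero C W W" using p q by simp
  finally show ?thesis using d by (auto simp: eps_obj_iff)
qed

sublocale B: additive_category B
proof (intro additive_category.intro preadditive_category.intro category.intro
    additive_category_axioms.intro preadditive_category_axioms.intro)
  fix A A' assume A: "A \<in> Obj B" "A' \<in> Obj B"
  obtain X e Y e' where XY: "A = (X, e)" "A' = (Y, e')" by (metis surj_pair)
  note [simp] = A [unfolded XY B_simps eps_obj_iff]
  show "comm_group (hom_group B A A')"
  proof (rule comm_groupI)
    fix F assume "F \<in> carrier (hom_group B A A')"
    then obtain f where F: "F = ((X, e), f, (Y, e'))" "((X, e), f, (Y, e')) \<in> Arr B"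
      by (auto simp: hom_group_def XY B_hom_iff)
    note [simp] = B_arrD [OF F(2)]
    show "\<exists>G\<in>carrier (hom_group B A A'). G \<otimes>\<^bsub>hom_group B A A'\<^esub> F = \<one>\<^bsub>hom_group B A A'\<^esub>"
      by (rule bexI [of _ "((X, e), neg C f, (Y, e'))"])
        (simp_all add: hom_group_def XY F B_hom_iff B_arr_iff)
  qed (use A in \<open>auto simp: hom_group_def XY B_hom_iff B_arr_iff eps_obj_iff add_ac\<close>)
next
  obtain Z where Z: "zero_object C Z" using ex_zero_object by blast
  then have ZO: "Z \<in> Obj C" by (simp add: zero_object_def)
  note zero = zero_object_eq [OF Z] and zero' = zero_object_eq' [OF Z]
  define d where "d = Zero C Z Z"
  have [simp]: "d \<in> Arr C" "Src C d = Z" "Tgt C d = Z" using ZO by (auto simp: d_def)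
  have "endo_pow C Z d n = Zero C Z Z"
    by (rule zero [of _ Z]) (use ZO in \<open>auto simp: hom_iff\<close>)
  then have ZZ: "(Z, d) \<in> eps_objects C n" using ZO by (auto simp: eps_obj_iff)
  have "\<exists>!F. F \<in> Hom B A (Z, d)" if "A \<in> eps_objects C n" for A
  proof -
    obtain X e where A: "A = (X, e)" by (cases A)
    note [simp] = that [unfolded A eps_obj_iff]
    show ?thesis unfolding A
      by (rule ex1I [of _ "((X, e), Zero C X Z, (Z, d))"])
        (use ZO ZZ that in \<open>auto simp: A B_hom_iff B_arr_iff hom_iff intro: zero [of _ X]\<close>)
  qed
  moreover have "\<exists>!F. F \<in> Hom B (Z, d) A" if "A \<in> eps_objects C n" for A
  proof -
    obtain X e where A: "A = (X, e)" by (cases A)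
    note [simp] = that [unfolded A eps_obj_iff]
    show ?thesis unfolding A
      by (rule ex1I [of _ "((Z, d), Zero C Z X, (X, e))"])
        (use ZO ZZ that in \<open>auto simp: A B_hom_iff B_arr_iff hom_iff intro: zero' [of _ X]\<close>)
  qed
  ultimately have "zero_object B (Z, d)" using ZZ unfolding zero_object_def by simp
  then show "\<exists>Z. zero_object B Z" ..
next
  fix A A' assume A: "A \<in> Obj B" "A' \<in> Obj B"
  obtain X e Y e' where XY: "A = (X, e)" "A' = (Y, e')" by (metis surj_pair)
  have ob: "(X, e) \<in> eps_objects C n" "(Y, e') \<in> eps_objects C n" using A by (auto simp: XY)
  note [simp] = ob [unfolded eps_obj_iff]
  obtain W i j p q where b: "biproduct C X Y W i j p q" using ex_biproduct [of X Y] by auto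
  note [simp] = biproductD(1-23) [OF b]
  let ?d = "i \<cdot> e \<cdot> p \<oplus> j \<cdot> e' \<cdot> q"
  have W: "(W, ?d) \<in> eps_objects C n"
    by (rule nilpotent_glue [of _ _ i X j Y p q, OF _ _ _ _ _ biproductD(24) [OF b] ob])
      (auto simp: hom_iff)
  have "biproduct B A A' (W, ?d) ((X, e), i, (W, ?d)) ((Y, e'), j, (W, ?d))
     ((W, ?d), p, (X, e)) ((W, ?d), q, (Y, e'))"
    unfolding biproduct_def using W ob biproductD(24) [OF b] by (simp add: XY B_hom_iff B_arr_iff)
  then show "\<exists>W i j p q. biproduct B A A' W i j p q" by blast
next
  fix F F' G A A' A''
  assume h: "F \<in> Hom B A A'" "F' \<in> Hom B A A'" "G \<in> Hom B A' A''"
  obtain X e Y e' Z e'' where XY: "A = (X, e)" "A' = (Y, e')" "A'' = (Z, e'')" by (metis surj_pair)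
  show "G \<cdot>\<^bsub>B\<^esub> (F \<oplus>\<^bsub>B\<^esub> F') = G \<cdot>\<^bsub>B\<^esub> F \<oplus>\<^bsub>B\<^esub> G \<cdot>\<^bsub>B\<^esub> F'"
    using h by (auto simp: XY B_hom_iff B_arr_iff)
next
  fix F G G' A A' A''
  assume h: "F \<in> Hom B A A'" "G \<in> Hom B A' A''" "G' \<in> Hom B A' A''"
  obtain X e Y e' Z e'' where XY: "A = (X, e)" "A' = (Y, e')" "A'' = (Z, e'')" by (metis surj_pair)
  show "(G \<oplus>\<^bsub>B\<^esub> G') \<cdot>\<^bsub>B\<^esub> F = G \<cdot>\<^bsub>B\<^esub> F \<oplus>\<^bsub>B\<^esub> G' \<cdot>\<^bsub>B\<^esub> F"
    using h by (auto simp: XY B_hom_iff B_arr_iff)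
next
  fix F G A A' A''
  assume h: "F \<in> Hom B A A'" "G \<in> Hom B A' A''"
  obtain X e Y e' Z e'' where XY: "A = (X, e)" "A' = (Y, e')" "A'' = (Z, e'')" by (metis surj_pair)
  obtain f where f: "F = ((X, e), f, (Y, e'))" "((X, e), f, (Y, e')) \<in> Arr B"
    using h(1) by (auto simp: XY B_hom_iff)
  obtain g where g: "G = ((Y, e'), g, (Z, e''))" "((Y, e'), g, (Z, e'')) \<in> Arr B"
    using h(2) by (auto simp: XY B_hom_iff)
  note [simp] = B_arrD [OF f(2)] B_arrD [OF g(2)]
  show "G \<cdot>\<^bsub>B\<^esub> F \<in> Hom B A A''"
    by (simp add: f g XY B_hom_iff B_arr_iff)
next
  fix F G H and A A' A'' A''' :: "'o \<times> 'm"
  assume h: "F \<in> Hom B A A'" "G \<in> Hom B A' A''" "H \<in> Hom B A'' A'''"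
  then show "(H \<cdot>\<^bsub>B\<^esub> G) \<cdot>\<^bsub>B\<^esub> F = H \<cdot>\<^bsub>B\<^esub> G \<cdot>\<^bsub>B\<^esub> F"
    by (auto elim!: B_homE simp: B_arr_iff)
next
  fix F assume "F \<in> Arr B"
  then obtain X e f Y e' where "F = ((X, e), f, (Y, e'))" "((X, e), f, (Y, e')) \<in> Arr B"
    by (rule B_arrE)
  then show "Src B F \<in> Obj B" "Tgt B F \<in> Obj B" using B_arrD(14,15) by auto
next
  fix A assume "A \<in> Obj B"
  then show "Ident B A \<in> Hom B A A"
    by (cases A) (auto simp: B_hom_iff B_arr_iff eps_obj_iff)
next
  fix F A A' assume "F \<in> Hom B A A'"
  then show "Ident B A' \<cdot>\<^bsub>B\<^esub> F = F" "F \<cdot>\<^bsub>B\<^esub> Ident B A = F"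
    by (auto elim!: B_homE simp: B_arr_iff)
qed

subsection \<open>The exact structure\<close>

lemma E_iff: "(F, G) \<in> E \<longleftrightarrow> (\<exists>X e f Y e' g Z e'' s r. F = ((X, e), f, (Y, e')) \<and>
    G = ((Y, e'), g, (Z, e'')) \<and> F \<in> Arr B \<and> G \<in> Arr B \<and> biproduct C X Z Y f s r g)"
proof
  assume "(F, G) \<in> E"
  then have "F \<in> Arr B" "G \<in> Arr B" "Tgt B F = Src B G" "(forget_arr F, forget_arr G) \<in> trivial_exact C"
    by (auto simp: forget_exact_def)
  then show "\<exists>X e f Y e' g Z e'' s r. F = ((X, e), f, (Y, e')) \<and>
    G = ((Y, e'), g, (Z, e'')) \<and> F \<in> Arr B \<and> G \<in> Arr B \<and> biproduct C X Z Y f s r g"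
    by (cases F, cases G) (fastforce simp: trivial_exact_def B_arr_iff)
next
  assume "\<exists>X e f Y e' g Z e'' s r. F = ((X, e), f, (Y, e')) \<and>
    G = ((Y, e'), g, (Z, e'')) \<and> F \<in> Arr B \<and> G \<in> Arr B \<and> biproduct C X Z Y f s r g"
  then obtain X e f Y e' g Z e'' s r where F: "F = ((X, e), f, (Y, e'))" "G = ((Y, e'), g, (Z, e''))"
    "F \<in> Arr B" "G \<in> Arr B" and b: "biproduct C X Z Y f s r g" by blast
  have "(f, g) \<in> trivial_exact C" using b biproductD [OF b] unfolding trivial_exact_def by auto
  then show "(F, G) \<in> E" using F by (auto simp: forget_exact_def)
qed

text \<open>The complement \<open>T\<close> of \<open>X\<close> in \<open>Y\<close> is the cokernel, so it inherits an endomorphism, given by the corner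
  \<open>q \<cdot> e' \<cdot> s\<close> of \<open>e'\<close>.\<close>

lemma adm_mono_iff: "adm_mono E F \<longleftrightarrow> (\<exists>X e f Y e' T s r q.
    F = ((X, e), f, (Y, e')) \<and> F \<in> Arr B \<and> biproduct C X T Y f s r q)"
proof
  assume "adm_mono E F"
  then show "\<exists>X e f Y e' T s r q. F = ((X, e), f, (Y, e')) \<and> F \<in> Arr B \<and> biproduct C X T Y f s r q"
    unfolding adm_mono_def E_iff by blast
next
  assume "\<exists>X e f Y e' T s r q. F = ((X, e), f, (Y, e')) \<and> F \<in> Arr B \<and> biproduct C X T Y f s r q"
  then obtain X e f Y e' T s r q where F: "F = ((X, e), f, (Y, e'))" "((X, e), f, (Y, e')) \<in> Arr B"
    and b: "biproduct C X T Y f s r q" by blast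
  note [simp] = biproductD(1-23) [OF b] B_arrD(1-15) [OF F(2)]
  note fe = B_arrD(16,17) [OF F(2)]
  let ?d = "q \<cdot> e' \<cdot> s"
  have qd: "q \<cdot> e' = ?d \<cdot> q"
    by (rule biproduct_epi [OF b, of _ T]) (auto simp: hom_iff simp flip: fe)
  have "(T, ?d) \<in> eps_objects C n"
    by (rule nilpotent_glue [of ?d T q Y q Y s "Zero C T Y", OF _ _ _ _ _ _ _ _ qd qd])
      (auto simp: hom_iff)
  then have "((Y, e'), q, (T, ?d)) \<in> Arr B" using qd by (simp add: B_arr_iff)
  then show "adm_mono E F" using F b unfolding adm_mono_def E_iff by blast
qed

text \<open>Dually, the kernel inherits an endomorphism by restriction.\<close>

lemma adm_epi_iff: "adm_epi E G \<longleftrightarrow> (\<exists>Y e' g Z e'' T s r i.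
    G = ((Y, e'), g, (Z, e'')) \<and> G \<in> Arr B \<and> biproduct C T Z Y i s r g)"
proof
  assume "adm_epi E G"
  then show "\<exists>Y e' g Z e'' T s r i. G = ((Y, e'), g, (Z, e'')) \<and> G \<in> Arr B \<and> biproduct C T Z Y i s r g"
    unfolding adm_epi_def E_iff by blast
next
  assume "\<exists>Y e' g Z e'' T s r i. G = ((Y, e'), g, (Z, e'')) \<and> G \<in> Arr B \<and> biproduct C T Z Y i s r g"
  then obtain Y e' g Z e'' T s r i where G: "G = ((Y, e'), g, (Z, e''))" "((Y, e'), g, (Z, e'')) \<in> Arr B"
    and b: "biproduct C T Z Y i s r g" by blast
  note [simp] = biproductD(1-23) [OF b] B_arrD [OF G(2)]
  let ?d = "r \<cdot> e' \<cdot> i"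
  have di: "i \<cdot> ?d = e' \<cdot> i"
    by (rule biproduct_mono [OF b, of _ T]) (auto simp: hom_iff)
  have "(T, ?d) \<in> eps_objects C n"
    by (rule nilpotent_coglue [of ?d T r Y "Zero C Y T" Y i i, OF _ _ _ _ _ _ _ _ di di])
      (auto simp: hom_iff)
  then have "((T, ?d), i, (Y, e')) \<in> Arr B" using di by (simp add: B_arr_iff)
  then show "adm_epi E G" using G b unfolding adm_epi_def E_iff by blast
qed

lemma E_kernel:
  assumes "(F, G) \<in> E"
  shows "is_kernel B F G"
proof -
  obtain X e f Y e' g Z e'' s r where F: "F = ((X, e), f, (Y, e'))" "((X, e), f, (Y, e')) \<in> Arr B"
    and G: "G = ((Y, e'), g, (Z, e''))" "((Y, e'), g, (Z, e'')) \<in> Arr B"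
    and b: "biproduct C X Z Y f s r g" using assms unfolding E_iff by blast
  note [simp] = biproductD(1-23) [OF b] B_arrD(1-15) [OF F(2)] B_arrD(1-15) [OF G(2)]
  have "\<exists>!K. K \<in> Hom B (Src B H) (Src B F) \<and> F \<cdot>\<^bsub>B\<^esub> K = H"
    if H: "H \<in> Arr B" "Tgt B H = Src B G" "G \<cdot>\<^bsub>B\<^esub> H = Zero B (Src B H) (Tgt B G)" for H
  proof -
    obtain V d h where h: "H = ((V, d), h, (Y, e'))" "((V, d), h, (Y, e')) \<in> Arr B"
      using B_arr_tgt_ex [OF H(1), of Y e'] H(2) G by auto
    note [simp] = B_arrD(1-15) [OF h(2)]
    have gh: "g \<cdot> h = Zero C V Z" using H(3) by (simp add: h G)
    have frh: "f \<cdot> r \<cdot> h = h"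
      by (rule biproduct_mono [OF b, of _ V]) (auto simp: hom_iff gh)
    have "r \<cdot> f \<cdot> r \<cdot> h \<cdot> d = r \<cdot> f \<cdot> e \<cdot> r \<cdot> h"
      using comp_reassoc [OF frh, of d] B_arrD(16) [OF h(2)] B_arrD(17) [OF F(2), of "r \<cdot> h"] frh
      by (simp del: biproductD(20) [OF b])
    then have "r \<cdot> h \<cdot> d = e \<cdot> r \<cdot> h" by simp
    then have K: "((V, d), r \<cdot> h, (X, e)) \<in> Arr B" by (simp add: B_arr_iff)
    show ?thesis
    proof (rule ex1I [of _ "((V, d), r \<cdot> h, (X, e))"])
      fix K assume "K \<in> Hom B (Src B H) (Src B F) \<and> F \<cdot>\<^bsub>B\<^esub> K = H"
      then obtain k where k: "K = ((V, d), k, (X, e))" "K \<in> Arr B" "f \<cdot> k = h"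
        by (auto simp: F h B_hom_iff)
      note [simp] = B_arrD(1-15) [OF k(2) [unfolded k(1)]]
      have "k = r \<cdot> f \<cdot> k" by simp
      then show "K = ((V, d), r \<cdot> h, (X, e))" unfolding k(1,3) by simp
    qed (use K frh in \<open>simp add: F h B_hom_iff\<close>)
  qed
  then show ?thesis
    unfolding is_kernel_def using F G by simp
qed

lemma E_cokernel:
  assumes "(F, G) \<in> E"
  shows "is_cokernel B G F"
proof -
  obtain X e f Y e' g Z e'' s r where F: "F = ((X, e), f, (Y, e'))" "((X, e), f, (Y, e')) \<in> Arr B"
    and G: "G = ((Y, e'), g, (Z, e''))" "((Y, e'), g, (Z, e'')) \<in> Arr B"
    and b: "biproduct C X Z Y f s r g" using assms unfolding E_iff by blast
  note [simp] = biproductD(1-23) [OF b] B_arrD(1-15) [OF F(2)] B_arrD(1-15) [OF G(2)]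
  have "\<exists>!K. K \<in> Hom B (Tgt B G) (Tgt B H) \<and> K \<cdot>\<^bsub>B\<^esub> G = H"
    if H: "H \<in> Arr B" "Src B H = Tgt B F" "H \<cdot>\<^bsub>B\<^esub> F = Zero B (Src B F) (Tgt B H)" for H
  proof -
    obtain V d h where h: "H = ((Y, e'), h, (V, d))" "((Y, e'), h, (V, d)) \<in> Arr B"
      using B_arr_src_ex [OF H(1), of Y e'] H(2) F by auto
    note [simp] = B_arrD(1-15) [OF h(2)]
    have hf: "h \<cdot> f = Zero C X V" using H(3) by (simp add: h F)
    have hsg: "h \<cdot> s \<cdot> g = h"
      by (rule biproduct_epi [OF b, of _ V]) (auto simp: hom_iff hf)
    have "(h \<cdot> s \<cdot> e'') \<cdot> g = (h \<cdot> s \<cdot> g) \<cdot> e'" by (simp add: B_arrD(16) [OF G(2)])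
    also have "\<dots> = d \<cdot> h" unfolding hsg by (rule B_arrD(16) [OF h(2)])
    also have "\<dots> = d \<cdot> h \<cdot> s \<cdot> g" by (simp only: hsg)
    finally have "(h \<cdot> s \<cdot> e'') \<cdot> g = (d \<cdot> h \<cdot> s) \<cdot> g" by simp
    then have "((h \<cdot> s \<cdot> e'') \<cdot> g) \<cdot> s = ((d \<cdot> h \<cdot> s) \<cdot> g) \<cdot> s" by (simp only:)
    then have "h \<cdot> s \<cdot> e'' = d \<cdot> h \<cdot> s" by simp
    then have K: "((Z, e''), h \<cdot> s, (V, d)) \<in> Arr B" by (simp add: B_arr_iff)
    show ?thesis
    proof (rule ex1I [of _ "((Z, e''), h \<cdot> s, (V, d))"])
      fix K assume "K \<in> Hom B (Tgt B G) (Tgt B H) \<and> K \<cdot>\<^bsub>B\<^esub> G = H"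
      then obtain k where k: "K = ((Z, e''), k, (V, d))" "K \<in> Arr B" "k \<cdot> g = h"
        by (auto simp: G h B_hom_iff)
      note [simp] = B_arrD(1-15) [OF k(2) [unfolded k(1)]]
      have "k = (k \<cdot> g) \<cdot> s" by simp
      then show "K = ((Z, e''), h \<cdot> s, (V, d))" unfolding k(1,3) by simp
    qed (use K hsg in \<open>simp add: G h B_hom_iff\<close>)
  qed
  then show ?thesis
    unfolding is_cokernel_def using F G by simp
qed

lemma B_iso_ex:
  assumes "iso_arr B H" "H \<in> Hom B (X, e) (Y, e')"
  shows "\<exists>h h'. H = ((X, e), h, (Y, e')) \<and> h \<in> Hom C X Y \<and> h' \<in> Hom C Y X \<and>
    h' \<cdot> h = Ident C X \<and> h \<cdot> h' = Ident C Y"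
proof -
  obtain H' where H': "H' \<in> Hom B (Y, e') (X, e)" "H' \<cdot>\<^bsub>B\<^esub> H = Ident B (X, e)"
    "H \<cdot>\<^bsub>B\<^esub> H' = Ident B (Y, e')"
    using B.iso_arrE [OF assms] by metis
  obtain h where h: "H = ((X, e), h, (Y, e'))" "((X, e), h, (Y, e')) \<in> Arr B"
    using assms(2) by (auto simp: B_hom_iff)
  obtain h' where h': "H' = ((Y, e'), h', (X, e))" "((Y, e'), h', (X, e)) \<in> Arr B"
    using H'(1) by (auto simp: B_hom_iff)
  show ?thesis
    by (intro exI [of _ h] exI [of _ h'])
      (use H'(2,3) B_arrD(1-15) [OF h(2)] B_arrD(1-15) [OF h'(2)] in \<open>auto simp: h h' hom_iff\<close>)
qed

lemma E_iso_closed: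
  assumes FG: "(F, G) \<in> E" and F': "F' \<in> Arr B" and G': "G' \<in> Arr B" and FG': "Tgt B F' = Src B G'"
    and iso: "iso_arr B a" "iso_arr B b" "iso_arr B c"
    and h: "a \<in> Hom B (Src B F) (Src B F')" "b \<in> Hom B (Tgt B F) (Tgt B F')"
      "c \<in> Hom B (Tgt B G) (Tgt B G')"
    and sq: "b \<cdot>\<^bsub>B\<^esub> F = F' \<cdot>\<^bsub>B\<^esub> a" "c \<cdot>\<^bsub>B\<^esub> G = G' \<cdot>\<^bsub>B\<^esub> b"
  shows "(F', G') \<in> E"
proof -
  obtain X e f Y e' g Z e'' s r where F: "F = ((X, e), f, (Y, e'))" and G: "G = ((Y, e'), g, (Z, e''))"
    and bp: "biproduct C X Z Y f s r g" using FG unfolding E_iff by blast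
  obtain X' d f' Y' d' where f': "F' = ((X', d), f', (Y', d'))" "((X', d), f', (Y', d')) \<in> Arr B"
    using F' by (rule B_arrE)
  obtain g' Z' d'' where g': "G' = ((Y', d'), g', (Z', d''))" "((Y', d'), g', (Z', d'')) \<in> Arr B"
    using B_arr_src_ex [OF G', of Y' d'] FG' by (auto simp: f')
  obtain x x' where x: "a = ((X, e), x, (X', d))" "x \<in> Hom C X X'" "x' \<in> Hom C X' X"
    "x' \<cdot> x = Ident C X" "x \<cdot> x' = Ident C X'"
    using B_iso_ex [OF iso(1), of X e X' d] h(1) by (auto simp: F f')
  obtain y y' where y: "b = ((Y, e'), y, (Y', d'))" "y \<in> Hom C Y Y'" "y' \<in> Hom C Y' Y"
    "y' \<cdot> y = Ident C Y" "y \<cdot> y' = Ident C Y'"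
    using B_iso_ex [OF iso(2), of Y e' Y' d'] h(2) by (auto simp: F f')
  obtain z z' where z: "c = ((Z, e''), z, (Z', d''))" "z \<in> Hom C Z Z'" "z' \<in> Hom C Z' Z"
    "z' \<cdot> z = Ident C Z" "z \<cdot> z' = Ident C Z'"
    using B_iso_ex [OF iso(3), of Z e'' Z' d''] h(3) by (auto simp: G g')
  have "f' \<in> Hom C X' Y'" "g' \<in> Hom C Y' Z'"
    using B_arrD [OF f'(2)] B_arrD [OF g'(2)] by (auto simp: hom_iff)
  moreover have "y \<cdot> f = f' \<cdot> x" "z \<cdot> g = g' \<cdot> y"
    using sq by (simp_all add: F G f' g' x(1) y(1) z(1))
  ultimately have "biproduct C X' Z' Y' f' (y \<cdot> s \<cdot> z') (x \<cdot> r \<cdot> y') g'"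
    by (intro biproduct_iso [OF bp x(2-5) y(2-5) z(2-5)])
  then show ?thesis using f' g' unfolding E_iff by blast
qed

lemma adm_mono_comp:
  assumes F: "adm_mono E F" and G: "adm_mono E G" and FG: "Tgt B F = Src B G"
  shows "adm_mono E (G \<cdot>\<^bsub>B\<^esub> F)"
proof -
  obtain X e f Y e' T s r q where f: "F = ((X, e), f, (Y, e'))" "F \<in> Arr B"
    and b: "biproduct C X T Y f s r q" using F unfolding adm_mono_iff by blast
  obtain g Z e'' T' s' r' q' where g: "G = ((Y, e'), g, (Z, e''))" "G \<in> Arr B"
    and b': "biproduct C Y T' Z g s' r' q'" using G FG f(1) unfolding adm_mono_iff by auto
  obtain U k k' l l' where "biproduct C T T' U k k' l l'"
    using ex_biproduct [of T T'] biproductD(2) [OF b] biproductD(2) [OF b'] by auto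
  from biproduct_comp [OF b b' this] obtain s'' r'' q'' where "biproduct C X U Z (g \<cdot> f) s'' r'' q''" by blast
  moreover have "G \<cdot>\<^bsub>B\<^esub> F \<in> Arr B" by (rule B.comp_typing(1) [OF f(2) g(2) FG])
  ultimately show ?thesis unfolding adm_mono_iff using f(1) g(1) by auto
qed

lemma adm_epi_comp:
  assumes F: "adm_epi E F" and G: "adm_epi E G" and FG: "Tgt B F = Src B G"
  shows "adm_epi E (G \<cdot>\<^bsub>B\<^esub> F)"
proof -
  obtain X e f Y e' T s r i where f: "F = ((X, e), f, (Y, e'))" "F \<in> Arr B"
    and b: "biproduct C T Y X i s r f" using F unfolding adm_epi_iff by blast
  obtain g Z e'' T' s' r' i' where g: "G = ((Y, e'), g, (Z, e''))" "G \<in> Arr B"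
    and b': "biproduct C T' Z Y i' s' r' g" using G FG f(1) unfolding adm_epi_iff by auto
  obtain U k k' l l' where "biproduct C T' T U k k' l l'"
    using ex_biproduct [of T' T] biproductD(1) [OF b] biproductD(1) [OF b'] by auto
  from biproduct_swap [OF biproduct_comp [OF biproduct_swap [OF b'] biproduct_swap [OF b] this]]
  obtain s'' r'' q'' where "biproduct C U Z X s'' r'' q'' (g \<cdot> f)" by blast
  moreover have "G \<cdot>\<^bsub>B\<^esub> F \<in> Arr B" by (rule B.comp_typing(1) [OF f(2) g(2) FG])
  ultimately show ?thesis unfolding adm_epi_iff using f(1) g(1) by auto
qed

lemma adm_ident:
  assumes "A \<in> Obj B"
  shows "adm_mono E (Ident B A)" "adm_epi E (Ident B A)"
proof -
  obtain X e where A: "A = (X, e)" by (cases A)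
  obtain Z where Z: "zero_object C Z" using ex_zero_object by blast
  have X: "X \<in> Obj C" using assms by (auto simp: A eps_obj_iff)
  have I: "((X, e), Ident C X, (X, e)) \<in> Arr B" using assms by (auto simp: A B_arr_iff eps_obj_iff)
  show "adm_mono E (Ident B A)"
    unfolding adm_mono_iff using biproduct_zero [OF Z X] I by (auto simp: A)
  show "adm_epi E (Ident B A)"
    unfolding adm_epi_iff using biproduct_swap [OF biproduct_zero [OF Z X]] I by (auto simp: A)
qed

text \<open>The push-out of \<open>f : X \<rightarrow> Y\<close> with complement \<open>T\<close> along \<open>h : X \<rightarrow> V\<close> is \<open>V \<oplus> T\<close>, as in \<open>C\<close>; its
  endomorphism is the only one that makes the two structure maps intertwiners.\<close>

lemma adm_mono_pushout:
  assumes F: "adm_mono E F" and H: "H \<in> Arr B" and HF: "Src B H = Src B F"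
  shows "\<exists>H' F'. is_pushout B F H H' F' \<and> adm_mono E F'"
proof -
  obtain X e f Y e' T s r q where f: "F = ((X, e), f, (Y, e'))" "((X, e), f, (Y, e')) \<in> Arr B"
    and b: "biproduct C X T Y f s r q" using F unfolding adm_mono_iff by blast
  obtain V d h where h: "H = ((X, e), h, (V, d))" "((X, e), h, (V, d)) \<in> Arr B"
    using B_arr_src_ex [OF H, of X e] HF by (auto simp: f)
  note [simp] = biproductD(1-23) [OF b] B_arrD(1-15) [OF f(2)] B_arrD(1-15) [OF h(2)]
  obtain W i j p k where b': "biproduct C V T W i j p k" using ex_biproduct [of V T] by auto
  note [simp] = biproductD(1-23) [OF b']
  define h' where "h' = i \<cdot> h \<cdot> r \<oplus> j \<cdot> q"
  have [simp]: "h' \<in> Arr C" "Src C h' = Y" "Tgt C h' = W" by (simp_all add: h'_def)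
  have h'f: "h' \<cdot> f = i \<cdot> h" and h's: "h' \<cdot> s = j" by (simp_all add: h'_def)
  define w where "w = i \<cdot> d \<cdot> p \<oplus> h' \<cdot> e' \<cdot> s \<cdot> k"
  have [simp]: "w \<in> Arr C" "Src C w = W" "Tgt C w = W" by (simp_all add: w_def)
  have wi: "i \<cdot> d = w \<cdot> i" by (simp add: w_def)
  have wh: "h' \<cdot> e' = w \<cdot> h'"
  proof (rule biproduct_epi [OF b, of _ W])
    have "(h' \<cdot> e') \<cdot> f = i \<cdot> d \<cdot> h"
      using comp_reassoc2 [OF h'f, of e] by (simp flip: B_arrD(16) [OF f(2)] B_arrD(16) [OF h(2)])
    also have "\<dots> = (w \<cdot> h') \<cdot> f" using comp_reassoc2 [OF wi, of h] by (simp add: h'f)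
    finally show "(h' \<cdot> e') \<cdot> f = (w \<cdot> h') \<cdot> f" .
    show "(h' \<cdot> e') \<cdot> s = (w \<cdot> h') \<cdot> s" by (simp add: h's) (simp add: w_def)
  qed (auto simp: hom_iff)
  have W: "(W, w) \<in> eps_objects C n"
  proof (rule nilpotent_glue [of w W i V h' Y p "s \<cdot> k", OF _ _ _ _ _ _ _ _ wi wh])
    show "i \<cdot> p \<oplus> h' \<cdot> s \<cdot> k = Ident C W"
      using comp_reassoc [OF h's, of k] biproductD(24) [OF b'] by simp
  qed (auto simp: hom_iff)
  have arr: "((V, d), i, (W, w)) \<in> Arr B" "((Y, e'), h', (W, w)) \<in> Arr B"
    using W wi wh by (simp_all add: B_arr_iff)
  let ?F' = "((V, d), i, (W, w))" and ?H' = "((Y, e'), h', (W, w))"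
  have "\<exists>!K. K \<in> Hom B (Tgt B ?H') (Tgt B P) \<and> K \<cdot>\<^bsub>B\<^esub> ?H' = P \<and> K \<cdot>\<^bsub>B\<^esub> ?F' = Q"
    if P: "P \<in> Arr B" and Q: "Q \<in> Arr B"
      and st: "Src B P = Tgt B F" "Src B Q = Tgt B H" "Tgt B P = Tgt B Q" "P \<cdot>\<^bsub>B\<^esub> F = Q \<cdot>\<^bsub>B\<^esub> H" for P Q
  proof -
    obtain x U c where x: "P = ((Y, e'), x, (U, c))" "((Y, e'), x, (U, c)) \<in> Arr B"
      using B_arr_src_ex [OF P, of Y e'] st(1) by (auto simp: f)
    obtain y where y: "Q = ((V, d), y, (U, c))" "((V, d), y, (U, c)) \<in> Arr B"
      using B_arr_src_ex [OF Q, of V d] st(2,3) by (auto simp: h x)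
    note [simp] = B_arrD(1-15) [OF x(2)] B_arrD(1-15) [OF y(2)]
    have xf: "x \<cdot> f = y \<cdot> h" using st(4) by (simp add: f h x y)
    define z where "z = y \<cdot> p \<oplus> x \<cdot> s \<cdot> k"
    have [simp]: "z \<in> Arr C" "Src C z = W" "Tgt C z = U" by (simp_all add: z_def)
    have zi: "z \<cdot> i = y" by (simp add: z_def)
    have zh: "z \<cdot> h' = x"
      by (rule biproduct_epi [OF b, of _ U])
        (simp_all add: hom_iff h's h'f xf zi comp_reassoc [OF zi] del: biproductD(18,19) [OF b'], simp add: z_def)
    have "z \<cdot> w = c \<cdot> z"
    proof (rule biproduct_epi [OF b', of _ U])
      show "(z \<cdot> w) \<cdot> i = (c \<cdot> z) \<cdot> i"
        using comp_reassoc [OF zi, of d] B_arrD(16) [OF y(2)] by (simp add: zi flip: wi)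
      have "(z \<cdot> w) \<cdot> h' = (c \<cdot> z) \<cdot> h'"
        using comp_reassoc [OF zh, of e'] B_arrD(16) [OF x(2)] by (simp add: zh flip: wh)
      then have "((z \<cdot> w) \<cdot> h') \<cdot> s = ((c \<cdot> z) \<cdot> h') \<cdot> s" by (simp only:)
      then show "(z \<cdot> w) \<cdot> j = (c \<cdot> z) \<cdot> j" by (simp add: h's)
    qed (auto simp: hom_iff)
    then have K: "((W, w), z, (U, c)) \<in> Arr B" using W by (simp add: B_arr_iff)
    show ?thesis
    proof (rule ex1I [of _ "((W, w), z, (U, c))"])
      fix K assume "K \<in> Hom B (Tgt B ?H') (Tgt B P) \<and> K \<cdot>\<^bsub>B\<^esub> ?H' = P \<and> K \<cdot>\<^bsub>B\<^esub> ?F' = Q"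
      then obtain m where m: "K = ((W, w), m, (U, c))" "K \<in> Arr B" "m \<cdot> h' = x" "m \<cdot> i = y"
        by (auto simp: x y B_hom_iff)
      note [simp] = B_arrD(1-15) [OF m(2) [unfolded m(1)]]
      have "m = z"
      proof (rule biproduct_epi [OF b', of _ U])
        have "m \<cdot> h' \<cdot> s = z \<cdot> h' \<cdot> s"
          using comp_reassoc [OF m(3), of s] comp_reassoc [OF zh, of s] by simp
        then show "m \<cdot> j = z \<cdot> j" by (simp add: h's)
      qed (auto simp: hom_iff m(4) zi)
      then show "K = ((W, w), z, (U, c))" by (simp add: m)
    qed (use K zi zh in \<open>simp add: x y B_hom_iff\<close>)
  qed
  then have "is_pushout B F H ?H' ?F'"
    unfolding is_pushout_def using f h arr by (simp add: h'f)
  moreover have "adm_mono E ?F'" unfolding adm_mono_iff using arr b' by blast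
  ultimately show ?thesis by blast
qed

text \<open>Dually, the pull-back is the sum of \<open>V\<close> and the kernel \<open>T\<close>; its endomorphism is forced by the two
  projections.\<close>

lemma adm_epi_pullback:
  assumes F: "adm_epi E F" and H: "H \<in> Arr B" and HF: "Tgt B H = Tgt B F"
  shows "\<exists>H' F'. is_pullback B F H H' F' \<and> adm_epi E F'"
proof -
  obtain Y e' f X e T s r q where f: "F = ((Y, e'), f, (X, e))" "((Y, e'), f, (X, e)) \<in> Arr B"
    and b: "biproduct C T X Y q s r f" using F unfolding adm_epi_iff by blast
  obtain V d h where h: "H = ((V, d), h, (X, e))" "((V, d), h, (X, e)) \<in> Arr B"
    using B_arr_tgt_ex [OF H, of X e] HF by (auto simp: f)
  note [simp] = biproductD(1-23) [OF b] B_arrD(1-15) [OF f(2)] B_arrD(1-15) [OF h(2)]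
  note fe = B_arrD(16,17) [OF f(2)] and he = B_arrD(16,17) [OF h(2)]
  obtain W k i j p where b': "biproduct C T V W k i j p" using ex_biproduct [of T V] by auto
  note [simp] = biproductD(1-23) [OF b']
  define h' where "h' = s \<cdot> h \<cdot> p \<oplus> q \<cdot> j"
  have [simp]: "h' \<in> Arr C" "Src C h' = W" "Tgt C h' = Y" by (simp_all add: h'_def)
  have fh': "f \<cdot> h' = h \<cdot> p" and rh': "r \<cdot> h' = j" by (simp_all add: h'_def)
  define w where "w = i \<cdot> d \<cdot> p \<oplus> k \<cdot> r \<cdot> e' \<cdot> h'"
  have [simp]: "w \<in> Arr C" "Src C w = W" "Tgt C w = W" by (simp_all add: w_def)
  have pw: "p \<cdot> w = d \<cdot> p" and jw: "j \<cdot> w = r \<cdot> e' \<cdot> h'" by (simp_all add: w_def)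
  have hw: "h' \<cdot> w = e' \<cdot> h'"
  proof (rule biproduct_mono [OF b, of _ W])
    have "f \<cdot> e' \<cdot> h' = e \<cdot> h \<cdot> p" using fe by (simp add: fh')
    also have "\<dots> = h \<cdot> p \<cdot> w" using he(2) [of p] by (simp add: pw)
    also have "\<dots> = f \<cdot> h' \<cdot> w" using comp_reassoc2 [OF fh', of w] by simp
    finally show "f \<cdot> h' \<cdot> w = f \<cdot> e' \<cdot> h'" by simp
    show "r \<cdot> h' \<cdot> w = r \<cdot> e' \<cdot> h'" using comp_reassoc [OF rh', of w] by (simp add: jw)
  qed (auto simp: hom_iff)
  have W: "(W, w) \<in> eps_objects C n"
  proof (rule nilpotent_coglue [of w W "k \<cdot> r" Y i V h' p, OF _ _ _ _ _ _ _ _ hw pw])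
    show "(k \<cdot> r) \<cdot> h' \<oplus> i \<cdot> p = Ident C W"
      using biproductD(24) [OF b'] by (simp add: rh')
  qed (auto simp: hom_iff)
  have arr: "((W, w), p, (V, d)) \<in> Arr B" "((W, w), h', (Y, e')) \<in> Arr B"
    using W pw hw by (simp_all add: B_arr_iff)
  let ?F' = "((W, w), p, (V, d))" and ?H' = "((W, w), h', (Y, e'))"
  have "\<exists>!K. K \<in> Hom B (Src B P) (Src B ?H') \<and> ?H' \<cdot>\<^bsub>B\<^esub> K = P \<and> ?F' \<cdot>\<^bsub>B\<^esub> K = Q"
    if P: "P \<in> Arr B" and Q: "Q \<in> Arr B"
      and st: "Tgt B P = Src B F" "Tgt B Q = Src B H" "Src B P = Src B Q" "F \<cdot>\<^bsub>B\<^esub> P = H \<cdot>\<^bsub>B\<^esub> Q" for P Q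
  proof -
    obtain x U c where x: "P = ((U, c), x, (Y, e'))" "((U, c), x, (Y, e')) \<in> Arr B"
      using B_arr_tgt_ex [OF P, of Y e'] st(1) by (auto simp: f)
    obtain y where y: "Q = ((U, c), y, (V, d))" "((U, c), y, (V, d)) \<in> Arr B"
      using B_arr_tgt_ex [OF Q, of V d] st(2,3) by (auto simp: h x)
    note [simp] = B_arrD(1-15) [OF x(2)] B_arrD(1-15) [OF y(2)]
    note xc = B_arrD(16) [OF x(2)] and yc = B_arrD(16) [OF y(2)]
    have fx: "f \<cdot> x = h \<cdot> y" using st(4) by (simp add: f h x y)
    define z where "z = i \<cdot> y \<oplus> k \<cdot> r \<cdot> x"
    have [simp]: "z \<in> Arr C" "Src C z = U" "Tgt C z = W" by (simp_all add: z_def)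
    have pz: "p \<cdot> z = y" and jz: "j \<cdot> z = r \<cdot> x" by (simp_all add: z_def)
    have hz: "h' \<cdot> z = x"
    proof (rule biproduct_mono [OF b, of _ U])
      show "f \<cdot> h' \<cdot> z = f \<cdot> x" using comp_reassoc2 [OF fh', of z] by (simp add: pz fx)
      show "r \<cdot> h' \<cdot> z = r \<cdot> x" using comp_reassoc [OF rh', of z] by (simp add: jz)
    qed (auto simp: hom_iff)
    have "w \<cdot> z = z \<cdot> c"
    proof (rule biproduct_mono [OF b', of _ U])
      show "p \<cdot> w \<cdot> z = p \<cdot> z \<cdot> c"
        using comp_reassoc2 [OF pw, of z] comp_reassoc [OF pz, of c] yc by (simp add: pz)
      show "j \<cdot> w \<cdot> z = j \<cdot> z \<cdot> c"
        using comp_reassoc [OF jw, of z] comp_reassoc [OF jz, of c] xc by (simp add: hz)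
    qed (auto simp: hom_iff)
    then have K: "((U, c), z, (W, w)) \<in> Arr B" using W by (simp add: B_arr_iff)
    show ?thesis
    proof (rule ex1I [of _ "((U, c), z, (W, w))"])
      fix K assume "K \<in> Hom B (Src B P) (Src B ?H') \<and> ?H' \<cdot>\<^bsub>B\<^esub> K = P \<and> ?F' \<cdot>\<^bsub>B\<^esub> K = Q"
      then obtain m where m: "K = ((U, c), m, (W, w))" "K \<in> Arr B" "h' \<cdot> m = x" "p \<cdot> m = y"
        by (auto simp: x y B_hom_iff)
      note [simp] = B_arrD(1-15) [OF m(2) [unfolded m(1)]]
      have "m = z"
      proof (rule biproduct_mono [OF b', of _ U])
        have "j \<cdot> m = r \<cdot> h' \<cdot> m" using comp_reassoc [OF rh', of m] by simp
        also have "\<dots> = j \<cdot> z" by (simp add: m(3) jz)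
        finally show "j \<cdot> m = j \<cdot> z" .
      qed (auto simp: hom_iff m(4) pz)
      then show "K = ((U, c), z, (W, w))" by (simp add: m)
    qed (use K pz hz in \<open>simp add: x y B_hom_iff\<close>)
  qed
  then have "is_pullback B F H ?H' ?F'"
    unfolding is_pullback_def using f h arr by (simp add: fh')
  moreover have "adm_epi E ?F'" unfolding adm_epi_iff using arr b' by blast
  ultimately show ?thesis by blast
qed

lemma exact: "exact_category B E"
proof (intro exact_category.intro exact_category_axioms.intro)
  show "additive_category B" ..
  fix F G assume "(F, G) \<in> E"
  then show "is_kernel B F G \<and> is_cokernel B G F" using E_kernel E_cokernel by blast
qed (fact E_iso_closed adm_ident adm_mono_comp adm_epi_comp adm_mono_pushout adm_epi_pullback)+

subsection \<open>Projective and injective objects\<close>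

text \<open>Higman's criterion for relative projectivity over \<open>C\<close>.\<close>

definition trace_split :: "'o \<times> 'm \<Rightarrow> bool" where
  "trace_split A \<longleftrightarrow> A \<in> eps_objects C n \<and>
     (\<exists>t \<in> Hom C (fst A) (fst A). trace (fst A) (snd A) (fst A) (snd A) t n = Ident C (fst A))"

text \<open>An extension of \<open>g\<close> along \<open>f\<close> in \<open>C\<close> is \<open>g \<cdot> r\<close>, with \<open>r\<close> a retraction of \<open>f\<close>. The trace of \<open>t \<cdot> g \<cdot> r\<close> commutes
  with the endomorphisms, and on \<open>f\<close> it is \<open>N(t \<cdot> g) = N(t) \<cdot> g = g\<close>.\<close>

lemma trace_split_injective:
  assumes "trace_split A"
  shows "injective_obj B E A"
proof -
  obtain W d where A: "A = (W, d)" by (cases A)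
  obtain t where W: "(W, d) \<in> eps_objects C n" and t: "t \<in> Hom C W W" "trace W d W d t n = Ident C W"
    using assms by (auto simp: trace_split_def A)
  note [simp] = W [unfolded eps_obj_iff] homD [OF t(1)] t(2)
  have "\<exists>H \<in> Hom B (Tgt B F) (W, d). H \<cdot>\<^bsub>B\<^esub> F = G"
    if F: "adm_mono E F" and G: "G \<in> Hom B (Src B F) (W, d)" for F G
  proof -
    obtain X e f Y e' T s r q where f: "F = ((X, e), f, (Y, e'))" "((X, e), f, (Y, e')) \<in> Arr B"
      and b: "biproduct C X T Y f s r q" using F unfolding adm_mono_iff by blast
    obtain g where g: "G = ((X, e), g, (W, d))" "((X, e), g, (W, d)) \<in> Arr B"
      using G by (auto simp: f B_hom_iff)
    note [simp] = biproductD(1-23) [OF b] B_arrD(1-15) [OF f(2)] B_arrD(1-15) [OF g(2)]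
    let ?h = "trace Y e' W d (t \<cdot> g \<cdot> r) n"
    have "?h \<cdot> e' = d \<cdot> ?h"
      by (rule trace_intertwine) (auto simp: hom_iff)
    then have H: "((Y, e'), ?h, (W, d)) \<in> Arr B" by (simp add: B_arr_iff)
    have "?h \<cdot> f = trace X e W d ((t \<cdot> g \<cdot> r) \<cdot> f) n"
      by (rule trace_comp_right [OF _ _ _ _ _ B_arrD(16) [OF f(2)]]) (auto simp: hom_iff)
    also have "\<dots> = trace X e W d (t \<cdot> g) n" by simp
    also have "\<dots> = trace W d W d t n \<cdot> g"
      by (rule trace_comp_right [OF _ _ _ _ _ B_arrD(16) [OF g(2)], symmetric]) (auto simp: hom_iff)
    finally have "?h \<cdot> f = g" by simp
    then show ?thesis using H by (intro bexI [of _ "((Y, e'), ?h, (W, d))"]) (auto simp: f g B_hom_iff)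
  qed
  then show ?thesis using W unfolding injective_obj_def A by auto
qed

text \<open>Dually, with a section \<open>s\<close> of \<open>f\<close> in \<open>C\<close> and the trace of \<open>s \<cdot> g \<cdot> t\<close>.\<close>

lemma trace_split_projective:
  assumes "trace_split A"
  shows "projective_obj B E A"
proof -
  obtain W d where A: "A = (W, d)" by (cases A)
  obtain t where W: "(W, d) \<in> eps_objects C n" and t: "t \<in> Hom C W W" "trace W d W d t n = Ident C W"
    using assms by (auto simp: trace_split_def A)
  note [simp] = W [unfolded eps_obj_iff] homD [OF t(1)] t(2)
  have "\<exists>H \<in> Hom B (W, d) (Src B F). F \<cdot>\<^bsub>B\<^esub> H = G"
    if F: "adm_epi E F" and G: "G \<in> Hom B (W, d) (Tgt B F)" for F G
  proof -
    obtain Y e' f X e T s r q where f: "F = ((Y, e'), f, (X, e))" "((Y, e'), f, (X, e)) \<in> Arr B"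
      and b: "biproduct C T X Y q s r f" using F unfolding adm_epi_iff by blast
    obtain g where g: "G = ((W, d), g, (X, e))" "((W, d), g, (X, e)) \<in> Arr B"
      using G by (auto simp: f B_hom_iff)
    note [simp] = biproductD(1-23) [OF b] B_arrD(1-15) [OF f(2)] B_arrD(1-15) [OF g(2)]
    let ?h = "trace W d Y e' (s \<cdot> g \<cdot> t) n"
    have "?h \<cdot> d = e' \<cdot> ?h"
      by (rule trace_intertwine) (auto simp: hom_iff)
    then have H: "((W, d), ?h, (Y, e')) \<in> Arr B" by (simp add: B_arr_iff)
    have "f \<cdot> ?h = trace W d X e (f \<cdot> s \<cdot> g \<cdot> t) n"
      by (rule trace_comp_left [OF _ _ _ _ _ B_arrD(16) [OF f(2)]]) (auto simp: hom_iff)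
    also have "\<dots> = trace W d X e (g \<cdot> t) n" by simp
    also have "\<dots> = g \<cdot> trace W d W d t n"
      by (rule trace_comp_left [OF _ _ _ _ _ B_arrD(16) [OF g(2)], symmetric]) (auto simp: hom_iff)
    finally have "f \<cdot> ?h = g" by simp
    then show ?thesis using H by (intro bexI [of _ "((W, d), ?h, (Y, e'))"]) (auto simp: f g B_hom_iff)
  qed
  then show ?thesis using W unfolding projective_obj_def A by auto
qed

text \<open>If \<open>N(t) = 1\<close> on \<open>A\<close>, then \<open>N(g \<cdot> t \<cdot> f) = g \<cdot> N(t) \<cdot> f = 1\<close> on the retract.\<close>

lemma trace_split_retract:
  assumes "trace_split A" "F \<in> Hom B A' A" "G \<in> Hom B A A'" "G \<cdot>\<^bsub>B\<^esub> F = Ident B A'"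
  shows "trace_split A'"
proof -
  obtain X e f W d where f: "A' = (X, e)" "A = (W, d)" "F = ((X, e), f, (W, d))"
    "((X, e), f, (W, d)) \<in> Arr B" using assms(2) by (rule B_homE)
  obtain g where g: "G = ((W, d), g, (X, e))" "((W, d), g, (X, e)) \<in> Arr B"
    using assms(3) by (auto simp: f B_hom_iff)
  have gf: "g \<cdot> f = Ident C X" using assms(4) by (simp add: f g)
  obtain t where t: "t \<in> Hom C W W" "trace W d W d t n = Ident C W"
    using assms(1) by (auto simp: trace_split_def f)
  note [simp] = B_arrD(1-15) [OF f(4)] B_arrD(1-15) [OF g(2)] homD [OF t(1)]
  have "trace X e X e (g \<cdot> t \<cdot> f) n = g \<cdot> trace X e W d (t \<cdot> f) n"
    by (rule trace_comp_left [OF _ _ _ _ _ B_arrD(16) [OF g(2)], symmetric]) (auto simp: hom_iff)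
  also have "trace X e W d (t \<cdot> f) n = trace W d W d t n \<cdot> f"
    by (rule trace_comp_right [OF _ _ _ _ _ B_arrD(16) [OF f(4)], symmetric]) (auto simp: hom_iff)
  finally have "trace X e X e (g \<cdot> t \<cdot> f) n = Ident C X" using t(2) gf by simp
  then show ?thesis by (auto simp: trace_split_def f hom_iff intro!: bexI [of _ "g \<cdot> t \<cdot> f"])
qed

text \<open>The embedding \<open>N(u)\<close> of \<open>X\<close> into the free object has the retraction \<open>c\<close> in \<open>C\<close>, and the projection \<open>N(c)\<close>
  onto \<open>X\<close> has the section \<open>u\<close>. Both have complements since idempotents split.\<close>

lemma enough_trace_split:
  assumes "idempotent_complete C" "n > 0" "A \<in> Obj B"
  shows "\<exists>F. adm_mono E F \<and> Src B F = A \<and> trace_split (Tgt B F)"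
    and "\<exists>G. adm_epi E G \<and> Tgt B G = A \<and> trace_split (Src B G)"
proof -
  obtain X e where A: "A = (X, e)" by (cases A)
  have X: "(X, e) \<in> eps_objects C n" using assms(3) by (simp add: A)
  note [simp] = X [unfolded eps_obj_iff]
  obtain m where n: "n = Suc m" using assms(2) by (cases n) auto
  obtain W d u c where F: "free_on X m W d u c" using free_ex [of X m] by auto
  have h: "d \<in> Hom C W W" "u \<in> Hom C X W" "c \<in> Hom C W X"
    and nil: "endo_pow C W d n = Zero C W W"
    and orth: "\<And>k. k < m \<Longrightarrow> c \<cdot> endo_pow C W d k \<cdot> u = Zero C X X" "c \<cdot> endo_pow C W d m \<cdot> u = Ident C X"
    and tr: "trace W d W d (u \<cdot> c) n = Ident C W"
    using F unfolding free_on_def n by blast+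
  note [simp] = h(1-3) [unfolded hom_iff]
  have W: "(W, d) \<in> eps_objects C n" using nil by (simp add: eps_obj_iff)
  have split: "trace_split (W, d)"
    using W tr by (auto simp: trace_split_def hom_iff intro!: bexI [of _ "u \<cdot> c"])
  let ?u = "trace X e W d u n" and ?c = "trace W d X e c n"
  have eH: "e \<in> Hom C X X" by (auto simp: hom_iff)
  have cu: "c \<cdot> ?u = Ident C X"
    using free_counit_trace [OF h orth, of "Ident C X" X e] eH n by (simp add: hom_iff del: trace.simps)
  have uc: "?c \<cdot> u = Ident C X"
    using free_trace_unit [OF h orth, of "Ident C X" X e] eH n by (simp add: hom_iff del: trace.simps)
  have "?u \<cdot> e = d \<cdot> ?u" "?c \<cdot> d = e \<cdot> ?c"
    by (rule trace_intertwine; use nil in \<open>auto simp: hom_iff\<close>)+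
  then have arr: "((X, e), ?u, (W, d)) \<in> Arr B" "((W, d), ?c, (X, e)) \<in> Arr B"
    using X W by (simp_all add: B_arr_iff)
  have "\<exists>T s q. biproduct C X T W ?u s c q"
    by (rule split_mono_biproduct [OF assms(1)]) (auto simp: hom_iff cu)
  then have "adm_mono E ((X, e), ?u, (W, d))" using arr(1) unfolding adm_mono_iff by blast
  then show "\<exists>F. adm_mono E F \<and> Src B F = A \<and> trace_split (Tgt B F)"
    using split by (intro exI [of _ "((X, e), ?u, (W, d))"]) (simp add: A)
  have "\<exists>T s q. biproduct C X T W u s ?c q"
    by (rule split_mono_biproduct [OF assms(1)]) (auto simp: hom_iff uc)
  then have "adm_epi E ((W, d), ?c, (X, e))"
    using arr(2) biproduct_swap unfolding adm_epi_iff by blast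
  then show "\<exists>G. adm_epi E G \<and> Tgt B G = A \<and> trace_split (Src B G)"
    using split by (intro exI [of _ "((W, d), ?c, (X, e))"]) (simp add: A)
qed

text \<open>A projective object is a retract of a free one, and so is an injective object; both are therefore
  characterised by the trace criterion.\<close>

theorem frobenius:
  assumes ic: "idempotent_complete C" and n: "n > 0"
  shows "frobenius_category B E"
proof -
  note mono = enough_trace_split(1) [OF ic n] and epi = enough_trace_split(2) [OF ic n]
  have proj: "projective_obj B E A \<longleftrightarrow> trace_split A" for A
  proof
    assume P: "projective_obj B E A"
    then have A: "A \<in> Obj B" by (simp add: projective_obj_def)
    obtain G where G: "adm_epi E G" "Tgt B G = A" "trace_split (Src B G)" using epi [OF A] by blast
    obtain s where "s \<in> Hom B A (Src B G)" "G \<cdot>\<^bsub>B\<^esub> s = Ident B A"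
      using P G B.ident_hom [OF A] unfolding projective_obj_def by metis
    moreover have "G \<in> Hom B (Src B G) A" using G(1,2) unfolding adm_epi_iff by (auto simp: Hom_def)
    ultimately show "trace_split A" using trace_split_retract G(3) by blast
  qed (rule trace_split_projective)
  have inj: "injective_obj B E A \<longleftrightarrow> trace_split A" for A
  proof
    assume I: "injective_obj B E A"
    then have A: "A \<in> Obj B" by (simp add: injective_obj_def)
    obtain F where F: "adm_mono E F" "Src B F = A" "trace_split (Tgt B F)" using mono [OF A] by blast
    obtain r where "r \<in> Hom B (Tgt B F) A" "r \<cdot>\<^bsub>B\<^esub> F = Ident B A"
      using I F B.ident_hom [OF A] unfolding injective_obj_def by metis
    moreover have "F \<in> Hom B A (Tgt B F)" using F(1,2) unfolding adm_mono_iff by (auto simp: Hom_def)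
    ultimately show "trace_split A" using trace_split_retract F(3) by blast
  qed (rule trace_split_injective)
  show ?thesis
    unfolding frobenius_category_def enough_projectives_def enough_injectives_def proj inj
    using exact mono epi by blast
qed

end

theorem proposition4p2:
  fixes C :: "('o, 'm) precat" and n :: nat
  assumes "n \<ge> 2"
    and "additive_category C"
    and "idempotent_complete C"
  defines "B \<equiv> eps_cat C n"
    and "E \<equiv> forget_exact C n (trivial_exact C)"
  shows "frobenius_category B E \<and>
    (\<forall>\<mu> \<pi>. injective_choice B E \<mu> \<pi> \<longrightarrow>
       triangulated_category (stable_cat B E) (susp_obj B \<pi>) (susp_arr B E \<mu> \<pi>)
         (happel_triangles B E \<mu> \<pi>))"
proof -
  interpret nilpotent_category C n
    using assms(2) by (simp add: nilpotent_category_def)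
  have frob: "frobenius_category B E"
    unfolding B_def E_def by (rule frobenius) (use assms in auto)
  moreover have "triangulated_category (stable_cat B E) (susp_obj B \<pi>) (susp_arr B E \<mu> \<pi>)
      (happel_triangles B E \<mu> \<pi>)" if "injective_choice B E \<mu> \<pi>" for \<mu> \<pi>
  proof -
    have "frobenius_choice B E \<mu> \<pi>"
      using frob that
      by (auto intro!: frobenius_choice.intro frobenius_choice_axioms.intro simp: frobenius_category_def)
    then show ?thesis by (rule frobenius_choice.stable_triangulated)
  qed
  ultimately show ?thesis by blast
qed

end
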